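(* Let $V$ be a nondegenerate nonlocal vertex algebra. Then $B(V)$ (an associative subalgebra of $\mathrm{Hom}_{\mathbb{C}}(V,V\otimes\mathbb{C}((x)))$ with derivation $\partial=\frac{d}{dx}$) is a differential bialgebra with comultiplication $\Delta$ and counit $\varepsilon$ uniquely determined by $$a(x)\mathbf{1}=\varepsilon(a(x))\mathbf{1},\qquad \Delta(a(x))=\sum a_{(1)}(x)\otimes a_{(2)}(x)\qquad\text{for } a(x)\in B(V),$$ where $\sum a_{(1)}(x)\otimes a_{(2)}(x)\in B(V)\otimes B(V)$ is such that $a(x_1)Y(v,x_2)=\sum Y(a_{(1)}(x_1-x_2)v,x_2)\,a_{(2)}(x_1)$ for all $v\in V$. Furthermore, $$\mathrm{PDer}^{-}(V)=\{a\in B(V)\mid \Delta(a)=a\otimes 1+1\otimes a\},$$ $$\mathrm{PEnd}^{-}(V)=\{a\in B(V)\mid a\neq 0,\ \Delta(a)=a\otimes a\}.$$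
   Context: All vector spaces are over $\mathbb{C}$; $(x_1\pm x_2)^n$ is expanded in nonnegative powers of the second variable. A nonlocal vertex algebra is a vector space $V$ with a linear map $Y(\cdot,x):V\to\mathrm{Hom}(V,V((x)))$, $v\mapsto Y(v,x)=\sum_{n\in\mathbb{Z}}v_nx^{-n-1}$, and a vacuum vector $\mathbf{1}\in V$ such that $Y(\mathbf{1},x)=1$; $Y(v,x)\mathbf{1}\in V[[x]]$ with $\lim_{x\to0}Y(v,x)\mathbf{1}=v$; and for all $u,v,w\in V$ there is a nonnegative integer $l$ with $(x_0+x_2)^lY(u,x_0+x_2)Y(v,x_2)w=(x_0+x_2)^lY(Y(u,x_0)v,x_2)w$. $V$ is nondegenerate if for every positive integer $n$ the linear map $Z_n:V^{\otimes n}\otimes\mathbb{C}((x_1))\cdots((x_n))\to V((x_1))\cdots((x_n))$, $v_{(1)}\otimes\cdots\otimes v_{(n)}\otimes f\mapsto fY(v_{(1)},x_1)\cdots Y(v_{(n)},x_n)\mathbf{1}$, is injective. $\mathrm{Hom}_{\mathbb{C}}(V,V\otimes\mathbb{C}((x)))$ is identified with $\mathrm{End}_{\mathbb{C}((x))}(V\otimes\mathbb{C}((x)))$, an associative algebra with the $\mathbb{C}$-linear derivation $\partial=d/dx$; its elements are written $a(x)$. $Y$ is extended linearly over scalar Laurent series. A subset $U$ is $\Delta$-closed if for any $a(x)\in U$ there exist $a_{(1i)}(x),a_{(2i)}(x)\in U$, $i=1,\dots,r$, with $a(x_1)Y(v,x_2)=\sum_{i=1}^rY(a_{(1i)}(x_1-x_2)v,x_2)a_{(2i)}(x_1)$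 for all $v\in V$. $B(V)$ is the sum of all $\Delta$-closed subspaces $U$ of $\mathrm{Hom}(V,V\otimes\mathbb{C}((x)))$ with $a(x)\mathbf{1}\in\mathbb{C}\mathbf{1}$ for all $a(x)\in U$. (For any $V$, $B(V)$ is a $\Delta$-closed subalgebra stable under $\partial$.) A differential bialgebra is a bialgebra $(B,\Delta,\varepsilon)$ (coassociative, counital, $\Delta$ and $\varepsilon$ algebra homomorphisms) with a derivation $\partial$ such that $\varepsilon\circ\partial=0$ and $\Delta\partial=(\partial\otimes1+1\otimes\partial)\Delta$. $\mathrm{PDer}^{-}(V)$ is the space of $\psi(x)\in\mathrm{Hom}_{\mathbb{C}}(V,V\otimes\mathbb{C}((x)))$ with $[\psi(x_1),Y(v,x_2)]=Y(\psi(x_1-x_2)v,x_2)$ for all $v\in V$. $\mathrm{PEnd}^{-}(V)$ is the set of $\phi(x)\in\mathrm{Hom}_{\mathbb{C}}(V,V\otimes\mathbb{C}((x)))$ with $\phi(x)\mathbf{1}=\mathbf{1}$ and $\phi(x_1)Y(v,x_2)=Y(\phi(x_1-x_2)v,x_2)\phi(x_1)$ for all $v\in V$. *)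

theory Defs
  imports
    "HOL-Computational_Algebra.Computational_Algebra"
    "HOL-Library.Poly_Mapping"
    "HOL-Library.Function_Algebras"
begin

notation fls_nth (infixl \<open>$$\<close> 75)

section \<open>Complex vector spaces and algebras\<close>

class complex_vector = ab_group_add +
  fixes scaleC :: "complex \<Rightarrow> 'a \<Rightarrow> 'a" (infixr \<open>*\<^sub>C\<close> 75)
  assumes scaleC_add_right: "c *\<^sub>C (x + y) = c *\<^sub>C x + c *\<^sub>C y"
    and scaleC_add_left: "(c + d) *\<^sub>C x = c *\<^sub>C x + d *\<^sub>C x"
    and scaleC_scaleC: "c *\<^sub>C d *\<^sub>C x = (c * d) *\<^sub>C x"
    and scaleC_one: "1 *\<^sub>C x = x"

global_interpretation cvec: vector_space "scaleC :: complex \<Rightarrow> 'a \<Rightarrow> 'a::complex_vector"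
  by unfold_locales (rule scaleC_add_right scaleC_add_left scaleC_scaleC scaleC_one)+

abbreviation clinear :: "('a::complex_vector \<Rightarrow> 'b::complex_vector) \<Rightarrow> bool" where
  "clinear \<equiv> Vector_Spaces.linear scaleC scaleC"

definition cbilinear :: "('a::complex_vector \<Rightarrow> 'b::complex_vector \<Rightarrow> 'c::complex_vector) \<Rightarrow> bool" where
  "cbilinear f \<longleftrightarrow> (\<forall>a. clinear (f a)) \<and> (\<forall>b. clinear (\<lambda>a. f a b))"

definition clinear_on :: "'a::complex_vector set \<Rightarrow> ('a \<Rightarrow> 'b::complex_vector) \<Rightarrow> bool" where
  "clinear_on S f \<longleftrightarrow>
     (\<forall>x\<in>S. \<forall>y\<in>S. f (x + y) = f x + f y) \<and> (\<forall>c. \<forall>x\<in>S. f (c *\<^sub>C x) = c *\<^sub>C f x)"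

definition cbilinear_on ::
  "'a::complex_vector set \<Rightarrow> 'b::complex_vector set \<Rightarrow> ('a \<Rightarrow> 'b \<Rightarrow> 'c::complex_vector) \<Rightarrow> bool" where
  "cbilinear_on S T f \<longleftrightarrow> (\<forall>a\<in>S. clinear_on T (f a)) \<and> (\<forall>b\<in>T. clinear_on S (\<lambda>a. f a b))"

(* Algebras are associative and unital.  1 \<noteq> 0 is not required, so the zero algebra
   (which is End of the zero space) is included. *)
class complex_algebra_1 = complex_vector + ring + monoid_mult +
  assumes mult_scaleC_left: "(c *\<^sub>C x) * y = c *\<^sub>C (x * y)"
    and mult_scaleC_right: "x * (c *\<^sub>C y) = c *\<^sub>C (x * y)"

lemma clinearI:
  assumes "\<And>x y. f (x + y) = f x + f y" "\<And>c x. f (c *\<^sub>C x) = c *\<^sub>C f x"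
  shows "clinear f"
  by unfold_locales (use assms in auto)

lemma clinear_iff:
  "clinear f \<longleftrightarrow> (\<forall>x y. f (x + y) = f x + f y) \<and> (\<forall>c x. f (c *\<^sub>C x) = c *\<^sub>C f x)"
  by (metis clinearI module_hom.add module_hom.scale Vector_Spaces.module_hom_eq_linear)

instantiation complex :: complex_vector
begin
definition scaleC_complex :: "complex \<Rightarrow> complex \<Rightarrow> complex" where
  "scaleC_complex = (*)"
instance by standard (simp_all add: scaleC_complex_def algebra_simps)
end

instantiation "fun" :: (type, complex_vector) complex_vector
begin
definition scaleC_fun :: "complex \<Rightarrow> ('a \<Rightarrow> 'b) \<Rightarrow> 'a \<Rightarrow> 'b" where
  "scaleC_fun c f = (\<lambda>x. c *\<^sub>C f x)"
instance
  by standard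
     (simp_all add: scaleC_fun_def fun_eq_iff cvec.scale_right_distrib cvec.scale_left_distrib)
end

instantiation poly_mapping :: (type, complex_vector) complex_vector
begin
lift_definition scaleC_poly_mapping :: "complex \<Rightarrow> ('a \<Rightarrow>\<^sub>0 'b) \<Rightarrow> 'a \<Rightarrow>\<^sub>0 'b"
  is "\<lambda>c f x. c *\<^sub>C f x"
  by (erule finite_subset[rotated]) auto
instance
  by standard
     (transfer, simp add: fun_eq_iff cvec.scale_right_distrib cvec.scale_left_distrib)+
end

instantiation fls :: (complex_vector) complex_vector
begin
definition scaleC_fls :: "complex \<Rightarrow> 'a fls \<Rightarrow> 'a fls" where
  "scaleC_fls c f = Abs_fls (\<lambda>n. c *\<^sub>C (f $$ n))"
lemma fls_scaleC_nth [simp]: "(c *\<^sub>C (f :: 'a fls)) $$ n = c *\<^sub>C (f $$ n)"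
  unfolding scaleC_fls_def
  by (subst nth_Abs_fls_lower_bound[where N = "fls_subdegree f"]) auto
instance
  by standard
     (simp_all add: fls_eq_iff cvec.scale_right_distrib cvec.scale_left_distrib)
end


subsection \<open>Free vector spaces\<close>

definition free_lift :: "('i \<Rightarrow> 'c::complex_vector) \<Rightarrow> ('i \<Rightarrow>\<^sub>0 complex) \<Rightarrow> 'c" where
  "free_lift \<phi> p = (\<Sum>k\<in>Poly_Mapping.keys p. Poly_Mapping.lookup p k *\<^sub>C \<phi> k)"

abbreviation free_gen :: "'i \<Rightarrow> ('i \<Rightarrow>\<^sub>0 complex)" where
  "free_gen k \<equiv> Poly_Mapping.single k 1"

lemma lookup_scaleC [simp]:
  "Poly_Mapping.lookup (c *\<^sub>C p) k = c *\<^sub>C Poly_Mapping.lookup p k"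
  by transfer simp

lemma free_lift_superset:
  assumes "finite K" "Poly_Mapping.keys p \<subseteq> K"
  shows "free_lift \<phi> p = (\<Sum>k\<in>K. Poly_Mapping.lookup p k *\<^sub>C \<phi> k)"
  unfolding free_lift_def
  by (rule sum.mono_neutral_left) (use assms in \<open>auto simp: in_keys_iff\<close>)

lemma clinear_free_lift: "clinear (free_lift \<phi>)"
proof (rule clinearI)
  fix p q :: "'a \<Rightarrow>\<^sub>0 complex" and c
  let ?K = "Poly_Mapping.keys p \<union> Poly_Mapping.keys q"
  have "Poly_Mapping.keys (p + q) \<subseteq> ?K" by (rule Poly_Mapping.keys_add)
  then show "free_lift \<phi> (p + q) = free_lift \<phi> p + free_lift \<phi> q"
    by (simp add: free_lift_superset[of ?K] lookup_add cvec.scale_left_distrib sum.distrib)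
  have "Poly_Mapping.keys (c *\<^sub>C p) \<subseteq> Poly_Mapping.keys p"
    by (auto simp: in_keys_iff)
  then show "free_lift \<phi> (c *\<^sub>C p) = c *\<^sub>C free_lift \<phi> p"
    by (simp add: free_lift_superset[of "Poly_Mapping.keys p"] cvec.scale_sum_right scaleC_complex_def)
qed

lemma free_lift_gen [simp]: "free_lift \<phi> (free_gen k) = \<phi> k"
  by (simp add: free_lift_def)

lemma free_decomp: "p = free_lift free_gen p"
proof (rule poly_mapping_eqI)
  fix k
  have "Poly_Mapping.lookup (free_lift free_gen p) k
      = (\<Sum>i\<in>Poly_Mapping.keys p. Poly_Mapping.lookup p i * (if i = k then 1 else 0))"
    by (simp add: free_lift_def lookup_sum lookup_single when_def scaleC_complex_def)
  also have "\<dots> = Poly_Mapping.lookup p k"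
    by (auto simp: in_keys_iff sum.remove if_distrib sum.If_cases cong: if_cong)
  finally show "Poly_Mapping.lookup p k = Poly_Mapping.lookup (free_lift free_gen p) k" ..
qed

lemma clinear_vanish_span:
  assumes "clinear f" "\<And>r. r \<in> R \<Longrightarrow> f r = 0" "p - q \<in> cvec.span R"
  shows "f p = f q"
proof -
  interpret f: Vector_Spaces.linear scaleC scaleC f by fact
  have "f (p - q) = 0" using f.eq_0_on_span assms by blast
  then show ?thesis by (simp add: f.diff)
qed

lemma span_equivp: "equivp (\<lambda>p q. p - q \<in> cvec.span R)"
proof (rule equivpI)
  show "reflp (\<lambda>p q. p - q \<in> cvec.span R)" by (simp add: reflp_def cvec.span_zero)
  show "symp (\<lambda>p q. p - q \<in> cvec.span R)"
    by (simp add: symp_def) (metis cvec.span_neg minus_diff_eq)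
  show "transp (\<lambda>p q. p - q \<in> cvec.span R)"
    by (rule transpI) (metis cvec.span_add diff_add_cancel add_diff_eq)
qed

lemma span_resp:
  "p - q \<in> cvec.span R \<Longrightarrow> p' - q' \<in> cvec.span R \<Longrightarrow> (p + p') - (q + q') \<in> cvec.span R"
  "p - q \<in> cvec.span R \<Longrightarrow> p' - q' \<in> cvec.span R \<Longrightarrow> (p - p') - (q - q') \<in> cvec.span R"
  "p - q \<in> cvec.span R \<Longrightarrow> - p - - q \<in> cvec.span R"
  "p - q \<in> cvec.span R \<Longrightarrow> c *\<^sub>C p - c *\<^sub>C q \<in> cvec.span R"
     apply (metis cvec.span_add add_diff_add)
    apply (drule (1) cvec.span_diff, simp add: algebra_simps)
   apply (drule cvec.span_neg, simp)
  apply (drule cvec.span_scale[of _ _ c], simp add: cvec.scale_right_diff_distrib)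
  done


section \<open>Tensor products\<close>

subsection \<open>The tensor product of two vector spaces\<close>

definition tensor_relators :: "('a::complex_vector \<times> 'b::complex_vector \<Rightarrow>\<^sub>0 complex) set" where
  "tensor_relators =
     {free_gen (a + a', b) - (free_gen (a, b) + free_gen (a', b)) |a a' b. True} \<union>
     {free_gen (a, b + b') - (free_gen (a, b) + free_gen (a, b')) |a b b'. True} \<union>
     {free_gen (c *\<^sub>C a, b) - c *\<^sub>C free_gen (a, b) |c a b. True} \<union>
     {free_gen (a, c *\<^sub>C b) - c *\<^sub>C free_gen (a, b) |c a b. True}"

quotient_type (overloaded) ('a, 'b) tensor = "'a::complex_vector \<times> 'b::complex_vector \<Rightarrow>\<^sub>0 complex" /
  "\<lambda>p q. p - q \<in> cvec.span tensor_relators"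
  by (rule span_equivp)

instantiation tensor :: (complex_vector, complex_vector) complex_vector
begin
lift_definition zero_tensor :: "('a, 'b) tensor" is 0 .
lift_definition plus_tensor :: "('a, 'b) tensor \<Rightarrow> ('a, 'b) tensor \<Rightarrow> ('a, 'b) tensor"
  is "(+)" by (rule span_resp)
lift_definition minus_tensor :: "('a, 'b) tensor \<Rightarrow> ('a, 'b) tensor \<Rightarrow> ('a, 'b) tensor"
  is "(-)" by (rule span_resp)
lift_definition uminus_tensor :: "('a, 'b) tensor \<Rightarrow> ('a, 'b) tensor"
  is uminus by (rule span_resp)
lift_definition scaleC_tensor :: "complex \<Rightarrow> ('a, 'b) tensor \<Rightarrow> ('a, 'b) tensor"
  is scaleC by (rule span_resp)
instance
  by standard
     (transfer, simp add: cvec.scale_right_distrib cvec.scale_left_distrib cvec.span_zero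
        algebra_simps)+
end

lift_definition pure_tensor :: "'a::complex_vector \<Rightarrow> 'b::complex_vector \<Rightarrow> ('a, 'b) tensor"
  (infixr \<open>\<otimes>\<close> 72) is "\<lambda>a b. free_gen (a, b)" .

(* The value does not depend on the chosen representative if f is bilinear. *)
definition tensor_lift ::
  "('a::complex_vector \<Rightarrow> 'b::complex_vector \<Rightarrow> 'c::complex_vector) \<Rightarrow> ('a, 'b) tensor \<Rightarrow> 'c" where
  "tensor_lift f t = free_lift (case_prod f) (rep_tensor t)"

lemma free_lift_relators:
  assumes "cbilinear f" "r \<in> tensor_relators"
  shows "free_lift (case_prod f) r = 0"
proof -
  interpret l: Vector_Spaces.linear scaleC scaleC "free_lift (case_prod f)"
    by (rule clinear_free_lift)
  show ?thesis
    using assms unfolding tensor_relators_def cbilinear_def clinear_iff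
    by (auto simp: l.diff l.add l.scale)
qed

lemma tensor_lift_abs:
  assumes "cbilinear f"
  shows "tensor_lift f (abs_tensor p) = free_lift (case_prod f) p"
  unfolding tensor_lift_def
proof (rule clinear_vanish_span[OF clinear_free_lift])
  show "free_lift (case_prod f) r = 0" if "r \<in> tensor_relators" for r
    using free_lift_relators[OF assms that] .
  show "rep_tensor (abs_tensor p) - p \<in> cvec.span tensor_relators"
    using Quotient3_rep_abs[OF Quotient3_tensor] cvec.span_zero
    by (metis (mono_tags, lifting) Quotient3_abs_rep Quotient3_tensor tensor.abs_eq_iff)
qed

lemma clinear_tensor_lift:
  assumes "cbilinear f" shows "clinear (tensor_lift f)"
proof (rule clinearI)
  interpret l: Vector_Spaces.linear scaleC scaleC "free_lift (case_prod f)"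
    by (rule clinear_free_lift)
  fix s t :: "('a, 'b) tensor" and c
  obtain p q where [simp]: "s = abs_tensor p" "t = abs_tensor q"
    by (induct s, induct t) blast
  show "tensor_lift f (s + t) = tensor_lift f s + tensor_lift f t"
    by (simp add: plus_tensor.abs_eq tensor_lift_abs[OF assms] l.add)
  show "tensor_lift f (c *\<^sub>C s) = c *\<^sub>C tensor_lift f s"
    by (simp add: scaleC_tensor.abs_eq tensor_lift_abs[OF assms] l.scale)
qed

lemma tensor_lift_pure [simp]: "cbilinear f \<Longrightarrow> tensor_lift f (a \<otimes> b) = f a b"
  by (simp add: pure_tensor.abs_eq tensor_lift_abs)

lemma cbilinear_pure: "cbilinear (\<otimes>)"
proof -
  have 1: "(a + a') \<otimes> b = a \<otimes> b + a' \<otimes> b" for a a' :: 'a and b :: 'b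
    by transfer (rule cvec.span_base, unfold tensor_relators_def, blast)
  have 2: "a \<otimes> (b + b') = a \<otimes> b + a \<otimes> b'" for a :: 'a and b b' :: 'b
    by transfer (rule cvec.span_base, unfold tensor_relators_def, blast)
  have 3: "(c *\<^sub>C a) \<otimes> b = c *\<^sub>C (a \<otimes> b)" for c and a :: 'a and b :: 'b
    by transfer (rule cvec.span_base, unfold tensor_relators_def, blast)
  have 4: "a \<otimes> (c *\<^sub>C b) = c *\<^sub>C (a \<otimes> b)" for c and a :: 'a and b :: 'b
    by transfer (rule cvec.span_base, unfold tensor_relators_def, blast)
  show ?thesis
    unfolding cbilinear_def clinear_iff using 1 2 3 4 by blast
qed

lemma pure_add_scale:
  "(a + a') \<otimes> b = a \<otimes> b + a' \<otimes> b" "a \<otimes> (b + b') = a \<otimes> b + a \<otimes> b'"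
  "(c *\<^sub>C a) \<otimes> b = c *\<^sub>C (a \<otimes> b)" "a \<otimes> (c *\<^sub>C b) = c *\<^sub>C (a \<otimes> b)"
  using cbilinear_pure[where 'a = 'a and 'b = 'b] by (auto simp: cbilinear_def clinear_iff)

lemma clinear_abs_tensor: "clinear abs_tensor"
  by (rule clinearI) (simp_all add: plus_tensor.abs_eq scaleC_tensor.abs_eq)

lemma tensor_induct [case_names pure add]:
  assumes pure: "\<And>a b. P (a \<otimes> b)" and add: "\<And>s t. P s \<Longrightarrow> P t \<Longrightarrow> P (s + t)"
  shows "P t"
proof -
  interpret a: Vector_Spaces.linear scaleC scaleC abs_tensor by (rule clinear_abs_tensor)
  obtain p where t: "t = abs_tensor p" by (induct t) blast
  have z: "P 0"
    using pure[of 0 0] cbilinear_pure unfolding cbilinear_def clinear_iff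
    by (metis add_cancel_right_right)
  have "P (\<Sum>k\<in>K. Poly_Mapping.lookup p k *\<^sub>C abs_tensor (free_gen k))" if "finite K" for K
    using that
  proof induction
    case (insert k K)
    obtain x y where k: "k = (x, y)" by fastforce
    have "Poly_Mapping.lookup p k *\<^sub>C abs_tensor (free_gen k)
        = (Poly_Mapping.lookup p k *\<^sub>C x) \<otimes> y"
      using cbilinear_pure k unfolding cbilinear_def clinear_iff
      by (metis pure_tensor.abs_eq)
    then have "P (Poly_Mapping.lookup p k *\<^sub>C abs_tensor (free_gen k))" using pure by simp
    then show ?case using insert add by simp
  qed (simp add: z)
  moreover have "t = (\<Sum>k\<in>Poly_Mapping.keys p. Poly_Mapping.lookup p k *\<^sub>C abs_tensor (free_gen k))"
    unfolding t by (subst free_decomp) (simp add: free_lift_def a.sum a.scale)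
  ultimately show ?thesis by simp
qed


lemma clinear_eq_tensor:
  assumes "clinear f" "clinear g" "\<And>a b. f (a \<otimes> b) = g (a \<otimes> b)"
  shows "f t = g t"
  using assms by (induct t rule: tensor_induct) (auto simp: clinear_iff)

(* For subspaces S and T this span is (isomorphic to) the tensor product of S and T,
   because we work over a field. *)
definition tensor_sub ::
  "'a::complex_vector set \<Rightarrow> 'b::complex_vector set \<Rightarrow> ('a, 'b) tensor set" (infixr \<open>\<otimes>\<^sub>S\<close> 72) where
  "S \<otimes>\<^sub>S T = cvec.span {a \<otimes> b |a b. a \<in> S \<and> b \<in> T}"

(* The linear map on the tensor product of S and T induced by f.  It depends only on the values
   of f on S \<times> T, and not on the chosen representation of t if f is bilinear there:
   see tensor_lift_on_eq. *)
definition tensor_lift_on ::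
  "'a::complex_vector set \<Rightarrow> 'b::complex_vector set \<Rightarrow> ('a \<Rightarrow> 'b \<Rightarrow> 'c::complex_vector) \<Rightarrow>
     ('a, 'b) tensor \<Rightarrow> 'c" where
  "tensor_lift_on S T f t =
     (let ps = (SOME ps. set ps \<subseteq> S \<times> T \<and> t = (\<Sum>(a, b)\<leftarrow>ps. a \<otimes> b)) in \<Sum>(a, b)\<leftarrow>ps. f a b)"

lemma subspace_projection:
  fixes S :: "'a::complex_vector set"
  assumes "cvec.subspace S"
  obtains \<pi> :: "'a \<Rightarrow> 'a" where "clinear \<pi>" "\<And>x. \<pi> x \<in> S" "\<And>x. x \<in> S \<Longrightarrow> \<pi> x = x"
proof -
  interpret p: vector_space_pair "scaleC :: complex \<Rightarrow> 'a \<Rightarrow> 'a" "scaleC :: complex \<Rightarrow> 'a \<Rightarrow> 'a"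
    by unfold_locales
  have "clinear (\<lambda>x::'a. x)" by (simp add: clinear_iff)
  from p.linear_exists_left_inverse_on[OF this assms]
  obtain g where "range g \<subseteq> S" "clinear g" "\<forall>x\<in>S. g x = x" by auto
  then show thesis by (intro that[of g]) auto
qed

lemma cbilinear_extend:
  assumes "cvec.subspace S" "cvec.subspace T" "cbilinear_on S T f"
  obtains g where "cbilinear g" "\<And>a b. a \<in> S \<Longrightarrow> b \<in> T \<Longrightarrow> g a b = f a b"
proof -
  obtain \<pi> where p: "clinear \<pi>" "\<And>x. \<pi> x \<in> S" "\<And>x. x \<in> S \<Longrightarrow> \<pi> x = x"
    using subspace_projection[OF assms(1)] by blast
  obtain \<rho> where r: "clinear \<rho>" "\<And>x. \<rho> x \<in> T" "\<And>x. x \<in> T \<Longrightarrow> \<rho> x = x"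
    using subspace_projection[OF assms(2)] by blast
  show thesis
    by (rule that[of "\<lambda>a b. f (\<pi> a) (\<rho> b)"])
       (use p r assms(3) in \<open>auto simp: cbilinear_def clinear_iff cbilinear_on_def clinear_on_def\<close>)
qed

lemma tensor_lift_sum:
  assumes "cbilinear g"
  shows "tensor_lift g (\<Sum>(a, b)\<leftarrow>ps. a \<otimes> b) = (\<Sum>(a, b)\<leftarrow>ps. g a b)"
proof -
  interpret l: Vector_Spaces.linear scaleC scaleC "tensor_lift g"
    by (rule clinear_tensor_lift[OF assms])
  show ?thesis by (induct ps) (auto simp: l.zero l.add tensor_lift_pure[OF assms])
qed

lemma tensor_lift_on_eq:
  assumes "cvec.subspace S" "cvec.subspace T" "cbilinear_on S T f" "set ps \<subseteq> S \<times> T"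
  shows "tensor_lift_on S T f (\<Sum>(a, b)\<leftarrow>ps. a \<otimes> b) = (\<Sum>(a, b)\<leftarrow>ps. f a b)"
proof -
  obtain g where g: "cbilinear g" "\<And>a b. a \<in> S \<Longrightarrow> b \<in> T \<Longrightarrow> g a b = f a b"
    using cbilinear_extend[OF assms(1-3)] by blast
  let ?t = "\<Sum>(a, b)\<leftarrow>ps. a \<otimes> b"
  define qs where "qs = (SOME qs. set qs \<subseteq> S \<times> T \<and> ?t = (\<Sum>(a, b)\<leftarrow>qs. a \<otimes> b))"
  have qs: "set qs \<subseteq> S \<times> T \<and> ?t = (\<Sum>(a, b)\<leftarrow>qs. a \<otimes> b)"
    unfolding qs_def by (rule someI) (use assms(4) in auto)
  have f: "(\<Sum>(a, b)\<leftarrow>rs. f a b) = tensor_lift g (\<Sum>(a, b)\<leftarrow>rs. a \<otimes> b)"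
    if "set rs \<subseteq> S \<times> T" for rs
    unfolding tensor_lift_sum[OF g(1)]
    by (rule arg_cong[where f = sum_list], rule map_cong) (use g(2) that in auto)
  show ?thesis
    unfolding tensor_lift_on_def qs_def[symmetric] Let_def using f[OF assms(4)] f[of qs] qs by simp
qed

lemma tensor_sub_list:
  assumes "cvec.subspace S" "t \<in> S \<otimes>\<^sub>S T"
  obtains ps where "set ps \<subseteq> S \<times> T" "t = (\<Sum>(a, b)\<leftarrow>ps. a \<otimes> b)"
proof -
  have "\<exists>ps. set ps \<subseteq> S \<times> T \<and> t = (\<Sum>(a, b)\<leftarrow>ps. a \<otimes> b)"
    using assms(2) unfolding tensor_sub_def
  proof (induct rule: cvec.span_induct_alt)
    case base
    then show ?case by (intro exI[of _ "[]"]) simp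
  next
    case (step c x y)
    then obtain a b ps where "x = a \<otimes> b" "a \<in> S" "b \<in> T"
      "set ps \<subseteq> S \<times> T" "y = (\<Sum>(a, b)\<leftarrow>ps. a \<otimes> b)" by blast
    then show ?case
      using cvec.subspace_scale[OF assms(1)]
      by (intro exI[of _ "(c *\<^sub>C a, b) # ps"]) (auto simp: pure_add_scale)
  qed
  then show thesis using that by blast
qed

definition tensor_assoc ::
  "(('a::complex_vector, 'b::complex_vector) tensor, 'c::complex_vector) tensor \<Rightarrow>
     ('a, ('b, 'c) tensor) tensor" where
  "tensor_assoc = tensor_lift (\<lambda>s c. tensor_lift (\<lambda>a b. a \<otimes> (b \<otimes> c)) s)"

lemma tensor_assoc_pure: "tensor_assoc ((a \<otimes> b) \<otimes> c) = a \<otimes> (b \<otimes> c)"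
proof -
  have 1: "cbilinear (\<lambda>(a::'a) (b::'b). a \<otimes> (b \<otimes> c))" for c :: 'c
    by (simp add: cbilinear_def clinear_iff pure_add_scale)
  have 2: "clinear (\<lambda>c::'c. tensor_lift (\<lambda>a b. a \<otimes> (b \<otimes> c)) s)" for s :: "('a, 'b) tensor"
  proof (induct s rule: tensor_induct)
    case (pure a b)
    then show ?case
      unfolding tensor_lift_pure[OF 1] by (simp add: clinear_iff pure_add_scale)
  next
    case (add s t)
    have "tensor_lift (\<lambda>a b. a \<otimes> (b \<otimes> c)) (s + t)
        = tensor_lift (\<lambda>a b. a \<otimes> (b \<otimes> c)) s + tensor_lift (\<lambda>a b. a \<otimes> (b \<otimes> c)) t" for c :: 'c
      using clinear_tensor_lift[OF 1] by (simp add: clinear_iff)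
    then show ?case using add
      by (simp add: clinear_iff algebra_simps cvec.scale_right_distrib)
  qed
  have "cbilinear (\<lambda>s (c::'c). tensor_lift (\<lambda>(a::'a) (b::'b). a \<otimes> (b \<otimes> c)) s)"
    unfolding cbilinear_def using 2 clinear_tensor_lift[OF 1] by blast
  then show ?thesis
    by (simp add: tensor_assoc_def tensor_lift_pure[OF 1])
qed

subsection \<open>The tensor product of two algebras\<close>

instantiation tensor :: (complex_algebra_1, complex_algebra_1) complex_algebra_1
begin

definition times_tensor :: "('a, 'b) tensor \<Rightarrow> ('a, 'b) tensor \<Rightarrow> ('a, 'b) tensor" where
  "s * t = tensor_lift (\<lambda>a b. tensor_lift (\<lambda>c d. (a * c) \<otimes> (b * d)) t) s"

definition one_tensor :: "('a, 'b) tensor" where "1 = 1 \<otimes> 1"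

lemma cbilinear_times_aux1: "cbilinear (\<lambda>c d. (a * c) \<otimes> (b * d))" for a :: 'a and b :: 'b
  by (simp add: cbilinear_def clinear_iff pure_add_scale distrib_left mult_scaleC_right)

lemma times_aux_add:
  "tensor_lift (\<lambda>c d. (a * c) \<otimes> (b * d)) (s + t)
     = tensor_lift (\<lambda>c d. (a * c) \<otimes> (b * d)) s + tensor_lift (\<lambda>c d. (a * c) \<otimes> (b * d)) t"
  for a :: 'a and b :: 'b
  using clinear_tensor_lift[OF cbilinear_times_aux1] by (simp add: clinear_iff)

lemma cbilinear_times_aux2: "cbilinear (\<lambda>a b. tensor_lift (\<lambda>c d. (a * c) \<otimes> (b * d)) t)"
  for t :: "('a, 'b) tensor"
proof (induct t rule: tensor_induct)
  case (pure c d)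
  show ?case
    by (simp add: tensor_lift_pure[OF cbilinear_times_aux1])
       (simp add: cbilinear_def clinear_iff pure_add_scale distrib_right mult_scaleC_left)
next
  case (add s t)
  then show ?case
    by (simp add: times_aux_add cbilinear_def clinear_iff cvec.scale_right_distrib algebra_simps)
qed

lemma tensor_mult_pure: "(a \<otimes> b) * (c \<otimes> d) = (a * c) \<otimes> (b * d)"
  for a c :: 'a and b d :: 'b
  unfolding times_tensor_def tensor_lift_pure[OF cbilinear_times_aux2]
  by (rule tensor_lift_pure[OF cbilinear_times_aux1])

lemma clinear_times_tensor: "clinear (\<lambda>s. s * t)" "clinear (\<lambda>t. s * t)"
  for s t :: "('a, 'b) tensor"
proof -
  show 1: "clinear (\<lambda>s. s * t)" for t :: "('a, 'b) tensor"
    unfolding times_tensor_def by (rule clinear_tensor_lift[OF cbilinear_times_aux2])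
  show "clinear (\<lambda>t. s * t)"
  proof (induct s rule: tensor_induct)
    case (pure a b)
    show ?case
      using clinear_tensor_lift[OF cbilinear_times_aux1[of a b]]
      by (simp add: times_tensor_def tensor_lift_pure[OF cbilinear_times_aux2])
  next
    case (add s s')
    have "(s + s') * t = s * t + s' * t" for t
      using 1 by (simp add: clinear_iff)
    then show ?case using add by (simp add: clinear_iff algebra_simps cvec.scale_right_distrib)
  qed
qed

lemma tensor_distrib:
  "(s + s') * t = s * t + s' * t" "t * (s + s') = t * s + t * s'"
  "(z *\<^sub>C s) * t = z *\<^sub>C (s * t)" "s * (z *\<^sub>C t) = z *\<^sub>C (s * t)"
  for s s' t :: "('a, 'b) tensor"
  using clinear_times_tensor by (auto simp: clinear_iff)

instance
proof
  fix s t u :: "('a, 'b) tensor" and z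
  show "s * t * u = s * (t * u)"
  proof (induct s rule: tensor_induct)
    case (pure a b)
    show ?case
    proof (induct t rule: tensor_induct)
      case (pure c d)
      show ?case
        by (induct u rule: tensor_induct) (simp_all add: tensor_distrib tensor_mult_pure mult.assoc)
    qed (simp add: tensor_distrib)
  qed (simp add: tensor_distrib)
  show "1 * s = s" "s * 1 = s"
    by (induct s rule: tensor_induct; simp add: one_tensor_def tensor_distrib tensor_mult_pure)+
qed (rule tensor_distrib)+

end


subsection \<open>Tensor powers\<close>

definition tensor_alg_relators :: "('a::complex_vector list \<Rightarrow>\<^sub>0 complex) set" where
  "tensor_alg_relators =
     {free_gen (xs @ (a + a') # ys) - (free_gen (xs @ a # ys) + free_gen (xs @ a' # ys))
        |xs a a' ys. True} \<union>
     {free_gen (xs @ (c *\<^sub>C a) # ys) - c *\<^sub>C free_gen (xs @ a # ys) |xs c a ys. True}"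

(* The tensor algebra, as the direct sum of all tensor powers. *)
quotient_type (overloaded) 'a tensor_alg = "'a::complex_vector list \<Rightarrow>\<^sub>0 complex" /
  "\<lambda>p q. p - q \<in> cvec.span tensor_alg_relators"
  by (rule span_equivp)

instantiation tensor_alg :: (complex_vector) complex_vector
begin
lift_definition zero_tensor_alg :: "'a tensor_alg" is 0 .
lift_definition plus_tensor_alg :: "'a tensor_alg \<Rightarrow> 'a tensor_alg \<Rightarrow> 'a tensor_alg"
  is "(+)" by (rule span_resp)
lift_definition minus_tensor_alg :: "'a tensor_alg \<Rightarrow> 'a tensor_alg \<Rightarrow> 'a tensor_alg"
  is "(-)" by (rule span_resp)
lift_definition uminus_tensor_alg :: "'a tensor_alg \<Rightarrow> 'a tensor_alg"
  is uminus by (rule span_resp)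
lift_definition scaleC_tensor_alg :: "complex \<Rightarrow> 'a tensor_alg \<Rightarrow> 'a tensor_alg"
  is scaleC by (rule span_resp)
instance
  by standard
     (transfer, simp add: cvec.scale_right_distrib cvec.scale_left_distrib cvec.span_zero
        algebra_simps)+
end

lift_definition pure_tensors :: "'a::complex_vector list \<Rightarrow> 'a tensor_alg" is free_gen .

definition tensor_power :: "nat \<Rightarrow> 'a::complex_vector tensor_alg set" where
  "tensor_power n = cvec.span {pure_tensors vs |vs. length vs = n}"

definition cmultilinear :: "('a::complex_vector list \<Rightarrow> 'b::complex_vector) \<Rightarrow> bool" where
  "cmultilinear \<Phi> \<longleftrightarrow> (\<forall>xs ys. clinear (\<lambda>a. \<Phi> (xs @ a # ys)))"

(* Independent of the chosen representative if \<Phi> is multilinear. *)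
definition tensor_alg_lift ::
  "('a::complex_vector list \<Rightarrow> 'b::complex_vector) \<Rightarrow> 'a tensor_alg \<Rightarrow> 'b" where
  "tensor_alg_lift \<Phi> t = free_lift \<Phi> (rep_tensor_alg t)"

lemma tensor_alg_lift_abs:
  assumes "cmultilinear \<Phi>"
  shows "tensor_alg_lift \<Phi> (abs_tensor_alg p) = free_lift \<Phi> p"
  unfolding tensor_alg_lift_def
proof (rule clinear_vanish_span[OF clinear_free_lift])
  interpret l: Vector_Spaces.linear scaleC scaleC "free_lift \<Phi>"
    by (rule clinear_free_lift)
  show "free_lift \<Phi> r = 0" if "r \<in> tensor_alg_relators" for r
    using assms that unfolding tensor_alg_relators_def cmultilinear_def clinear_iff
    by (auto simp: l.diff l.add l.scale)
  show "rep_tensor_alg (abs_tensor_alg p) - p \<in> cvec.span tensor_alg_relators"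
    by (metis (mono_tags, lifting) Quotient3_abs_rep Quotient3_tensor_alg tensor_alg.abs_eq_iff)
qed

lemma tensor_alg_lift_pure: "cmultilinear \<Phi> \<Longrightarrow> tensor_alg_lift \<Phi> (pure_tensors vs) = \<Phi> vs"
  by (simp add: pure_tensors.abs_eq tensor_alg_lift_abs)

lemma clinear_tensor_alg_lift:
  assumes "cmultilinear \<Phi>" shows "clinear (tensor_alg_lift \<Phi>)"
proof (rule clinearI)
  interpret l: Vector_Spaces.linear scaleC scaleC "free_lift \<Phi>"
    by (rule clinear_free_lift)
  fix s t :: "'a tensor_alg" and c
  obtain p q where [simp]: "s = abs_tensor_alg p" "t = abs_tensor_alg q"
    by (induct s, induct t) blast
  show "tensor_alg_lift \<Phi> (s + t) = tensor_alg_lift \<Phi> s + tensor_alg_lift \<Phi> t"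
    by (simp add: plus_tensor_alg.abs_eq tensor_alg_lift_abs[OF assms] l.add)
  show "tensor_alg_lift \<Phi> (c *\<^sub>C s) = c *\<^sub>C tensor_alg_lift \<Phi> s"
    by (simp add: scaleC_tensor_alg.abs_eq tensor_alg_lift_abs[OF assms] l.scale)
qed


section \<open>Laurent series with vector coefficients\<close>

subsection \<open>The algebra of linear maps from V to V \<otimes> C((x))\<close>

definition fls_pure :: "complex fls \<Rightarrow> 'v::complex_vector \<Rightarrow> 'v fls" where
  "fls_pure f v = Abs_fls (\<lambda>n. (f $$ n) *\<^sub>C v)"

(* V \<otimes> C((x)), identified with its image under the canonical embedding into V((x)).
   The image is a proper subspace of V((x)) if V is infinite-dimensional. *)
definition laurent_tensor :: "'v::complex_vector fls set" where
  "laurent_tensor = cvec.span {fls_pure f v |f v. True}"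

(* The C((x))-linear extension to V \<otimes> C((x)) of a linear map a from V to V \<otimes> C((x)):
   the sum over k of a(g_k) x^k, where g is the sum over k of g_k x^k. *)
definition laurent_extend ::
  "('v::complex_vector \<Rightarrow> 'v fls) \<Rightarrow> 'v fls \<Rightarrow> 'v fls" where
  "laurent_extend a g = Abs_fls (\<lambda>n. Sum_any (\<lambda>k. a (g $$ k) $$ (n - k)))"

definition fls_ddx :: "'v::complex_vector fls \<Rightarrow> 'v fls" where
  "fls_ddx g = Abs_fls (\<lambda>n. of_int (n + 1) *\<^sub>C (g $$ (n + 1)))"

(* The product of a scalar series with a vector-valued series. *)
definition fls_module :: "complex fls \<Rightarrow> 'v::complex_vector fls \<Rightarrow> 'v fls" where
  "fls_module f g = Abs_fls (\<lambda>n. Sum_any (\<lambda>k. (f $$ k) *\<^sub>C (g $$ (n - k))))"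

lemma fls_pure_nth [simp]: "fls_pure f v $$ n = (f $$ n) *\<^sub>C v"
  unfolding fls_pure_def
  by (subst nth_Abs_fls_lower_bound[where N = "fls_subdegree f"]) auto

lemma fls_ddx_nth [simp]: "fls_ddx g $$ n = of_int (n + 1) *\<^sub>C (g $$ (n + 1))"
  unfolding fls_ddx_def
  by (subst nth_Abs_fls_lower_bound[where N = "fls_subdegree g - 1"]) auto

lemma fls_module_support:
  "{k. (f $$ k) *\<^sub>C (g $$ (n - k)) \<noteq> 0} \<subseteq> {fls_subdegree f..n - fls_subdegree g}"
proof safe
  fix k assume *: "(f $$ k) *\<^sub>C (g $$ (n - k)) \<noteq> 0"
  then have "fls_subdegree f \<le> k" "fls_subdegree g \<le> n - k"
    by (auto intro: fls_subdegree_leI)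
  then show "k \<in> {fls_subdegree f..n - fls_subdegree g}" by simp
qed

lemma fls_module_nth: "fls_module f g $$ n = Sum_any (\<lambda>k. (f $$ k) *\<^sub>C (g $$ (n - k)))"
  unfolding fls_module_def
proof (subst nth_Abs_fls_lower_bound[where N = "fls_subdegree f + fls_subdegree g"])
  show "\<forall>m<fls_subdegree f + fls_subdegree g. Sum_any (\<lambda>k. (f $$ k) *\<^sub>C (g $$ (m - k))) = 0"
  proof safe
    fix m assume "m < fls_subdegree f + fls_subdegree g"
    then have "{k. (f $$ k) *\<^sub>C (g $$ (m - k)) \<noteq> 0} = {}"
      using fls_module_support[of f g m] by auto
    then show "Sum_any (\<lambda>k. (f $$ k) *\<^sub>C (g $$ (m - k))) = 0"
      by (simp add: Sum_any.expand_set)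
  qed
qed simp

lemma fls_module_add: "fls_module f (g + h) = fls_module f g + fls_module f h"
proof (rule fls_eqI)
  fix n
  show "fls_module f (g + h) $$ n = (fls_module f g + fls_module f h) $$ n"
    by (simp add: fls_module_nth cvec.scale_right_distrib)
       (rule Sum_any.distrib; rule finite_subset[OF fls_module_support]; simp)
qed

lemma Sum_any_scaleC:
  assumes "finite {k. h k \<noteq> 0}"
  shows "Sum_any (\<lambda>k. c *\<^sub>C h k) = c *\<^sub>C (Sum_any h :: 'a::complex_vector)"
proof -
  have "Sum_any (\<lambda>k. c *\<^sub>C h k) = sum (\<lambda>k. c *\<^sub>C h k) {k. h k \<noteq> 0}"
    by (rule Sum_any.expand_superset[OF assms]) auto
  then show ?thesis by (simp add: Sum_any.expand_set cvec.scale_sum_right)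
qed

lemma fls_module_scale: "fls_module f (c *\<^sub>C g) = c *\<^sub>C fls_module f g"
proof (rule fls_eqI)
  fix n
  have "Sum_any (\<lambda>k. c *\<^sub>C ((f $$ k) *\<^sub>C (g $$ (n - k))))
      = c *\<^sub>C Sum_any (\<lambda>k. (f $$ k) *\<^sub>C (g $$ (n - k)))"
    by (rule Sum_any_scaleC, rule finite_subset[OF fls_module_support]) simp
  then show "fls_module f (c *\<^sub>C g) $$ n = (c *\<^sub>C fls_module f g) $$ n"
    by (simp add: fls_module_nth cvec.scale_left_commute mult.commute)
qed

lemma clinear_fls_module: "clinear (fls_module f)"
  by (rule clinearI) (simp_all add: fls_module_add fls_module_scale)

lemma fls_module_pure: "fls_module f (fls_pure g v) = fls_pure (f * g) v"
proof (rule fls_eqI)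
  fix n
  have "fls_module f (fls_pure g v) $$ n = Sum_any (\<lambda>k. (f $$ k * g $$ (n - k)) *\<^sub>C v)"
    by (simp add: fls_module_nth)
  also have "\<dots> = (\<Sum>k=fls_subdegree f..n - fls_subdegree g. (f $$ k * g $$ (n - k)) *\<^sub>C v)"
  proof (rule Sum_any.expand_superset)
    show "{k. (f $$ k * g $$ (n - k)) *\<^sub>C v \<noteq> 0} \<subseteq> {fls_subdegree f..n - fls_subdegree g}"
    proof
      fix k assume "k \<in> {k. (f $$ k * g $$ (n - k)) *\<^sub>C v \<noteq> 0}"
      then have "fls_subdegree f \<le> k" "fls_subdegree g \<le> n - k"
        by (auto intro: fls_subdegree_leI)
      then show "k \<in> {fls_subdegree f..n - fls_subdegree g}" by simp
    qed
  qed simp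
  also have "\<dots> = fls_pure (f * g) v $$ n"
    by (simp add: fls_times_nth(2) cvec.scale_sum_left)
  finally show "fls_module f (fls_pure g v) $$ n = fls_pure (f * g) v $$ n" .
qed

lemma laurent_tensor_pure: "fls_pure f v \<in> laurent_tensor"
  unfolding laurent_tensor_def by (rule cvec.span_base) blast

lemma subspace_laurent_tensor: "cvec.subspace laurent_tensor"
  unfolding laurent_tensor_def by (rule cvec.subspace_span)

lemma laurent_tensor_induct [consumes 1, case_names zero add]:
  assumes "g \<in> laurent_tensor" "P 0"
    and "\<And>f v g. g \<in> laurent_tensor \<Longrightarrow> P g \<Longrightarrow> P (fls_pure f v + g)"
  shows "P g"
proof -
  have "g \<in> laurent_tensor \<and> P g"
    using assms(1) unfolding laurent_tensor_def
  proof (induct rule: cvec.span_induct_alt)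
    case (step c x y)
    then obtain f v where "x = fls_pure f v" by blast
    then have x: "c *\<^sub>C x = fls_pure f (c *\<^sub>C v)"
      by (simp add: fls_eq_iff mult.commute)
    from step have y: "y \<in> laurent_tensor" "P y" by (auto simp: laurent_tensor_def)
    show ?case
      unfolding x
      using assms(3)[OF y] cvec.subspace_add[OF subspace_laurent_tensor laurent_tensor_pure y(1)]
      by (simp add: laurent_tensor_def)
  qed (use assms(2) cvec.span_zero in auto)
  then show ?thesis by simp
qed

lemma laurent_tensor_const: "fls_const v \<in> laurent_tensor"
proof -
  have "fls_const v = fls_pure 1 v" by (auto simp: fls_eq_iff)
  then show ?thesis by (simp add: laurent_tensor_pure)
qed

lemma laurent_tensor_module: "g \<in> laurent_tensor \<Longrightarrow> fls_module f g \<in> laurent_tensor"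
proof (induct rule: laurent_tensor_induct)
  case zero
  then show ?case using clinear_fls_module[of f] subspace_laurent_tensor
    by (metis cvec.subspace_0 cvec.scale_zero_left fls_module_scale)
next
  case (add g v h)
  then show ?case
    by (simp add: fls_module_add fls_module_pure laurent_tensor_pure
        cvec.subspace_add[OF subspace_laurent_tensor])
qed

lemma fls_module_assoc: "g \<in> laurent_tensor \<Longrightarrow> fls_module f (fls_module h g) = fls_module (f * h) g"
proof (induct rule: laurent_tensor_induct)
  case zero
  show ?case by (metis cvec.scale_zero_left fls_module_scale)
next
  case (add g v h)
  then show ?case by (simp add: fls_module_add fls_module_pure mult.assoc)
qed

lemma laurent_tensor_ddx: "g \<in> laurent_tensor \<Longrightarrow> fls_ddx g \<in> laurent_tensor"
proof (induct rule: laurent_tensor_induct)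
  case zero
  have "fls_ddx (0 :: 'a fls) = 0" by (simp add: fls_eq_iff)
  then show ?case using subspace_laurent_tensor by (metis cvec.subspace_0)
next
  case (add f v h)
  have "fls_ddx (fls_pure f v + h) = fls_pure (fls_deriv f) v + fls_ddx h"
    by (simp add: fls_eq_iff cvec.scale_right_distrib)
  then show ?case
    using add by (simp add: laurent_tensor_pure cvec.subspace_add[OF subspace_laurent_tensor])
qed

lemma laurent_extend_bound:
  assumes a: "clinear a" and g: "g \<in> laurent_tensor"
  shows "\<exists>N. \<forall>k n. n < N \<longrightarrow> a (g $$ k) $$ n = 0"
  using g
proof (induct rule: laurent_tensor_induct)
  case zero
  have "a 0 = 0" using a by (metis clinear_iff cvec.scale_zero_left)
  then show ?case by simp
next
  case (add f v h)
  then obtain N where N: "\<forall>k n. n < N \<longrightarrow> a (h $$ k) $$ n = 0" by blast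
  have "a ((fls_pure f v + h) $$ k) $$ n = 0" if "n < min N (fls_subdegree (a v))" for k n
    using N that a by (simp add: clinear_iff)
  then show ?case by blast
qed

lemma laurent_extend_support:
  assumes a: "clinear a" and N: "\<forall>k n. n < N \<longrightarrow> a (g $$ k) $$ n = 0"
  shows "{k. a (g $$ k) $$ (n - k) \<noteq> 0} \<subseteq> {fls_subdegree g..n - N}"
proof safe
  fix k assume *: "a (g $$ k) $$ (n - k) \<noteq> 0"
  have "a 0 = 0" using a by (metis clinear_iff cvec.scale_zero_left)
  with * have "g $$ k \<noteq> 0" by auto
  then have "fls_subdegree g \<le> k" by (rule fls_subdegree_leI)
  moreover have "\<not> n - k < N" using N * by blast
  ultimately show "k \<in> {fls_subdegree g..n - N}" by simp
qed

lemma laurent_extend_finite: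
  assumes "clinear a" "g \<in> laurent_tensor"
  shows "finite {k. a (g $$ k) $$ (n - k) \<noteq> 0}"
  using laurent_extend_bound[OF assms] laurent_extend_support[OF assms(1), of _ g n]
  by (meson finite_atLeastAtMost_int finite_subset)

lemma laurent_extend_nth:
  assumes "clinear a" "g \<in> laurent_tensor"
  shows "laurent_extend a g $$ n = Sum_any (\<lambda>k. a (g $$ k) $$ (n - k))"
proof -
  obtain N where N: "\<forall>k n. n < N \<longrightarrow> a (g $$ k) $$ n = 0"
    using laurent_extend_bound[OF assms] by blast
  show ?thesis
    unfolding laurent_extend_def
  proof (subst nth_Abs_fls_lower_bound[where N = "fls_subdegree g + N"])
    show "\<forall>m<fls_subdegree g + N. Sum_any (\<lambda>k. a (g $$ k) $$ (m - k)) = 0"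
    proof safe
      fix m assume "m < fls_subdegree g + N"
      then have "{k. a (g $$ k) $$ (m - k) \<noteq> 0} = {}"
        using laurent_extend_support[OF assms(1) N, of m] by auto
      then show "Sum_any (\<lambda>k. a (g $$ k) $$ (m - k)) = 0"
        by (simp add: Sum_any.expand_set)
    qed
  qed simp
qed

lemma laurent_extend_add:
  assumes "clinear a" "g \<in> laurent_tensor" "h \<in> laurent_tensor"
  shows "laurent_extend a (g + h) = laurent_extend a g + laurent_extend a h"
proof (rule fls_eqI)
  fix n
  have gh: "g + h \<in> laurent_tensor"
    by (rule cvec.subspace_add[OF subspace_laurent_tensor assms(2,3)])
  have ad: "a (g $$ k + h $$ k) = a (g $$ k) + a (h $$ k)" for k
    using assms(1) by (simp add: clinear_iff)
  show "laurent_extend a (g + h) $$ n = (laurent_extend a g + laurent_extend a h) $$ n"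
    by (simp add: laurent_extend_nth[OF assms(1)] assms gh ad)
       (rule Sum_any.distrib; rule laurent_extend_finite; fact)
qed

lemma laurent_extend_scale:
  assumes "clinear a" "g \<in> laurent_tensor"
  shows "laurent_extend a (c *\<^sub>C g) = c *\<^sub>C laurent_extend a g"
proof (rule fls_eqI)
  fix n
  have "c *\<^sub>C g \<in> laurent_tensor"
    by (rule cvec.subspace_scale[OF subspace_laurent_tensor assms(2)])
  moreover have "a (c *\<^sub>C (g $$ k)) = c *\<^sub>C a (g $$ k)" for k
    using assms(1) by (simp add: clinear_iff)
  ultimately show "laurent_extend a (c *\<^sub>C g) $$ n = (c *\<^sub>C laurent_extend a g) $$ n"
    by (simp add: laurent_extend_nth[OF assms(1)] assms Sum_any_scaleC laurent_extend_finite)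
qed

lemma laurent_extend_pure:
  assumes "clinear a"
  shows "laurent_extend a (fls_pure f v) = fls_module f (a v)"
  using assms
  by (intro fls_eqI)
     (simp add: laurent_extend_nth[OF assms laurent_tensor_pure] fls_module_nth clinear_iff)

lemma laurent_extend_0:
  assumes "clinear a" shows "laurent_extend a 0 = 0"
  using laurent_extend_scale[OF assms laurent_tensor_pure, of 0] by simp

lemma laurent_extend_const:
  assumes "g \<in> laurent_tensor" shows "laurent_extend fls_const g = g"
proof (rule fls_eqI)
  fix n
  have c: "clinear (fls_const :: 'a \<Rightarrow> 'a fls)" by (rule clinearI) (simp_all add: fls_eq_iff)
  have "laurent_extend fls_const g $$ n = Sum_any (\<lambda>k. if k = n then g $$ k else 0)"
    unfolding laurent_extend_nth[OF c assms] by (rule Sum_any.cong) simp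
  then show "laurent_extend fls_const g $$ n = g $$ n" by simp
qed

lemma laurent_extend_in:
  assumes a: "clinear a" "range a \<subseteq> laurent_tensor" and "g \<in> laurent_tensor"
  shows "laurent_extend a g \<in> laurent_tensor"
  using assms(3)
proof (induct rule: laurent_tensor_induct)
  case zero
  show ?case using laurent_extend_0[OF a(1)] subspace_laurent_tensor by (metis cvec.subspace_0)
next
  case (add f v h)
  then have "fls_module f (a v) \<in> laurent_tensor" using a(2) by (intro laurent_tensor_module) auto
  with add show ?case
    by (simp add: laurent_extend_add[OF a(1)] laurent_tensor_pure laurent_extend_pure[OF a(1)]
        cvec.subspace_add[OF subspace_laurent_tensor])
qed

lemma laurent_extend_module:
  assumes a: "clinear a" "range a \<subseteq> laurent_tensor" and "g \<in> laurent_tensor"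
  shows "laurent_extend a (fls_module f g) = fls_module f (laurent_extend a g)"
  using assms(3)
proof (induct rule: laurent_tensor_induct)
  case zero
  have "fls_module f 0 = (0 :: 'a fls)" by (metis cvec.scale_zero_left fls_module_scale)
  then show ?case by (simp add: laurent_extend_0[OF a(1)])
next
  case (add h v g)
  have "a v \<in> laurent_tensor" using a(2) by auto
  with add show ?case
    by (simp add: fls_module_add fls_module_pure laurent_extend_add[OF a(1)] laurent_tensor_pure
        laurent_extend_pure[OF a(1)] laurent_tensor_module fls_module_assoc)
qed

lemma clinear_laurent_extend_comp:
  assumes "clinear a" "clinear b" "range b \<subseteq> laurent_tensor"
  shows "clinear (\<lambda>v. laurent_extend a (b v))"
  using assms
  by (intro clinearI)
     (auto simp: clinear_iff image_subset_iff intro: laurent_extend_add[OF assms(1)]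
        laurent_extend_scale[OF assms(1)])

lemma laurent_extend_assoc:
  assumes a: "clinear a" "range a \<subseteq> laurent_tensor" and b: "clinear b" "range b \<subseteq> laurent_tensor"
    and "g \<in> laurent_tensor"
  shows "laurent_extend (\<lambda>v. laurent_extend a (b v)) g = laurent_extend a (laurent_extend b g)"
  using assms(5)
proof (induct rule: laurent_tensor_induct)
  case zero
  show ?case
    by (simp add: laurent_extend_0[OF a(1)] laurent_extend_0[OF b(1)]
        laurent_extend_0[OF clinear_laurent_extend_comp[OF a(1) b]])
next
  case (add f v h)
  have "b v \<in> laurent_tensor" using b(2) by auto
  with add show ?case
    by (simp add: laurent_extend_add[OF a(1)] laurent_extend_add[OF b(1)]
        laurent_extend_add[OF clinear_laurent_extend_comp[OF a(1) b]] laurent_tensor_pure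
        laurent_extend_pure[OF b(1)] laurent_extend_pure[OF clinear_laurent_extend_comp[OF a(1) b]]
        laurent_tensor_module laurent_extend_in[OF b] laurent_extend_module[OF a])
qed

lemma laurent_extend_add_left:
  assumes "clinear a" "clinear b" "g \<in> laurent_tensor"
  shows "laurent_extend (\<lambda>v. a v + b v) g = laurent_extend a g + laurent_extend b g"
proof (rule fls_eqI)
  fix n
  have ab: "clinear (\<lambda>v. a v + b v)"
    using assms by (simp add: clinear_iff cvec.scale_right_distrib algebra_simps)
  show "laurent_extend (\<lambda>v. a v + b v) g $$ n = (laurent_extend a g + laurent_extend b g) $$ n"
    by (simp add: laurent_extend_nth assms ab)
       (rule Sum_any.distrib; rule laurent_extend_finite; fact)
qed

lemma laurent_extend_scale_left:
  assumes "clinear a" "g \<in> laurent_tensor"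
  shows "laurent_extend (\<lambda>v. c *\<^sub>C a v) g = c *\<^sub>C laurent_extend a g"
proof (rule fls_eqI)
  fix n
  have ca: "clinear (\<lambda>v. c *\<^sub>C a v)"
    using assms by (simp add: clinear_iff cvec.scale_right_distrib mult.commute)
  show "laurent_extend (\<lambda>v. c *\<^sub>C a v) g $$ n = (c *\<^sub>C laurent_extend a g) $$ n"
    by (simp add: laurent_extend_nth assms ca Sum_any_scaleC laurent_extend_finite)
qed

typedef (overloaded) ('v::complex_vector) laurent_hom =
    "{a :: 'v \<Rightarrow> 'v fls. clinear a \<and> range a \<subseteq> laurent_tensor}"
  morphisms laurent_apply Abs_laurent_hom
proof
  show "(\<lambda>_. 0) \<in> {a :: 'v \<Rightarrow> 'v fls. clinear a \<and> range a \<subseteq> laurent_tensor}"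
    using cvec.subspace_0[OF subspace_laurent_tensor] by (auto simp: clinear_iff)
qed

setup_lifting type_definition_laurent_hom

(* The product is composition in the algebra of C((x))-linear endomorphisms of V \<otimes> C((x)), which
   is identified with the space of linear maps from V to V \<otimes> C((x)) by restriction to V. *)
instantiation laurent_hom :: (complex_vector) complex_algebra_1
begin

lift_definition zero_laurent_hom :: "'a laurent_hom" is "\<lambda>_. 0"
  using cvec.subspace_0[OF subspace_laurent_tensor] by (auto simp: clinear_iff)

lift_definition plus_laurent_hom :: "'a laurent_hom \<Rightarrow> 'a laurent_hom \<Rightarrow> 'a laurent_hom"
  is "\<lambda>a b v. a v + b v"
  by (auto simp: clinear_iff cvec.scale_right_distrib algebra_simps image_subset_iff
      intro!: cvec.subspace_add[OF subspace_laurent_tensor])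

lift_definition minus_laurent_hom :: "'a laurent_hom \<Rightarrow> 'a laurent_hom \<Rightarrow> 'a laurent_hom"
  is "\<lambda>a b v. a v - b v"
  by (auto simp: clinear_iff cvec.scale_right_diff_distrib algebra_simps image_subset_iff
      intro!: cvec.subspace_diff[OF subspace_laurent_tensor])

lift_definition uminus_laurent_hom :: "'a laurent_hom \<Rightarrow> 'a laurent_hom"
  is "\<lambda>a v. - a v"
  by (auto simp: clinear_iff image_subset_iff
      intro!: cvec.subspace_neg[OF subspace_laurent_tensor])

lift_definition scaleC_laurent_hom :: "complex \<Rightarrow> 'a laurent_hom \<Rightarrow> 'a laurent_hom"
  is "\<lambda>c a v. c *\<^sub>C a v"
  by (auto simp: clinear_iff cvec.scale_right_distrib mult.commute image_subset_iff
      intro!: cvec.subspace_scale[OF subspace_laurent_tensor])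

lift_definition one_laurent_hom :: "'a laurent_hom" is fls_const
  by (auto simp: laurent_tensor_const fls_eq_iff intro!: clinearI)

lift_definition times_laurent_hom :: "'a laurent_hom \<Rightarrow> 'a laurent_hom \<Rightarrow> 'a laurent_hom"
  is "\<lambda>a b v. laurent_extend a (b v)"
  by (auto simp: image_subset_iff intro!: clinear_laurent_extend_comp laurent_extend_in)

instance
proof
  fix a b c :: "'a laurent_hom" and z w :: complex
  show "a * b * c = a * (b * c)"
    by transfer (auto simp: fun_eq_iff image_subset_iff intro!: laurent_extend_assoc)
  show "(a + b) * c = a * c + b * c"
    by transfer (auto simp: fun_eq_iff image_subset_iff intro!: laurent_extend_add_left)
  show "a * (b + c) = a * b + a * c"
    by transfer (auto simp: fun_eq_iff image_subset_iff intro!: laurent_extend_add)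
  show "(z *\<^sub>C a) * b = z *\<^sub>C (a * b)"
    by transfer (auto simp: fun_eq_iff image_subset_iff intro!: laurent_extend_scale_left)
  show "a * (z *\<^sub>C b) = z *\<^sub>C (a * b)"
    by transfer (auto simp: fun_eq_iff image_subset_iff intro!: laurent_extend_scale)
  show "1 * a = a"
    by transfer (auto simp: fun_eq_iff image_subset_iff intro!: laurent_extend_const)
  show "a * 1 = a"
  proof transfer
    fix a :: "'a \<Rightarrow> 'a fls"
    assume "clinear a \<and> range a \<subseteq> laurent_tensor"
    then have a: "clinear a" by simp
    show "(\<lambda>v. laurent_extend a (fls_const v)) = a"
    proof (intro ext fls_eqI)
      fix v n
      have "a 0 = 0" using a by (metis clinear_iff cvec.scale_zero_left)
      then have "a (fls_const v $$ k) $$ (n - k) = (if k = 0 then a v $$ n else 0)" for k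
        by simp
      then have "laurent_extend a (fls_const v) $$ n = Sum_any (\<lambda>k. if k = 0 then a v $$ n else 0)"
        unfolding laurent_extend_nth[OF a laurent_tensor_const] by simp
      then show "laurent_extend a (fls_const v) $$ n = a v $$ n" by simp
    qed
  qed
qed (transfer; simp add: fun_eq_iff cvec.scale_right_distrib cvec.scale_left_distrib algebra_simps)+

end

lift_definition laurent_ddx :: "'v::complex_vector laurent_hom \<Rightarrow> 'v laurent_hom"
  is "\<lambda>a v. fls_ddx (a v)"
  by (auto simp: clinear_iff image_subset_iff fls_eq_iff cvec.scale_right_distrib mult.commute
      intro!: laurent_tensor_ddx)


subsection \<open>Iterated Laurent series\<close>

(* The space W((x_1))...((x_n)), where W is the coefficient space.  A series is represented by the
   function mapping [k_1, ..., k_n] to the coefficient of x_1^k_1 ... x_n^k_n and all lists of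
   other lengths to 0.  The recursion is on the last variable, x_n, whose exponents are bounded
   below uniformly in the other exponents. *)
primrec iter_laurent :: "nat \<Rightarrow> (int list \<Rightarrow> 'a::zero) set" where
  "iter_laurent 0 = {F. \<forall>ks. ks \<noteq> [] \<longrightarrow> F ks = 0}"
| "iter_laurent (Suc n) =
     {F. F [] = 0 \<and> (\<exists>N. \<forall>k<N. \<forall>ks. F (ks @ [k]) = 0) \<and>
         (\<forall>k. (\<lambda>ks. F (ks @ [k])) \<in> iter_laurent n)}"

definition iter_laurent_mult ::
  "(int list \<Rightarrow> complex) \<Rightarrow> (int list \<Rightarrow> 'a::complex_vector) \<Rightarrow> int list \<Rightarrow> 'a" where
  "iter_laurent_mult F G ks =
     Sum_any (\<lambda>is. if length is = length ks then F is *\<^sub>C G (map2 (-) ks is) else 0)"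

lemma iter_laurent_length:
  "F \<in> iter_laurent n \<Longrightarrow> F ks \<noteq> 0 \<Longrightarrow> length ks = n"
proof (induct n arbitrary: F ks)
  case (Suc n)
  then show ?case by (cases ks rule: rev_cases) fastforce+
qed auto

lemma iter_laurent_mult_finite:
  assumes "F \<in> iter_laurent n" "G \<in> iter_laurent n" "length ks = n"
  shows "finite {is. length is = n \<and> F is \<noteq> 0 \<and> G (map2 (-) ks is) \<noteq> 0}"
  using assms
proof (induct n arbitrary: F G ks)
  case 0
  then show ?case by simp
next
  case (Suc n)
  obtain ks' k where ks: "ks = ks' @ [k]" "length ks' = n"
    using Suc.prems(3) by (cases ks rule: rev_cases) auto
  obtain N where N: "\<forall>k<N. \<forall>ks. F (ks @ [k]) = 0" using Suc.prems(1) by auto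
  obtain M where M: "\<forall>k<M. \<forall>ks. G (ks @ [k]) = 0" using Suc.prems(2) by auto
  let ?A = "\<lambda>i. {is. length is = n \<and> F (is @ [i]) \<noteq> 0 \<and> G (map2 (-) ks' is @ [k - i]) \<noteq> 0}"
  have "finite (?A i)" for i
    using Suc.hyps[of "\<lambda>is. F (is @ [i])" "\<lambda>is. G (is @ [k - i])" ks'] Suc.prems ks by auto
  then have "finite (\<Union>i\<in>{N..k - M}. (\<lambda>is. is @ [i]) ` ?A i)" by simp
  moreover have "{is. length is = Suc n \<and> F is \<noteq> 0 \<and> G (map2 (-) ks is) \<noteq> 0}
      \<subseteq> (\<Union>i\<in>{N..k - M}. (\<lambda>is. is @ [i]) ` ?A i)"
  proof clarify
    fix is' assume *: "length is' = Suc n" "F is' \<noteq> 0" "G (map2 (-) ks is') \<noteq> 0"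
    then obtain js i where is': "is' = js @ [i]" "length js = n"
      by (cases is' rule: rev_cases) auto
    have "\<not> i < N" "\<not> k - i < M" using * is' ks N M by auto
    then show "is' \<in> (\<Union>i\<in>{N..k - M}. (\<lambda>is. is @ [i]) ` ?A i)"
      using * is' ks by auto
  qed
  ultimately show ?case by (rule finite_subset[rotated])
qed


subsection \<open>Formal series in two variables\<close>

(* A formal series in x, y is represented by the function mapping p, q to the coefficient of
   x^p y^q.  This is F(x + s y, y), with (x + s y)^m expanded in nonnegative powers of y:
   the coefficient of x^p y^j in (x + s y)^(p + j) is s^j (p + j choose j). *)
definition subst_shift ::
  "complex \<Rightarrow> (int \<Rightarrow> int \<Rightarrow> 'a::complex_vector) \<Rightarrow> int \<Rightarrow> int \<Rightarrow> 'a" where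
  "subst_shift s F p q =
     Sum_any (\<lambda>j::nat. (s ^ j * (of_int (p + int j) gchoose j)) *\<^sub>C F (p + int j) (q - int j))"

(* (x + y)^l F(x, y) *)
definition mult_add_power ::
  "nat \<Rightarrow> (int \<Rightarrow> int \<Rightarrow> 'a::complex_vector) \<Rightarrow> int \<Rightarrow> int \<Rightarrow> 'a" where
  "mult_add_power l F p q =
     (\<Sum>j\<le>l. of_nat (l choose j) *\<^sub>C F (p - int (l - j)) (q - int j))"


section \<open>Nonlocal vertex algebras\<close>

(* Y u v is the series Y(u,x)v in V((x)); the product u_n v is the coefficient of x^(-n-1). *)
locale nonlocal_vertex_algebra =
  fixes Y :: "'v::complex_vector \<Rightarrow> 'v \<Rightarrow> 'v fls" and vac :: 'v
  assumes bilinear: "cbilinear Y"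
    and vacuum: "Y vac w = fls_const w"
    and creation: "n < 0 \<Longrightarrow> Y v vac $$ n = 0" "Y v vac $$ 0 = v"
    and weak_assoc: "\<exists>l. mult_add_power l (subst_shift 1 (\<lambda>m n. Y u (Y v w $$ n) $$ m))
                       = mult_add_power l (\<lambda>p q. Y (Y u v $$ p) w $$ q)"

(* Y(v_1,x_1) ... Y(v_n,x_n)vac *)
fun Y_product ::
  "('v::complex_vector \<Rightarrow> 'v \<Rightarrow> 'v fls) \<Rightarrow> 'v \<Rightarrow> 'v list \<Rightarrow> int list \<Rightarrow> 'v" where
  "Y_product Y vac [] [] = vac"
| "Y_product Y vac (v # vs) (k # ks) = Y v (Y_product Y vac vs ks) $$ k"
| "Y_product Y vac _ _ = 0"

definition Z_map ::
  "('v::complex_vector \<Rightarrow> 'v \<Rightarrow> 'v fls) \<Rightarrow> 'v \<Rightarrow> nat \<Rightarrow>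
     ('v tensor_alg, int list \<Rightarrow> complex) tensor \<Rightarrow> int list \<Rightarrow> 'v" where
  "Z_map Y vac n = tensor_lift_on (tensor_power n) (iter_laurent n)
     (\<lambda>t F. iter_laurent_mult F (tensor_alg_lift (Y_product Y vac) t))"

definition nondegenerate :: "('v::complex_vector \<Rightarrow> 'v \<Rightarrow> 'v fls) \<Rightarrow> 'v \<Rightarrow> bool" where
  "nondegenerate Y vac \<longleftrightarrow>
     (\<forall>n>0. inj_on (Z_map Y vac n) (tensor_power n \<otimes>\<^sub>S iter_laurent n))"

(* Y(\<alpha>(x_1 - x_2),x_2)w for \<alpha>(x) in V \<otimes> C((x)), with Y extended linearly over scalar series. *)
definition Y_shifted ::
  "('v::complex_vector \<Rightarrow> 'v \<Rightarrow> 'v fls) \<Rightarrow> 'v fls \<Rightarrow> 'v \<Rightarrow> int \<Rightarrow> int \<Rightarrow> 'v" where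
  "Y_shifted Y \<alpha> w = subst_shift (-1) (\<lambda>m n. Y (\<alpha> $$ m) w $$ n)"

(* Y(\<alpha>(x_1 - x_2),x_2)\<beta>(x_1), where \<beta>(x_1) is the sum over k of \<beta>_k x_1^k. *)
definition Y_shifted_series ::
  "('v::complex_vector \<Rightarrow> 'v \<Rightarrow> 'v fls) \<Rightarrow> 'v fls \<Rightarrow> 'v fls \<Rightarrow> int \<Rightarrow> int \<Rightarrow> 'v" where
  "Y_shifted_series Y \<alpha> \<beta> p q = Sum_any (\<lambda>k. Y_shifted Y \<alpha> (\<beta> $$ k) (p - k) q)"

(* a(x_1)Y(v,x_2)w *)
definition apply_Y ::
  "('v::complex_vector \<Rightarrow> 'v \<Rightarrow> 'v fls) \<Rightarrow> 'v laurent_hom \<Rightarrow> 'v \<Rightarrow> 'v \<Rightarrow> int \<Rightarrow> int \<Rightarrow> 'v" where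
  "apply_Y Y a v w p q = laurent_apply a (Y v w $$ q) $$ p"

(* Y(v,x_2)a(x_1)w *)
definition Y_apply ::
  "('v::complex_vector \<Rightarrow> 'v \<Rightarrow> 'v fls) \<Rightarrow> 'v laurent_hom \<Rightarrow> 'v \<Rightarrow> 'v \<Rightarrow> int \<Rightarrow> int \<Rightarrow> 'v" where
  "Y_apply Y a v w p q = Y v (laurent_apply a w $$ p) $$ q"

(* The list ps of pairs stands for the sum of a_(1)(x) \<otimes> a_(2)(x) over its entries. *)
definition coproduct_identity ::
  "('v::complex_vector \<Rightarrow> 'v \<Rightarrow> 'v fls) \<Rightarrow> 'v laurent_hom \<Rightarrow>
     ('v laurent_hom \<times> 'v laurent_hom) list \<Rightarrow> bool" where
  "coproduct_identity Y a ps \<longleftrightarrow>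
     (\<forall>v w p q. apply_Y Y a v w p q =
        (\<Sum>(b, c)\<leftarrow>ps. Y_shifted_series Y (laurent_apply b v) (laurent_apply c w) p q))"

definition Delta_closed ::
  "('v::complex_vector \<Rightarrow> 'v \<Rightarrow> 'v fls) \<Rightarrow> 'v laurent_hom set \<Rightarrow> bool" where
  "Delta_closed Y U \<longleftrightarrow> (\<forall>a\<in>U. \<exists>ps. set ps \<subseteq> U \<times> U \<and> coproduct_identity Y a ps)"

definition B_space ::
  "('v::complex_vector \<Rightarrow> 'v \<Rightarrow> 'v fls) \<Rightarrow> 'v \<Rightarrow> 'v laurent_hom set" where
  "B_space Y vac = cvec.span (\<Union>{U. cvec.subspace U \<and> Delta_closed Y U \<and>
     (\<forall>a\<in>U. \<exists>c. laurent_apply a vac = fls_const (c *\<^sub>C vac))})"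

definition PDer :: "('v::complex_vector \<Rightarrow> 'v \<Rightarrow> 'v fls) \<Rightarrow> 'v laurent_hom set" where
  "PDer Y = {\<psi>. \<forall>v w p q. apply_Y Y \<psi> v w p q - Y_apply Y \<psi> v w p q
                        = Y_shifted Y (laurent_apply \<psi> v) w p q}"

definition PEnd :: "('v::complex_vector \<Rightarrow> 'v \<Rightarrow> 'v fls) \<Rightarrow> 'v \<Rightarrow> 'v laurent_hom set" where
  "PEnd Y vac = {\<phi>. laurent_apply \<phi> vac = fls_const vac \<and>
     (\<forall>v w p q. apply_Y Y \<phi> v w p q
              = Y_shifted_series Y (laurent_apply \<phi> v) (laurent_apply \<phi> w) p q)}"

definition is_counit ::
  "('v::complex_vector \<Rightarrow> 'v \<Rightarrow> 'v fls) \<Rightarrow> 'v \<Rightarrow> ('v laurent_hom \<Rightarrow> complex) \<Rightarrow> bool" where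
  "is_counit Y vac \<epsilon> \<longleftrightarrow>
     (\<forall>a\<in>B_space Y vac. laurent_apply a vac = fls_const (\<epsilon> a *\<^sub>C vac))"

definition is_comultiplication ::
  "('v::complex_vector \<Rightarrow> 'v \<Rightarrow> 'v fls) \<Rightarrow> 'v \<Rightarrow>
     ('v laurent_hom \<Rightarrow> ('v laurent_hom, 'v laurent_hom) tensor) \<Rightarrow> bool" where
  "is_comultiplication Y vac \<Delta> \<longleftrightarrow>
     (\<forall>a\<in>B_space Y vac. \<exists>ps. set ps \<subseteq> B_space Y vac \<times> B_space Y vac \<and>
        coproduct_identity Y a ps \<and> \<Delta> a = (\<Sum>(b, c)\<leftarrow>ps. b \<otimes> c))"


section \<open>Differential bialgebras\<close>

(* The bialgebra is a subset B of an ambient algebra; only the restrictions to B of the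
   structure maps are constrained. *)
locale bialgebra =
  fixes B :: "'a::complex_algebra_1 set"
    and \<Delta> :: "'a \<Rightarrow> ('a, 'a) tensor"
    and \<epsilon> :: "'a \<Rightarrow> complex"
  assumes subspace: "cvec.subspace B"
    and one_mem: "1 \<in> B"
    and mult_mem: "a \<in> B \<Longrightarrow> b \<in> B \<Longrightarrow> a * b \<in> B"
    and comult_mem: "a \<in> B \<Longrightarrow> \<Delta> a \<in> B \<otimes>\<^sub>S B"
    and comult_linear: "clinear_on B \<Delta>"
    and counit_linear: "clinear_on B \<epsilon>"
    and coassoc: "a \<in> B \<Longrightarrow>
      tensor_assoc (tensor_lift_on B B (\<lambda>b c. \<Delta> b \<otimes> c) (\<Delta> a)) =
      tensor_lift_on B B (\<lambda>b c. b \<otimes> \<Delta> c) (\<Delta> a)"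
    and counit_left: "a \<in> B \<Longrightarrow> tensor_lift_on B B (\<lambda>b c. \<epsilon> b *\<^sub>C c) (\<Delta> a) = a"
    and counit_right: "a \<in> B \<Longrightarrow> tensor_lift_on B B (\<lambda>b c. \<epsilon> c *\<^sub>C b) (\<Delta> a) = a"
    and comult_one: "\<Delta> 1 = 1"
    and comult_mult: "a \<in> B \<Longrightarrow> b \<in> B \<Longrightarrow> \<Delta> (a * b) = \<Delta> a * \<Delta> b"
    and counit_one: "\<epsilon> 1 = 1"
    and counit_mult: "a \<in> B \<Longrightarrow> b \<in> B \<Longrightarrow> \<epsilon> (a * b) = \<epsilon> a * \<epsilon> b"

locale differential_bialgebra = bialgebra B \<Delta> \<epsilon>
  for B :: "'a::complex_algebra_1 set" and \<Delta> \<epsilon> +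
  fixes D :: "'a \<Rightarrow> 'a"
  assumes deriv_mem: "a \<in> B \<Longrightarrow> D a \<in> B"
    and deriv_linear: "clinear_on B D"
    and deriv_mult: "a \<in> B \<Longrightarrow> b \<in> B \<Longrightarrow> D (a * b) = D a * b + a * D b"
    and counit_deriv: "a \<in> B \<Longrightarrow> \<epsilon> (D a) = 0"
    and comult_deriv: "a \<in> B \<Longrightarrow>
      \<Delta> (D a) = tensor_lift_on B B (\<lambda>b c. D b \<otimes> c + b \<otimes> D c) (\<Delta> a)"

end

theory Submission
  imports Defs
begin

text \<open>
  Write $K = C((x))$ and regard $V \otimes K$ as a nonlocal vertex algebra, where $K$ is one by means
  of the derivation $-d/dx$. Its vertex operators are $Y(\alpha(x_1 - x_2), x_2)\beta(x_1)$. A coproduct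
  identity for $a$ says that $a$ acts on all products $Y(\alpha, x_2)\beta$ of $V \otimes K$ by the sum of
  $Y(a_{(1)}\alpha, x_2) a_{(2)}\beta$. Hence such identities can be composed and differentiated, and
  evaluation at the vacuum gives the counit laws.

  Uniqueness of the coproduct is the injectivity of $b \otimes c \mapsto Y(bu, x_2)c$. Evaluating at
  $Y(v, x_3)1$ replaces $c$ by $Y(cv, x_3)$, and nondegeneracy shows that the coefficients of
  $b(x_1 - x_2)u \otimes c(x_1 - x_3)v$ determine $b \otimes c$. The same argument with one more factor
  reduces coassociativity to an identity of operators, which follows by letting $a$ act on
  $Y(u, x_2)Y(v, x_3)w$ and on $Y(Y(u, x_0)v, x_3)w$ and comparing the results by weak associativity
  of $V \otimes K$.
\<close>

text \<open>The sign in -d/dx comes from the rule Y(f,z)g = f(x - z)g on C((x)), which is (exp(-z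
  d/dx) f)g. The substitution produces infinitely many powers of z. The sums stay finite because an
  element of V \<otimes> C((x)) involves only finitely many vectors of V up to linear combinations,
  so truncation is uniform; in V((x)) it may fail.

  Nondegeneracy concerns scalars in the variables of the vertex operators, while here a further
  variable x is common to all scalars. Fixing its exponent leaves the products f_1(x - y_1) ...
  f_n(x - y_n) as power series in the y_i. What remains is to separate f from f(x - y), which is a
  statement about binomial coefficients as polynomials in the exponent.

  The power in weak associativity depends on the vectors to which it is applied. Coassociativity
  involves only finitely many triples at a time, so one power serves all of them and can be
  cancelled.\<close>

section \<open>Scalar series in a shifted variable\<close>

lemma fls_times_nth_Sum_any: "(f * g :: complex fls) $$ n = Sum_any (\<lambda>k. f $$ k * g $$ (n - k))"
proof -
  have "fls_pure h (1::complex) = h" for h by (simp add: fls_eq_iff scaleC_complex_def)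
  then have "fls_module f g $$ n = (f * g) $$ n"
    using fls_module_pure[of f g "1::complex"] by simp
  then show ?thesis by (simp add: fls_module_nth scaleC_complex_def)
qed

lemma fls_times_nth_superset:
  assumes "finite K" "\<And>k. k \<notin> K \<Longrightarrow> f $$ k = 0 \<or> g $$ (n - k) = 0"
  shows "(f * g :: complex fls) $$ n = (\<Sum>k\<in>K. f $$ k * g $$ (n - k))"
  unfolding fls_times_nth_Sum_any
  by (rule Sum_any.expand_superset[OF assms(1)]) (use assms(2) in auto)

text \<open>The coefficient of $y^j$ in $f(x - y)$, expanded in nonnegative powers of $y$.\<close>

definition shift_coeff :: "nat \<Rightarrow> complex fls \<Rightarrow> complex fls" where
  "shift_coeff j f = Abs_fls (\<lambda>n. (- 1) ^ j * (of_int (n + int j) gchoose j) * f $$ (n + int j))"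

lemma shift_coeff_nth [simp]:
  "shift_coeff j f $$ n = (- 1) ^ j * (of_int (n + int j) gchoose j) * f $$ (n + int j)"
  unfolding shift_coeff_def
  by (subst nth_Abs_fls_lower_bound[where N = "fls_subdegree f - int j"]) auto

lemma shift_coeff_0 [simp]: "shift_coeff 0 f = f"
  by (simp add: fls_eq_iff)

lemma shift_coeff_add: "shift_coeff j (f + g) = shift_coeff j f + shift_coeff j g"
  by (simp add: fls_eq_iff algebra_simps)

lemma shift_coeff_one: "shift_coeff j 1 = (if j = 0 then 1 else 0)"
proof (cases "j = 0")
  case False
  have "(of_int (n + int j) gchoose j :: complex) = 0" if "n + int j = 0" for n
    using False that by (simp only: of_int_0 gbinomial_0) (cases j, auto)
  then show ?thesis using False by (auto simp: fls_eq_iff simp del: of_int_add)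
qed simp

text \<open>Substitution of x - y for x respects products; for monomials of exponents k and m + n -
  k this is Vandermonde's convolution.\<close>

lemma shift_coeff_mult:
  "shift_coeff n (f * g) = (\<Sum>i\<le>n. shift_coeff i f * shift_coeff (n - i) g)"
proof (rule fls_eqI)
  fix m
  define K where "K = {fls_subdegree f..m + int n - fls_subdegree g}"
  have K: "f $$ k = 0 \<or> g $$ (m + int n - k) = 0" if "k \<notin> K" for k
    using that unfolding K_def by (auto intro: fls_eq0_below_subdegree)
  have "(shift_coeff i f * shift_coeff (n - i) g) $$ m
      = (\<Sum>k\<in>K. (- 1) ^ n * ((of_int k gchoose i) * (of_int (m + int n - k) gchoose (n - i)))
           * (f $$ k * g $$ (m + int n - k)))" if "i \<le> n" for i
  proof -
    \<comment> \<open>The exponent in \<open>f\<close> is k - i + i = k, so after reindexing the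
      range \<open>K\<close> no longer depends on i and the two sums can be exchanged.\<close>
    have "(shift_coeff i f * shift_coeff (n - i) g) $$ m
        = (\<Sum>k\<in>(\<lambda>k. k - int i) ` K. shift_coeff i f $$ k * shift_coeff (n - i) g $$ (m - k))"
    proof (rule fls_times_nth_superset)
      show "finite ((\<lambda>k. k - int i) ` K)" by (simp add: K_def)
      fix k assume "k \<notin> (\<lambda>k. k - int i) ` K"
      then have "k + int i \<notin> K" by (auto simp: image_iff)
      from K[OF this] show "shift_coeff i f $$ k = 0 \<or> shift_coeff (n - i) g $$ (m - k) = 0"
        using that by (auto simp: of_nat_diff algebra_simps)
    qed
    also have "\<dots> = (\<Sum>k\<in>K. shift_coeff i f $$ (k - int i) * shift_coeff (n - i) g $$ (m - (k - int i)))"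
      by (rule sum.reindex_cong[of "\<lambda>k. k - int i"]) (auto simp: inj_on_def)
    also have "\<dots> = (\<Sum>k\<in>K. (- 1) ^ n * ((of_int k gchoose i) * (of_int (m + int n - k) gchoose (n - i)))
           * (f $$ k * g $$ (m + int n - k)))"
    proof (rule sum.cong)
      fix k
      have "(- 1 :: complex) ^ n = (- 1) ^ i * (- 1) ^ (n - i)"
        using that by (simp flip: power_add)
      moreover have "m - (k - int i) + int (n - i) = m + int n - k" "k - int i + int i = k"
        using that by simp_all
      ultimately show "shift_coeff i f $$ (k - int i) * shift_coeff (n - i) g $$ (m - (k - int i))
        = (- 1) ^ n * ((of_int k gchoose i) * (of_int (m + int n - k) gchoose (n - i)))
           * (f $$ k * g $$ (m + int n - k))"
        by (simp only: shift_coeff_nth mult_ac)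
    qed simp
    finally show ?thesis .
  qed
  then have "(\<Sum>i\<le>n. shift_coeff i f * shift_coeff (n - i) g) $$ m
     = (\<Sum>i\<le>n. \<Sum>k\<in>K. (- 1) ^ n * ((of_int k gchoose i) * (of_int (m + int n - k) gchoose (n - i)))
           * (f $$ k * g $$ (m + int n - k)))"
    by (simp add: fls_nth_sum)
  also have "\<dots> = (\<Sum>k\<in>K. (- 1) ^ n * (\<Sum>i\<le>n. (of_int k gchoose i) * (of_int (m + int n - k) gchoose (n - i)))
           * (f $$ k * g $$ (m + int n - k)))"
    by (subst sum.swap) (simp add: sum_distrib_left sum_distrib_right)
  also have "\<dots> = (\<Sum>k\<in>K. (- 1) ^ n * (of_int (m + int n) gchoose n) * (f $$ k * g $$ (m + int n - k)))"
    by (rule sum.cong) (simp_all add: atMost_atLeast0 gbinomial_Vandermonde)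
  also have "\<dots> = (- 1) ^ n * (of_int (m + int n) gchoose n) * (f * g) $$ (m + int n)"
    by (subst fls_times_nth_superset[of K]) (use K in \<open>auto simp: K_def sum_distrib_left\<close>)
  finally show "shift_coeff n (f * g) $$ m = (\<Sum>i\<le>n. shift_coeff i f * shift_coeff (n - i) g) $$ m"
    by simp
qed

text \<open>Both sides are the coefficient of y^i z^j in f(x - y - z), the right-hand side by
  expanding powers of y + z. On binomials in the exponent this is trinomial revision.\<close>

lemma shift_coeff_shift_coeff:
  "shift_coeff j (shift_coeff i f) = of_nat ((i + j) choose j) *\<^sub>C shift_coeff (i + j) f"
proof (rule fls_eqI)
  fix n
  define x :: complex where "x = of_int (n + int j + int i)"
  have "(x gchoose (i + j)) * of_nat ((i + j) choose j) = (x gchoose i) * ((x - of_nat i) gchoose j)"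
  proof -
    have "(i + j) choose j = (i + j) choose i" using binomial_symmetric[of j "i + j"] by simp
    then show ?thesis
      using gbinomial_trinomial_revision[of i "i + j" x] by (simp add: binomial_gbinomial)
  qed
  moreover have "p * d * (q * e * t) = c * (q * p * a * t)" if "a * c = e * d" for a c d e p q t :: complex
    using that by algebra
  ultimately have "(- 1) ^ j * ((x - of_nat i) gchoose j) * ((- 1) ^ i * (x gchoose i) * t)
      = of_nat ((i + j) choose j) * ((- 1) ^ i * (- 1) ^ j * (x gchoose (i + j)) * t)" for t
    by blast
  moreover have "of_int (n + int j) = x - of_nat i" by (simp add: x_def)
  moreover have "n + int (i + j) = n + int j + int i" by simp
  ultimately show "shift_coeff j (shift_coeff i f) $$ n
      = (of_nat ((i + j) choose j) *\<^sub>C shift_coeff (i + j) f) $$ n"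
    unfolding shift_coeff_nth fls_scaleC_nth scaleC_complex_def power_add x_def by metis
qed

text \<open>The polynomials $\binom{m}{j}$ span all polynomials in $m$. The induction removes a point
  $m_0$ from $S$ by passing to the weights $(m - m_0) T(m)$, whose moments vanish as well because
  $m \binom{m}{j}$ is a combination of $\binom{m}{j}$ and $\binom{m}{j+1}$.\<close>

lemma gchoose_moments_eq_0:
  fixes T :: "int \<Rightarrow> complex"
  assumes "finite S" "\<And>j. (\<Sum>m\<in>S. (of_int m gchoose j) * T m) = 0" "m \<in> S"
  shows "T m = 0"
  using assms
proof (induct "card S" arbitrary: S T m)
  case (Suc n)
  have other: "T m = 0" if "m \<in> S" "m0 \<in> S" "m \<noteq> m0" for m m0
  proof -
    have "(of_int m - of_int m0) * T m = 0"
    proof (rule Suc.hyps(1)[of "S - {m0}"])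
      show "n = card (S - {m0})" using Suc.hyps(2) Suc.prems(1) that by simp
      show "m \<in> S - {m0}" using that by simp
      fix j
      have "(\<Sum>m\<in>S - {m0}. (of_int m gchoose j) * ((of_int m - of_int m0) * T m))
          = (\<Sum>m\<in>S. (of_int m gchoose j) * ((of_int m - of_int m0) * T m))"
        by (rule sum.mono_neutral_left) (use Suc.prems(1) in auto)
      also have "\<dots> = (\<Sum>m\<in>S. of_nat (Suc j) * ((of_int m gchoose Suc j) * T m)
                        + (of_nat j - of_int m0) * ((of_int m gchoose j) * T m))"
      proof (rule sum.cong)
        fix m :: int
        have "of_int m * (of_int m gchoose j)
            = of_nat j * (of_int m gchoose j) + of_nat (Suc j) * (of_int m gchoose Suc j :: complex)"
          by (rule gbinomial_mult_1)
        moreover have "c * ((x - y) * t) = b * (d * t) + (a - y) * (c * t)" if "x * c = a * c + b * d"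
          for a b c d t x y :: complex
          using that by algebra
        ultimately show "(of_int m gchoose j) * ((of_int m - of_int m0) * T m)
          = of_nat (Suc j) * ((of_int m gchoose Suc j) * T m)
            + (of_nat j - of_int m0) * ((of_int m gchoose j) * T m)"
          by blast
      qed simp
      also have "\<dots> = 0"
        by (simp only: sum.distrib sum_distrib_left[symmetric] Suc.prems(2)) simp
      finally show "(\<Sum>m\<in>S - {m0}. (of_int m gchoose j) * ((of_int m - of_int m0) * T m)) = 0" .
    qed (use Suc.prems in auto)
    then show ?thesis using that by simp
  qed
  \<comment> \<open>This also covers a singleton \<open>S\<close>, about which \<open>other\<close>
    says nothing. The moment with j = 0 is the plain sum.\<close>
  have "(\<Sum>k\<in>S. T k) = (\<Sum>k\<in>S. if k = m then T m else 0)"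
    by (rule sum.cong) (use other Suc.prems(3) in auto)
  then show ?case using Suc.prems(1,3) Suc.prems(2)[of 0] by simp
qed auto

text \<open>Fix the total degree s = m + n. The hypothesis for j, read at x^(s - j), says that the
  j-th binomial moment of \<open>T\<close> vanishes, so \<open>gchoose_moments_eq_0\<close> applies.
  Hence the sum of f_i(x - y) g_i(x) determines the sum of f_i(x_1) g_i(x_2).\<close>

lemma shift_coeff_products_eq_0:
  assumes "finite I" "\<And>j. (\<Sum>i\<in>I. shift_coeff j (f i) * g i) = 0"
  shows "(\<Sum>i\<in>I. fls_const (f i $$ m) * g i) = 0"
proof (rule fls_eqI)
  fix n
  define s where "s = m + n"
  \<comment> \<open>Common lower bounds for the finitely many series confine the exponents to one
    interval. The inserted 0 keeps \<open>Min\<close> defined when \<open>I\<close> is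
    empty.\<close>
  obtain a where a: "\<And>i k. i \<in> I \<Longrightarrow> k < a \<Longrightarrow> f i $$ k = 0"
  proof (rule that[of "Min (insert 0 ((\<lambda>i. fls_subdegree (f i)) ` I))"])
    show "f i $$ k = 0" if "i \<in> I" "k < Min (insert 0 ((\<lambda>i. fls_subdegree (f i)) ` I))" for i k
      using that assms(1) by (intro fls_eq0_below_subdegree) auto
  qed
  obtain b where b: "\<And>i k. i \<in> I \<Longrightarrow> k < b \<Longrightarrow> g i $$ k = 0"
  proof (rule that[of "Min (insert 0 ((\<lambda>i. fls_subdegree (g i)) ` I))"])
    show "g i $$ k = 0" if "i \<in> I" "k < Min (insert 0 ((\<lambda>i. fls_subdegree (g i)) ` I))" for i k
      using that assms(1) by (intro fls_eq0_below_subdegree) auto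
  qed
  define T where "T k = (\<Sum>i\<in>I. f i $$ k * g i $$ (s - k))" for k
  have T0: "T k = 0" if "k \<notin> {a..s - b}" for k
    unfolding T_def using that a b by (intro sum.neutral) force
  have "(\<Sum>k=a..s - b. (of_int k gchoose j) * T k) = 0" for j
  proof -
    have "(shift_coeff j (f i) * g i) $$ (s - int j)
        = (\<Sum>k=a..s - b. (- 1) ^ j * (of_int k gchoose j) * (f i $$ k * g i $$ (s - k)))" if "i \<in> I" for i
    proof -
      have "(shift_coeff j (f i) * g i) $$ (s - int j)
          = (\<Sum>k\<in>(\<lambda>k. k - int j) ` {a..s - b}. shift_coeff j (f i) $$ k * g i $$ (s - int j - k))"
      proof (rule fls_times_nth_superset)
        fix k assume "k \<notin> (\<lambda>k. k - int j) ` {a..s - b}"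
        then have "k + int j \<notin> {a..s - b}" by (auto simp: image_iff)
        then show "shift_coeff j (f i) $$ k = 0 \<or> g i $$ (s - int j - k) = 0"
          using a[OF that] b[OF that] by force
      qed simp
      also have "\<dots> = (\<Sum>k=a..s - b. shift_coeff j (f i) $$ (k - int j) * g i $$ (s - int j - (k - int j)))"
        by (rule sum.reindex_cong[of "\<lambda>k. k - int j"]) (auto simp: inj_on_def)
      finally show ?thesis by (simp add: ac_simps)
    qed
    then have "(\<Sum>i\<in>I. shift_coeff j (f i) * g i) $$ (s - int j)
       = (\<Sum>i\<in>I. \<Sum>k=a..s - b. (- 1) ^ j * (of_int k gchoose j) * (f i $$ k * g i $$ (s - k)))"
      by (simp add: fls_nth_sum)
    also have "\<dots> = (- 1) ^ j * (\<Sum>k=a..s - b. (of_int k gchoose j) * T k)"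
      by (subst sum.swap) (simp add: T_def sum_distrib_left mult.assoc)
    finally show ?thesis using assms(2)[of j] by simp
  qed
  from gchoose_moments_eq_0[OF _ this] T0[of m] have "T m = 0" by (cases "m \<in> {a..s - b}") auto
  then show "(\<Sum>i\<in>I. fls_const (f i $$ m) * g i) $$ n = 0 $$ n"
    by (simp add: T_def s_def fls_nth_sum)
qed

section \<open>Vertex operators on $V \otimes C((x))$\<close>

text \<open>Every infinite sum below has, in each coefficient, only finitely many nonzero terms. Stating
  this as eventual equality with the partial sums lets finite operations be applied termwise.\<close>

definition ev_sum :: "'a::comm_monoid_add \<Rightarrow> (nat \<Rightarrow> 'a) \<Rightarrow> bool" where
  "ev_sum x g \<longleftrightarrow> (\<forall>\<^sub>F N in sequentially. x = (\<Sum>j\<le>N. g j))"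

lemma ev_sumI:
  assumes "\<And>j. j > M \<Longrightarrow> g j = 0" "x = (\<Sum>j\<le>M. g j)"
  shows "ev_sum x g"
  unfolding ev_sum_def
proof (rule eventually_sequentiallyI[of M])
  fix N assume "M \<le> N"
  then have "(\<Sum>j\<le>M. g j) = (\<Sum>j\<le>N. g j)"
    by (intro sum.mono_neutral_left) (use assms(1) in auto)
  with assms(2) show "x = (\<Sum>j\<le>N. g j)" by simp
qed

lemma ev_sum_unique:
  assumes "ev_sum x g" "ev_sum y g" shows "x = y"
proof -
  have "\<forall>\<^sub>F N in sequentially. x = y"
    using assms unfolding ev_sum_def by eventually_elim simp
  then show ?thesis by simp
qed

lemma ev_sum_add: "ev_sum x g \<Longrightarrow> ev_sum y h \<Longrightarrow> ev_sum (x + y) (\<lambda>j. g j + h j)"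
  unfolding ev_sum_def by (erule (1) eventually_elim2) (simp add: sum.distrib)

lemma ev_sum_zero: "ev_sum 0 (\<lambda>j. 0)"
  by (rule ev_sumI[of 0]) auto

lemma ev_sum_sum:
  "finite A \<Longrightarrow> (\<And>i. i \<in> A \<Longrightarrow> ev_sum (x i) (g i)) \<Longrightarrow> ev_sum (\<Sum>i\<in>A. x i) (\<lambda>j. \<Sum>i\<in>A. g i j)"
  by (induct A rule: finite_induct) (auto intro: ev_sum_add ev_sum_zero)

lemma ev_sum_sum_list:
  "(\<And>i. i \<in> set A \<Longrightarrow> ev_sum (x i) (g i)) \<Longrightarrow> ev_sum (\<Sum>i\<leftarrow>A. x i) (\<lambda>j. \<Sum>i\<leftarrow>A. g i j)"
  by (induct A) (auto intro: ev_sum_add ev_sum_zero)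

lemma subspace_sum_list:
  "cvec.subspace S \<Longrightarrow> (\<And>i. i \<in> set A \<Longrightarrow> g i \<in> S) \<Longrightarrow> (\<Sum>i\<leftarrow>A. g i) \<in> S"
  by (induct A) (auto intro: cvec.subspace_0 cvec.subspace_add)

lemma clinear_on_0: "cvec.subspace S \<Longrightarrow> clinear_on S T \<Longrightarrow> T 0 = 0"
  unfolding clinear_on_def by (metis cvec.scale_zero_left cvec.subspace_0)

lemma clinear_on_sum:
  assumes "cvec.subspace S" "clinear_on S T" "\<And>i. i \<in> A \<Longrightarrow> g i \<in> S"
  shows "T (\<Sum>i\<in>A. g i) = (\<Sum>i\<in>A. T (g i))"
proof (cases "finite A")
  case True
  then show ?thesis using assms(3)
  proof (induct A rule: finite_induct)
    case (insert i A)
    have "(\<Sum>i\<in>A. g i) \<in> S" by (rule cvec.subspace_sum[OF assms(1)]) (use insert in auto)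
    then show ?case using insert assms(2) by (simp add: clinear_on_def)
  qed (simp add: clinear_on_0[OF assms(1,2)])
qed (simp add: clinear_on_0[OF assms(1,2)])

lemma clinear_on_sum_list:
  assumes "cvec.subspace S" "clinear_on S T" "\<And>i. i \<in> set A \<Longrightarrow> g i \<in> S"
  shows "T (\<Sum>i\<leftarrow>A. g i) = (\<Sum>i\<leftarrow>A. T (g i))"
  using assms(3)
proof (induct A)
  case (Cons i A)
  have "(\<Sum>i\<leftarrow>A. g i) \<in> S" by (rule subspace_sum_list[OF assms(1)]) (use Cons in auto)
  then show ?case using Cons assms(2) by (simp add: clinear_on_def)
qed (simp add: clinear_on_0[OF assms(1,2)])

lemma ev_sum_linear:
  assumes "ev_sum x g" "cvec.subspace S" "clinear_on S T" "\<And>j. g j \<in> S"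
  shows "ev_sum (T x) (\<lambda>j. T (g j))"
  using assms(1) unfolding ev_sum_def
  by eventually_elim (simp add: clinear_on_sum[OF assms(2-4)])

lemma ev_sum_clinear: "ev_sum x g \<Longrightarrow> clinear T \<Longrightarrow> ev_sum (T x) (\<lambda>j. T (g j))"
  by (rule ev_sum_linear[where S = UNIV]) (auto simp: clinear_on_def clinear_iff)

text \<open>A product of two expansions gives a double sum over a square, while a single expansion
  runs over antidiagonals. No antidiagonal beyond 2M meets the square.\<close>

lemma ev_sum_triangle:
  fixes z :: "nat \<Rightarrow> nat \<Rightarrow> 'a::comm_monoid_add"
  assumes "\<And>i j. i > M \<or> j > M \<Longrightarrow> z i j = 0"
  shows "ev_sum (\<Sum>i\<le>M. \<Sum>j\<le>M. z i j) (\<lambda>n. \<Sum>i\<le>n. z i (n - i))"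
proof (rule ev_sumI[of "2 * M"])
  show "(\<Sum>i\<le>n. z i (n - i)) = 0" if "n > 2 * M" for n
    using that by (intro sum.neutral ballI assms) auto
  have "(\<Sum>i\<le>M. \<Sum>j\<le>M. z i j) = (\<Sum>(i, j)\<in>{..M} \<times> {..M}. z i j)"
    by (simp add: sum.cartesian_product)
  also have "\<dots> = (\<Sum>(i, j)\<in>{(i, j). i + j \<le> 2 * M}. z i j)"
  proof (rule sum.mono_neutral_left)
    show "finite {(i, j). i + j \<le> 2 * M}"
      by (rule finite_subset[of _ "{..2 * M} \<times> {..2 * M}"]) auto
    show "{..M} \<times> {..M} \<subseteq> {(i, j). i + j \<le> 2 * M}" by auto
    show "\<forall>ij\<in>{(i, j). i + j \<le> 2 * M} - {..M} \<times> {..M}. (case ij of (i, j) \<Rightarrow> z i j) = 0"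
      using assms by (auto simp: not_le) (meson not_le)+
  qed
  also have "\<dots> = (\<Sum>n\<le>2 * M. \<Sum>i\<le>n. z i (n - i))"
    by (rule sum.triangle_reindex_eq)
  finally show "(\<Sum>i\<le>M. \<Sum>j\<le>M. z i j) = (\<Sum>n\<le>2 * M. \<Sum>i\<le>n. z i (n - i))" .
qed

section \<open>The C((x))-module V \<otimes> C((x))\<close>

abbreviation W :: "'v::complex_vector fls set" where "W \<equiv> laurent_tensor"

lemma W_add: "x \<in> W \<Longrightarrow> y \<in> W \<Longrightarrow> x + y \<in> W"
  by (rule cvec.subspace_add[OF subspace_laurent_tensor])

lemma W_zero: "0 \<in> W"
  by (rule cvec.subspace_0[OF subspace_laurent_tensor])

lemma W_scale: "x \<in> W \<Longrightarrow> c *\<^sub>C x \<in> W"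
  by (rule cvec.subspace_scale[OF subspace_laurent_tensor])

lemma W_sum: "(\<And>i. i \<in> A \<Longrightarrow> g i \<in> W) \<Longrightarrow> (\<Sum>i\<in>A. g i) \<in> W"
  by (rule cvec.subspace_sum[OF subspace_laurent_tensor])

lemma W_ev_sum: "ev_sum x g \<Longrightarrow> (\<And>j. g j \<in> W) \<Longrightarrow> x \<in> W"
  unfolding ev_sum_def by (force simp: eventually_sequentially intro: W_sum)

lemma fls_pure_add_left: "fls_pure (f + g) v = fls_pure f v + fls_pure g v"
  by (simp add: fls_eq_iff cvec.scale_left_distrib)

lemma fls_pure_sum_left: "fls_pure (\<Sum>i\<in>A. f i) v = (\<Sum>i\<in>A. fls_pure (f i) v)"
  by (simp add: fls_eq_iff fls_nth_sum cvec.scale_sum_left)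

lemma fls_pure_0 [simp]: "fls_pure f 0 = 0" "fls_pure 0 v = 0"
  by (simp_all add: fls_eq_iff)

lemma fls_pure_1: "fls_pure 1 v = fls_const v"
  by (auto simp: fls_eq_iff)

lemma fls_module_0 [simp]: "fls_module f 0 = 0"
  by (metis cvec.scale_zero_left fls_module_scale)

lemma fls_module_sum: "fls_module f (\<Sum>i\<in>A. g i) = (\<Sum>i\<in>A. fls_module f (g i))"
  by (induct A rule: infinite_finite_induct) (auto simp: fls_module_add)

lemma fls_module_sum_list: "fls_module f (\<Sum>i\<leftarrow>A. g i) = (\<Sum>i\<leftarrow>A. fls_module f (g i))"
  by (induct A) (auto simp: fls_module_add)

lemma fls_module_add_left:
  "x \<in> W \<Longrightarrow> fls_module (f + g) x = fls_module f x + fls_module g x"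
  by (induct rule: laurent_tensor_induct)
     (auto simp: fls_module_add fls_module_pure distrib_right fls_pure_add_left)

lemma fls_module_0_left [simp]: "fls_module 0 x = 0"
  by (simp add: fls_eq_iff fls_module_nth)

lemma fls_module_scale_left:
  "x \<in> W \<Longrightarrow> fls_module (c *\<^sub>C f) x = c *\<^sub>C fls_module f x"
proof (induct rule: laurent_tensor_induct)
  case (add g v h)
  have "c *\<^sub>C h = fls_const c * h" for h
    by (simp add: fls_eq_iff scaleC_complex_def)
  then have "(c *\<^sub>C f) * g = c *\<^sub>C (f * g)" by (simp add: mult.assoc)
  then have "fls_pure ((c *\<^sub>C f) * g) v = c *\<^sub>C fls_pure (f * g) v"
    by (simp add: fls_eq_iff scaleC_complex_def mult_ac)
  with add show ?case by (simp add: fls_module_add fls_module_pure cvec.scale_right_distrib)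
qed simp

lemma fls_module_1: "x \<in> W \<Longrightarrow> fls_module 1 x = x"
  by (induct rule: laurent_tensor_induct) (auto simp: fls_module_add fls_module_pure)

lemma fls_pure_eq_module: "fls_pure f v = fls_module f (fls_const v)"
  using fls_module_pure[of f 1 v] by (simp add: fls_pure_1)

text \<open>Here k is the exponent of x_1 taken from \<open>\<beta>\<close>, and j is the power of
  x_2 taken from (x_1 - x_2)^(p - k + j).\<close>

definition Y_shift_summand ::
  "('v::complex_vector \<Rightarrow> 'v \<Rightarrow> 'v fls) \<Rightarrow> 'v fls \<Rightarrow> 'v fls \<Rightarrow> int \<Rightarrow> int \<Rightarrow> int \<Rightarrow> nat \<Rightarrow> 'v" where
  "Y_shift_summand Y \<alpha> \<beta> p q k j = ((- 1) ^ j * (of_int (p - k + int j) gchoose j))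
        *\<^sub>C (Y (\<alpha> $$ (p - k + int j)) (\<beta> $$ k) $$ (q - int j))"

text \<open>$Y(\alpha(x_1 - x_2), x_2)\beta(x_1)$ is regarded as a series in $x_2$ whose coefficient at
  $x_2^q$ is a series in $x_1$. Then $C((x_1))$ is a field of scalars.\<close>

definition Yq :: "('v::complex_vector \<Rightarrow> 'v \<Rightarrow> 'v fls) \<Rightarrow> 'v fls \<Rightarrow> 'v fls \<Rightarrow> int \<Rightarrow> 'v fls" where
  "Yq Y \<alpha> \<beta> q = Abs_fls (\<lambda>p. Y_shifted_series Y \<alpha> \<beta> p q)"

section \<open>Expansion, bilinearity and scalars for the extended vertex operators\<close>

context nonlocal_vertex_algebra
begin

lemma Y_linear [simp]:
  "Y (u + v) w = Y u w + Y v w" "Y u (v + w) = Y u v + Y u w"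
  "Y (c *\<^sub>C v) w = c *\<^sub>C Y v w" "Y v (c *\<^sub>C w) = c *\<^sub>C Y v w"
  using bilinear by (auto simp: cbilinear_def clinear_iff)

lemma Y_0 [simp]: "Y 0 w = 0" "Y v 0 = 0"
  using Y_linear(3,4)[where c = 0] by simp_all

text \<open>Elements of \<open>W\<close> are finite sums of pure tensors, so up to linear
  combinations only finitely many series \<open>Y u v\<close> occur, each with its own lower
  bound.\<close>

lemma Y_bound:
  assumes "\<alpha> \<in> W" "\<beta> \<in> W"
  obtains N where "\<And>m k n. n < N \<Longrightarrow> Y (\<alpha> $$ m) (\<beta> $$ k) $$ n = 0"
proof -
  have 1: "\<exists>N. \<forall>k n. n < N \<longrightarrow> Y u (\<beta> $$ k) $$ n = 0" for u
    using assms(2)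
  proof (induct rule: laurent_tensor_induct)
    case (add f v g)
    then obtain N where "\<forall>k n. n < N \<longrightarrow> Y u (g $$ k) $$ n = 0" by blast
    then show ?case by (intro exI[of _ "min N (fls_subdegree (Y u v))"]) auto
  qed simp
  have "\<exists>N. \<forall>m k n. n < N \<longrightarrow> Y (\<alpha> $$ m) (\<beta> $$ k) $$ n = 0"
    using assms(1)
  proof (induct rule: laurent_tensor_induct)
    case (add f v g)
    then obtain N where "\<forall>m k n. n < N \<longrightarrow> Y (g $$ m) (\<beta> $$ k) $$ n = 0" by blast
    moreover obtain M where "\<forall>k n. n < M \<longrightarrow> Y v (\<beta> $$ k) $$ n = 0" using 1 by blast
    ultimately show ?case by (intro exI[of _ "min N M"]) auto
  qed simp
  then show thesis using that by blast
qed

text \<open>For j > J the exponent q - j lies below N. For j \<le> J a nonzero coefficient of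
  \<open>\<alpha>\<close> needs p - k + j \<ge> a, which gives the upper limit for k.\<close>

lemma Y_shifted_series_finite:
  assumes N: "\<And>m k n. n < N \<Longrightarrow> Y (\<alpha> $$ m) (\<beta> $$ k) $$ n = 0"
    and a: "\<And>m. m < a \<Longrightarrow> \<alpha> $$ m = 0" and b: "\<And>k. k < b \<Longrightarrow> \<beta> $$ k = 0"
    and J: "q - int J \<le> N"
  shows "Y_shifted_series Y \<alpha> \<beta> p q = (\<Sum>k=b..p - a + int J. \<Sum>j\<le>J. Y_shift_summand Y \<alpha> \<beta> p q k j)"
proof -
  have J0: "Y_shift_summand Y \<alpha> \<beta> p q k j = 0" if "j \<notin> {..J}" for k j
    using that N[of "q - int j"] J by (simp add: Y_shift_summand_def)
  have "Y_shifted Y \<alpha> (\<beta> $$ k) (p - k) q = Sum_any (Y_shift_summand Y \<alpha> \<beta> p q k)" for k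
    by (simp add: Y_shifted_def subst_shift_def Y_shift_summand_def)
  also have "Sum_any (Y_shift_summand Y \<alpha> \<beta> p q k) = (\<Sum>j\<le>J. Y_shift_summand Y \<alpha> \<beta> p q k j)" for k
    by (rule Sum_any.expand_superset) (use J0 in auto)
  finally have "Y_shifted_series Y \<alpha> \<beta> p q = Sum_any (\<lambda>k. \<Sum>j\<le>J. Y_shift_summand Y \<alpha> \<beta> p q k j)"
    by (simp add: Y_shifted_series_def)
  also have "\<dots> = (\<Sum>k=b..p - a + int J. \<Sum>j\<le>J. Y_shift_summand Y \<alpha> \<beta> p q k j)"
  proof (rule Sum_any.expand_superset)
    have "Y_shift_summand Y \<alpha> \<beta> p q k j = 0" if "k \<notin> {b..p - a + int J}" "j \<le> J" for k j
      using that a[of "p - k + int j"] b[of k] by (auto simp: Y_shift_summand_def not_le)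
    then have "(\<Sum>j\<le>J. Y_shift_summand Y \<alpha> \<beta> p q k j) = 0" if "k \<notin> {b..p - a + int J}" for k
      using that by (intro sum.neutral) blast
    then show "{k. (\<Sum>j\<le>J. Y_shift_summand Y \<alpha> \<beta> p q k j) \<noteq> 0} \<subseteq> {b..p - a + int J}"
      by blast
  qed simp
  finally show ?thesis .
qed

lemma Yq_nth:
  assumes "\<alpha> \<in> W" "\<beta> \<in> W"
  shows "Yq Y \<alpha> \<beta> q $$ p = Y_shifted_series Y \<alpha> \<beta> p q"
proof -
  obtain N where N: "\<And>m k n. n < N \<Longrightarrow> Y (\<alpha> $$ m) (\<beta> $$ k) $$ n = 0"
    using Y_bound[OF assms] by blast
  \<comment> \<open>Below this exponent the interval for k in \<open>Y_shifted_series_finite\<close>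
    is empty.\<close>
  have "Y_shifted_series Y \<alpha> \<beta> p q = 0"
    if "p < fls_subdegree \<alpha> + fls_subdegree \<beta> - int (nat (q - N))" for p
    using that
    by (subst Y_shifted_series_finite[OF N, where a = "fls_subdegree \<alpha>" and b = "fls_subdegree \<beta>"
            and J = "nat (q - N)"]) (auto intro: fls_eq0_below_subdegree)
  then show ?thesis
    unfolding Yq_def
    by (subst nth_Abs_fls_lower_bound[where N = "fls_subdegree \<alpha> + fls_subdegree \<beta> - int (nat (q - N))"])
       auto
qed

text \<open>This exhibits \<open>Yq\<close> as the tensor product of \<open>Y\<close> with the rule
  f(x - z)g on C((x)). By bilinearity it determines \<open>Yq\<close> on \<open>W\<close>.\<close>

lemma Yq_pure:
  "ev_sum (Yq Y (fls_pure f u) (fls_pure g w) q)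
     (\<lambda>j. fls_pure (shift_coeff j f * g) (Y u w $$ (q - int j)))"
proof -
  define N where "N = fls_subdegree (Y u w)"
  define J where "J = nat (q - N)"
  have N: "Y u w $$ n = 0" if "n < N" for n
    using that by (simp add: N_def)
  show ?thesis
  proof (rule ev_sumI[of J])
    show "fls_pure (shift_coeff j f * g) (Y u w $$ (q - int j)) = 0" if "j > J" for j
      using that N[of "q - int j"] by (simp add: J_def)
    show "Yq Y (fls_pure f u) (fls_pure g w) q
        = (\<Sum>j\<le>J. fls_pure (shift_coeff j f * g) (Y u w $$ (q - int j)))" (is "?l = ?r")
    proof (rule fls_eqI)
      fix p
      define a where "a = fls_subdegree f"
      define b where "b = fls_subdegree g"
      have a: "f $$ m = 0" if "m < a" for m using that by (simp add: a_def)
      have b: "g $$ m = 0" if "m < b" for m using that by (simp add: b_def)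
      have "?l $$ p = (\<Sum>k=b..p - a + int J. \<Sum>j\<le>J.
          Y_shift_summand Y (fls_pure f u) (fls_pure g w) p q k j)"
        unfolding Yq_nth[OF laurent_tensor_pure laurent_tensor_pure]
        by (rule Y_shifted_series_finite[where N = N]) (use a b N in \<open>auto simp: J_def\<close>)
      also have "\<dots> = (\<Sum>j\<le>J. (\<Sum>k=b..p - a + int J. g $$ k * shift_coeff j f $$ (p - k))
                             *\<^sub>C (Y u w $$ (q - int j)))"
        by (subst sum.swap) (simp add: cvec.scale_sum_left mult_ac Y_shift_summand_def)
      also have "\<dots> = (\<Sum>j\<le>J. ((g * shift_coeff j f) $$ p) *\<^sub>C (Y u w $$ (q - int j)))"
      proof (rule sum.cong)
        fix j assume "j \<in> {..J}"
        then have "(g * shift_coeff j f) $$ p = (\<Sum>k=b..p - a + int J. g $$ k * shift_coeff j f $$ (p - k))"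
          by (intro fls_times_nth_superset) (use a b in \<open>auto simp: not_le\<close>)
        then show "(\<Sum>k=b..p - a + int J. g $$ k * shift_coeff j f $$ (p - k)) *\<^sub>C (Y u w $$ (q - int j))
           = ((g * shift_coeff j f) $$ p) *\<^sub>C (Y u w $$ (q - int j))" by simp
      qed simp
      also have "\<dots> = ?r $$ p" by (simp add: fls_nth_sum mult.commute)
      finally show "?l $$ p = ?r $$ p" .
    qed
  qed
qed

text \<open>The index sets do not depend on \<open>\<alpha>\<close> and \<open>\<beta>\<close>, so
  series with different arguments can be compared term by term.\<close>

lemma Y_shifted_series_common:
  assumes "\<alpha> \<in> W" "\<beta> \<in> W"
  shows "\<forall>\<^sub>F M in sequentially. Y_shifted_series Y \<alpha> \<beta> p q =
    (\<Sum>k=-int M..int M. \<Sum>j\<le>M. Y_shift_summand Y \<alpha> \<beta> p q k j)"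
proof -
  obtain N where N: "\<And>m k n. n < N \<Longrightarrow> Y (\<alpha> $$ m) (\<beta> $$ k) $$ n = 0"
    using Y_bound[OF assms] by blast
  define J where "J = nat (q - N)"
  define a b where "a = fls_subdegree \<alpha>" and "b = fls_subdegree \<beta>"
  let ?F = "Y_shift_summand Y \<alpha> \<beta> p q"
  have "Y_shifted_series Y \<alpha> \<beta> p q = (\<Sum>k=-int M..int M. \<Sum>j\<le>M. ?F k j)"
    if M: "int M \<ge> - b" "int M \<ge> p - a + int J" "M \<ge> J" for M
  proof -
    have J0: "?F k j = 0" if "j > J" for k j
      using that N[of "q - int j"] by (simp add: Y_shift_summand_def J_def)
    have k0: "?F k j = 0" if "k \<notin> {b..p - a + int J}" "j \<le> J" for k j
    proof -
      have "k < b \<or> p - k + int j < a" using that by auto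
      then show ?thesis by (auto simp: Y_shift_summand_def a_def b_def)
    qed
    have "Y_shifted_series Y \<alpha> \<beta> p q = (\<Sum>k=b..p - a + int J. \<Sum>j\<le>J. ?F k j)"
      by (rule Y_shifted_series_finite[OF N]) (auto simp: a_def b_def J_def)
    also have "\<dots> = (\<Sum>k=-int M..int M. \<Sum>j\<le>J. ?F k j)"
      by (rule sum.mono_neutral_left) (use M k0 in \<open>auto intro!: sum.neutral\<close>)
    also have "\<dots> = (\<Sum>k=-int M..int M. \<Sum>j\<le>M. ?F k j)"
      by (intro sum.cong sum.mono_neutral_left) (use M J0 in auto)
    finally show ?thesis .
  qed
  then show ?thesis
    by (intro eventually_sequentiallyI[of "nat (max (- b) (max (p - a + int J) (int J)))"]) auto
qed

lemma Yq_add_left: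
  assumes "\<alpha> \<in> W" "\<alpha>' \<in> W" "\<beta> \<in> W"
  shows "Yq Y (\<alpha> + \<alpha>') \<beta> q = Yq Y \<alpha> \<beta> q + Yq Y \<alpha>' \<beta> q"
proof (rule fls_eqI)
  fix p
  have "\<forall>\<^sub>F M in sequentially. Y_shifted_series Y (\<alpha> + \<alpha>') \<beta> p q
     = Y_shifted_series Y \<alpha> \<beta> p q + Y_shifted_series Y \<alpha>' \<beta> p q"
    using Y_shifted_series_common[OF assms(1,3), of p q] Y_shifted_series_common[OF assms(2,3), of p q]
      Y_shifted_series_common[OF W_add[OF assms(1,2)] assms(3), of p q]
    by eventually_elim (simp add: sum.distrib cvec.scale_right_distrib Y_shift_summand_def)
  then show "Yq Y (\<alpha> + \<alpha>') \<beta> q $$ p = (Yq Y \<alpha> \<beta> q + Yq Y \<alpha>' \<beta> q) $$ p"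
    by (simp add: Yq_nth assms W_add)
qed

lemma Yq_add_right:
  assumes "\<alpha> \<in> W" "\<beta> \<in> W" "\<beta>' \<in> W"
  shows "Yq Y \<alpha> (\<beta> + \<beta>') q = Yq Y \<alpha> \<beta> q + Yq Y \<alpha> \<beta>' q"
proof (rule fls_eqI)
  fix p
  have "\<forall>\<^sub>F M in sequentially. Y_shifted_series Y \<alpha> (\<beta> + \<beta>') p q
     = Y_shifted_series Y \<alpha> \<beta> p q + Y_shifted_series Y \<alpha> \<beta>' p q"
    using Y_shifted_series_common[OF assms(1,2), of p q] Y_shifted_series_common[OF assms(1,3), of p q]
      Y_shifted_series_common[OF assms(1) W_add[OF assms(2,3)], of p q]
    by eventually_elim (simp add: sum.distrib cvec.scale_right_distrib Y_shift_summand_def)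
  then show "Yq Y \<alpha> (\<beta> + \<beta>') q $$ p = (Yq Y \<alpha> \<beta> q + Yq Y \<alpha> \<beta>' q) $$ p"
    by (simp add: Yq_nth assms W_add)
qed

lemma Yq_scale:
  assumes "\<alpha> \<in> W" "\<beta> \<in> W"
  shows "Yq Y (c *\<^sub>C \<alpha>) \<beta> q = c *\<^sub>C Yq Y \<alpha> \<beta> q" "Yq Y \<alpha> (c *\<^sub>C \<beta>) q = c *\<^sub>C Yq Y \<alpha> \<beta> q"
proof -
  have "\<forall>\<^sub>F M in sequentially. Y_shifted_series Y (c *\<^sub>C \<alpha>) \<beta> p q
     = c *\<^sub>C Y_shifted_series Y \<alpha> \<beta> p q" for p
    using Y_shifted_series_common[OF assms, of p q]
      Y_shifted_series_common[OF W_scale[OF assms(1)] assms(2), of c p q]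
    by eventually_elim (simp add: cvec.scale_sum_right Y_shift_summand_def mult.commute)
  moreover have "\<forall>\<^sub>F M in sequentially. Y_shifted_series Y \<alpha> (c *\<^sub>C \<beta>) p q
     = c *\<^sub>C Y_shifted_series Y \<alpha> \<beta> p q" for p
    using Y_shifted_series_common[OF assms, of p q]
      Y_shifted_series_common[OF assms(1) W_scale[OF assms(2)], of c p q]
    by eventually_elim (simp add: cvec.scale_sum_right Y_shift_summand_def mult.commute)
  ultimately show "Yq Y (c *\<^sub>C \<alpha>) \<beta> q = c *\<^sub>C Yq Y \<alpha> \<beta> q" "Yq Y \<alpha> (c *\<^sub>C \<beta>) q = c *\<^sub>C Yq Y \<alpha> \<beta> q"
    by (simp_all add: fls_eq_iff Yq_nth assms W_scale)
qed

lemma Yq_linear_on: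
  "\<beta> \<in> W \<Longrightarrow> clinear_on W (\<lambda>\<alpha>. Yq Y \<alpha> \<beta> q)"
  "\<alpha> \<in> W \<Longrightarrow> clinear_on W (\<lambda>\<beta>. Yq Y \<alpha> \<beta> q)"
  by (simp_all add: clinear_on_def Yq_add_left Yq_add_right Yq_scale)

lemma Yq_0 [simp]:
  "\<beta> \<in> W \<Longrightarrow> Yq Y 0 \<beta> q = 0" "\<alpha> \<in> W \<Longrightarrow> Yq Y \<alpha> 0 q = 0"
  using clinear_on_0[OF subspace_laurent_tensor Yq_linear_on(1)]
    clinear_on_0[OF subspace_laurent_tensor Yq_linear_on(2)] by auto

lemma Yq_in [simp]: "\<alpha> \<in> W \<Longrightarrow> \<beta> \<in> W \<Longrightarrow> Yq Y \<alpha> \<beta> q \<in> W"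
proof (induct \<alpha> rule: laurent_tensor_induct)
  case (add f u \<alpha>)
  have "Yq Y (fls_pure f u) \<beta> q \<in> W" using add(3)
  proof (induct \<beta> rule: laurent_tensor_induct)
    case (add g w \<beta>)
    have "Yq Y (fls_pure f u) (fls_pure g w) q \<in> W"
      by (rule W_ev_sum[OF Yq_pure]) (rule laurent_tensor_pure)
    with add show ?case by (simp add: Yq_add_right laurent_tensor_pure W_add)
  qed (simp add: laurent_tensor_pure W_zero)
  with add show ?case by (simp add: Yq_add_left laurent_tensor_pure W_add)
qed (simp add: W_zero)

lemma Yq_bound:
  assumes "\<alpha> \<in> W" "\<beta> \<in> W"
  obtains N where "\<And>n. n < N \<Longrightarrow> Yq Y \<alpha> \<beta> n = 0"
proof -
  obtain N where N: "\<And>m k n. n < N \<Longrightarrow> Y (\<alpha> $$ m) (\<beta> $$ k) $$ n = 0"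
    using Y_bound[OF assms] by blast
  have "Yq Y \<alpha> \<beta> n = 0" if "n < N" for n
  proof (rule fls_eqI)
    fix p
    show "Yq Y \<alpha> \<beta> n $$ p = 0 $$ p"
      unfolding Yq_nth[OF assms]
      by (subst Y_shifted_series_finite[OF N, where a = "fls_subdegree \<alpha>" and b = "fls_subdegree \<beta>"
            and J = 0]) (use that N in \<open>auto simp: Y_shift_summand_def\<close>)
  qed
  then show thesis using that by blast
qed

text \<open>Scalars are pulled out as $h(x_1 - x_2)$ from the first argument and as $k(x_1)$ from the
  second one.\<close>

lemma Yq_module:
  assumes "\<alpha> \<in> W" "\<beta> \<in> W"
  shows "ev_sum (Yq Y (fls_module h \<alpha>) (fls_module k \<beta>) q)
     (\<lambda>j. fls_module (shift_coeff j h * k) (Yq Y \<alpha> \<beta> (q - int j)))"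
  using assms(1)
proof (induct rule: laurent_tensor_induct)
  case zero
  then show ?case by (simp add: ev_sum_zero assms laurent_tensor_module)
next
  case (add f u \<alpha>)
  have "ev_sum (Yq Y (fls_module h (fls_pure f u)) (fls_module k \<beta>) q)
     (\<lambda>j. fls_module (shift_coeff j h * k) (Yq Y (fls_pure f u) \<beta> (q - int j)))"
    using assms(2)
  proof (induct rule: laurent_tensor_induct)
    case zero
    then show ?case by (simp add: ev_sum_zero laurent_tensor_module laurent_tensor_pure)
  next
    case (add g w \<beta>)
    define M where "M = nat (q - fls_subdegree (Y u w))"
    have M: "Y u w $$ (q - int i) = 0" if "i > M" for i
      using that by (auto simp: M_def)
    \<comment> \<open>The index i comes from expanding \<open>h\<close> and j from expanding
      \<open>f\<close>. Antidiagonals of \<open>z\<close> recombine to the expansion of h f, while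
      rows give the scalar action on \<open>Yq\<close> with \<open>f\<close> alone.\<close>
    define z where "z i j = fls_pure (shift_coeff i h * shift_coeff j f * (k * g)) (Y u w $$ (q - int (i + j)))" for i j
    have z0: "z i j = 0" if "i > M \<or> j > M" for i j
      using M[of "i + j"] that by (auto simp: z_def)
    have "(\<Sum>i\<le>n. z i (n - i)) = fls_pure (shift_coeff n (h * f) * (k * g)) (Y u w $$ (q - int n))" for n
      unfolding shift_coeff_mult sum_distrib_right fls_pure_sum_left
      by (rule sum.cong) (simp_all add: z_def flip: of_nat_add)
    then have "ev_sum (Yq Y (fls_pure (h * f) u) (fls_pure (k * g) w) q) (\<lambda>n. \<Sum>i\<le>n. z i (n - i))"
      using Yq_pure[of "h * f" u "k * g" w q]
      by simp
    then have 1: "Yq Y (fls_pure (h * f) u) (fls_pure (k * g) w) q = (\<Sum>i\<le>M. \<Sum>j\<le>M. z i j)"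
      using ev_sum_triangle[of M z] z0 by (blast intro: ev_sum_unique)
    have 2: "fls_module (shift_coeff i h * k) (Yq Y (fls_pure f u) (fls_pure g w) (q - int i))
        = (\<Sum>j\<le>M. z i j)" for i
    proof -
      have "Yq Y (fls_pure f u) (fls_pure g w) (q - int i)
        = (\<Sum>j\<le>M. fls_pure (shift_coeff j f * g) (Y u w $$ (q - int i - int j)))"
      proof (rule ev_sum_unique[OF Yq_pure], rule ev_sumI)
        fix j assume "j > M"
        then show "fls_pure (shift_coeff j f * g) (Y u w $$ (q - int i - int j)) = 0"
          using M[of "i + j"] by (simp add: diff_diff_eq)
      qed simp
      then show ?thesis
        by (simp add: fls_module_sum fls_module_pure z_def mult_ac diff_diff_eq)
    qed
    have "ev_sum (Yq Y (fls_module h (fls_pure f u)) (fls_module k (fls_pure g w)) q)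
     (\<lambda>j. fls_module (shift_coeff j h * k) (Yq Y (fls_pure f u) (fls_pure g w) (q - int j)))"
      by (rule ev_sumI[of M]) (use z0 in \<open>auto simp: fls_module_pure 1 2 intro!: sum.neutral\<close>)
    from ev_sum_add[OF this add(2)] show ?case
      using add(1) by (simp add: fls_module_add Yq_add_right laurent_tensor_pure laurent_tensor_module)
  qed
  from ev_sum_add[OF this add(2)] show ?case
    using add(1) assms(2) by (simp add: fls_module_add Yq_add_left laurent_tensor_pure laurent_tensor_module)
qed

text \<open>Only h(x_1 - x_2) produces powers of x_2. For h = 1 a single term is left, so
  \<open>Yq\<close> is C((x_1))-linear in its second argument.\<close>

lemma Yq_module_right:
  assumes "\<alpha> \<in> W" "\<beta> \<in> W"
  shows "Yq Y \<alpha> (fls_module k \<beta>) q = fls_module k (Yq Y \<alpha> \<beta> q)"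
proof (rule ev_sum_unique)
  show "ev_sum (Yq Y \<alpha> (fls_module k \<beta>) q) (\<lambda>j. fls_module (shift_coeff j 1 * k) (Yq Y \<alpha> \<beta> (q - int j)))"
    using Yq_module[OF assms, of 1 k q] by (simp add: fls_module_1 assms)
  show "ev_sum (fls_module k (Yq Y \<alpha> \<beta> q)) (\<lambda>j. fls_module (shift_coeff j 1 * k) (Yq Y \<alpha> \<beta> (q - int j)))"
    by (rule ev_sumI[of 0]) (auto simp: shift_coeff_one)
qed

lemma Yq_module_left:
  assumes "\<alpha> \<in> W" "\<beta> \<in> W"
  shows "ev_sum (Yq Y (fls_module h \<alpha>) \<beta> q) (\<lambda>j. fls_module (shift_coeff j h) (Yq Y \<alpha> \<beta> (q - int j)))"
  using Yq_module[OF assms, of h 1 q] by (simp add: fls_module_1 assms)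

lemma Yq_const: "Yq Y (fls_const u) (fls_const w) q = fls_const (Y u w $$ q)"
proof (rule ev_sum_unique)
  show "ev_sum (Yq Y (fls_const u) (fls_const w) q)
      (\<lambda>j. fls_pure (shift_coeff j 1 * 1) (Y u w $$ (q - int j)))"
    using Yq_pure[of 1 u 1 w q] by (simp add: fls_pure_1)
  show "ev_sum (fls_const (Y u w $$ q)) (\<lambda>j. fls_pure (shift_coeff j 1 * 1) (Y u w $$ (q - int j)))"
    by (rule ev_sumI[of 0]) (auto simp: shift_coeff_one fls_pure_1)
qed

lemma Yq_const_left:
  assumes "\<beta> \<in> W"
  shows "Yq Y (fls_const u) \<beta> q $$ p = Y u (\<beta> $$ p) $$ q"
  using assms
proof (induct rule: laurent_tensor_induct)
  case (add g w \<beta>)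
  have "Yq Y (fls_const u) (fls_pure g w) q = fls_pure g (Y u w $$ q)"
    by (simp add: fls_pure_eq_module Yq_module_right Yq_const laurent_tensor_const)
  with add show ?case by (simp add: Yq_add_right laurent_tensor_const laurent_tensor_pure)
qed (simp add: laurent_tensor_const)

text \<open>With \<open>Yq_const_left\<close> this expresses the terms in the definition of
  \<open>PDer\<close> through \<open>Yq\<close>.\<close>

lemma Yq_const_right:
  assumes "\<alpha> \<in> W"
  shows "Yq Y \<alpha> (fls_const w) q $$ p = Y_shifted Y \<alpha> w p q"
proof -
  have "Y_shifted Y \<alpha> (fls_const w $$ k) (p - k) q = (if k = 0 then Y_shifted Y \<alpha> w p q else 0)" for k
    by (simp add: Y_shifted_def subst_shift_def)
  then show ?thesis
    by (simp add: Yq_nth assms laurent_tensor_const Y_shifted_series_def)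
qed

end

section \<open>Coproduct identities\<close>

abbreviation lext :: "'v::complex_vector laurent_hom \<Rightarrow> 'v fls \<Rightarrow> 'v fls" where
  "lext a \<equiv> laurent_extend (laurent_apply a)"

lemma laurent_apply_clinear: "clinear (laurent_apply a)"
  and laurent_apply_range: "range (laurent_apply a) \<subseteq> W"
  and laurent_apply_in [simp]: "laurent_apply a v \<in> W"
  using laurent_apply[of a] by auto

declare laurent_tensor_const [simp] laurent_tensor_pure [simp]

lemma lext_in [simp]: "\<alpha> \<in> W \<Longrightarrow> lext a \<alpha> \<in> W"
  by (rule laurent_extend_in[OF laurent_apply_clinear laurent_apply_range])

lemma lext_linear_on: "clinear_on W (lext a)"
  unfolding clinear_on_def
  by (simp add: laurent_extend_add[OF laurent_apply_clinear] laurent_extend_scale[OF laurent_apply_clinear])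

lemma lext_add: "\<alpha> \<in> W \<Longrightarrow> \<beta> \<in> W \<Longrightarrow> lext a (\<alpha> + \<beta>) = lext a \<alpha> + lext a \<beta>"
  by (rule laurent_extend_add[OF laurent_apply_clinear])

lemma sum_list_swap:
  "(\<Sum>i\<leftarrow>xs. \<Sum>j\<leftarrow>ys. f i j) = (\<Sum>j\<leftarrow>ys. \<Sum>i\<leftarrow>xs. f i j :: 'a::comm_monoid_add)"
  by (induct xs) (auto simp: sum_list_addf)

lemma lext_0 [simp]: "lext a 0 = 0"
  by (rule clinear_on_0[OF subspace_laurent_tensor lext_linear_on])

lemma lext_module: "\<alpha> \<in> W \<Longrightarrow> lext a (fls_module f \<alpha>) = fls_module f (lext a \<alpha>)"
  by (rule laurent_extend_module[OF laurent_apply_clinear laurent_apply_range])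

lemma lext_const [simp]: "lext a (fls_const v) = laurent_apply a v"
  using laurent_extend_pure[OF laurent_apply_clinear, of a 1 v] by (simp add: fls_pure_1 fls_module_1)

lemma laurent_apply_mult: "laurent_apply (a * b) v = lext a (laurent_apply b v)"
  by (simp add: times_laurent_hom.rep_eq)

lemma laurent_apply_simps [simp]:
  "laurent_apply (a + b) v = laurent_apply a v + laurent_apply b v"
  "laurent_apply (a - b) v = laurent_apply a v - laurent_apply b v"
  "laurent_apply (c *\<^sub>C a) v = c *\<^sub>C laurent_apply a v"
  "laurent_apply 0 v = 0" "laurent_apply 1 v = fls_const v"
  by (simp_all add: plus_laurent_hom.rep_eq minus_laurent_hom.rep_eq scaleC_laurent_hom.rep_eq
      zero_laurent_hom.rep_eq one_laurent_hom.rep_eq)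

lemma laurent_apply_linear [simp]:
  "laurent_apply a (u + v) = laurent_apply a u + laurent_apply a v"
  "laurent_apply a (c *\<^sub>C v) = c *\<^sub>C laurent_apply a v"
  "laurent_apply a 0 = 0"
  using laurent_apply_clinear[of a] by (auto simp: clinear_iff) (metis cvec.scale_zero_left)

lemma laurent_apply_sum_list:
  "laurent_apply (\<Sum>i\<leftarrow>A. f i) v = (\<Sum>i\<leftarrow>A. laurent_apply (f i) v)"
  by (induct A) auto

lemma laurent_hom_eqI: "(\<And>v. laurent_apply a v = laurent_apply b v) \<Longrightarrow> a = b"
  by (metis ext laurent_apply_inject)

lemma laurent_apply_ddx: "laurent_apply (laurent_ddx a) v = fls_ddx (laurent_apply a v)"
  by (simp add: laurent_ddx.rep_eq)

lemma fls_ddx_add: "fls_ddx (f + g) = fls_ddx f + fls_ddx g"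
  by (simp add: fls_eq_iff cvec.scale_right_distrib)

lemma fls_ddx_scale: "fls_ddx (c *\<^sub>C f) = c *\<^sub>C fls_ddx f"
  by (simp add: fls_eq_iff mult.commute)

lemma fls_ddx_linear_on: "clinear_on S fls_ddx"
  by (simp add: clinear_on_def fls_ddx_add fls_ddx_scale)

lemma fls_ddx_0 [simp]: "fls_ddx 0 = 0"
  by (simp add: fls_eq_iff)

lemma fls_ddx_pure: "fls_ddx (fls_pure f v) = fls_pure (fls_deriv f) v"
  by (simp add: fls_eq_iff)

lemma fls_ddx_const: "fls_ddx (fls_const v) = 0"
  using fls_ddx_pure[of 1 v] by (simp add: fls_pure_1)

lemma fls_ddx_module:
  "\<alpha> \<in> W \<Longrightarrow> fls_ddx (fls_module f \<alpha>) = fls_module (fls_deriv f) \<alpha> + fls_module f (fls_ddx \<alpha>)"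
  by (induct rule: laurent_tensor_induct)
     (simp_all add: fls_module_add fls_module_pure fls_ddx_add fls_ddx_pure fls_pure_add_left)

text \<open>Substituting x - y commutes with d/dx. On coefficients this is the absorption identity
  for binomials.\<close>

lemma fls_deriv_shift_coeff: "fls_deriv (shift_coeff j f) = shift_coeff j (fls_deriv f)"
proof (rule fls_eqI)
  fix n
  define x :: complex where "x = of_int (n + 1 + int j)"
  have "(x - of_nat j) * (x gchoose j) = x * ((x - 1) gchoose j)"
    by (rule gbinomial_absorb_comp)
  moreover have "a * (s * b * t) = s * d * (c * t)" if "a * b = c * d" for a b c d s t :: complex
    using that by algebra
  ultimately have "(x - of_nat j) * ((- 1) ^ j * (x gchoose j) * t) = (- 1) ^ j * ((x - 1) gchoose j) * (x * t)" for t
    by blast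
  moreover have "of_int (n + 1) = x - of_nat j" "of_int (n + int j) = x - 1" "of_int (n + int j + 1) = x"
    "n + 1 + int j = n + int j + 1"
    by (simp_all add: x_def)
  ultimately show "fls_deriv (shift_coeff j f) $$ n = shift_coeff j (fls_deriv f) $$ n"
    unfolding fls_deriv_nth shift_coeff_nth by (metis x_def)
qed

section \<open>The calculus of coproduct identities\<close>

context nonlocal_vertex_algebra
begin

text \<open>Grouping by powers of x_2 makes each side an element of \<open>W\<close>, so that
  further operators can be applied to it.\<close>

lemma coproduct_identity_iff:
  "coproduct_identity Y a ps \<longleftrightarrow> (\<forall>v w q. lext a (Yq Y (fls_const v) (fls_const w) q)
     = (\<Sum>(b, c)\<leftarrow>ps. Yq Y (laurent_apply b v) (laurent_apply c w) q))"
proof -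
  have "(\<Sum>(b, c)\<leftarrow>ps. Yq Y (laurent_apply b v) (laurent_apply c w) q) $$ p
      = (\<Sum>(b, c)\<leftarrow>ps. Y_shifted_series Y (laurent_apply b v) (laurent_apply c w) p q)" for v w p q
    by (induct ps) (auto simp: Yq_nth)
  then show ?thesis
    unfolding coproduct_identity_def apply_Y_def fls_eq_iff
    by (simp add: Yq_const) blast
qed

text \<open>The operators \<open>a\<close>, \<open>b\<close>, \<open>c\<close> commute with scalars,
  and on both sides scalars f and g in the arguments become the same factor f(x_1 - x_2) g(x_1). So
  the identity passes from constants to \<open>W\<close>, where it can be applied to the results of
  another one.\<close>

lemma coproduct_identity_lext:
  assumes "coproduct_identity Y a ps" "\<alpha> \<in> W" "\<beta> \<in> W"
  shows "lext a (Yq Y \<alpha> \<beta> q) = (\<Sum>(b, c)\<leftarrow>ps. Yq Y (lext b \<alpha>) (lext c \<beta>) q)"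
  using assms(2)
proof (induct rule: laurent_tensor_induct)
  case zero
  then show ?case
    by (simp add: assms(3) case_prod_unfold)
next
  case (add f u \<alpha>)
  have "lext a (Yq Y (fls_pure f u) \<beta> q) = (\<Sum>(b, c)\<leftarrow>ps. Yq Y (lext b (fls_pure f u)) (lext c \<beta>) q)"
    using assms(3)
  proof (induct rule: laurent_tensor_induct)
    case zero
    then show ?case
      by (simp add: case_prod_unfold)
  next
    case (add g w \<beta>)
    have "ev_sum (Yq Y (fls_module f (fls_const u)) (fls_module g (fls_const w)) q)
     (\<lambda>j. fls_module (shift_coeff j f * g) (fls_const (Y u w $$ (q - int j))))"
      using Yq_module[of "fls_const u" "fls_const w" f g q] by (simp add: Yq_const)
    then have "ev_sum (lext a (Yq Y (fls_module f (fls_const u)) (fls_module g (fls_const w)) q))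
     (\<lambda>j. lext a (fls_module (shift_coeff j f * g) (fls_const (Y u w $$ (q - int j)))))"
      by (rule ev_sum_linear[OF _ subspace_laurent_tensor lext_linear_on]) (simp add: laurent_tensor_module)
    moreover have "lext a (fls_module (shift_coeff j f * g) (fls_const (Y u w $$ (q - int j))))
       = (\<Sum>i\<leftarrow>ps. fls_module (shift_coeff j f * g) (Yq Y (laurent_apply (fst i) u) (laurent_apply (snd i) w) (q - int j)))" for j
      using assms(1) unfolding coproduct_identity_iff
      by (simp add: lext_module Yq_const case_prod_unfold fls_module_sum_list)
    moreover have "ev_sum (\<Sum>i\<leftarrow>ps. Yq Y (fls_module f (laurent_apply (fst i) u)) (fls_module g (laurent_apply (snd i) w)) q)
      (\<lambda>j. \<Sum>i\<leftarrow>ps. fls_module (shift_coeff j f * g) (Yq Y (laurent_apply (fst i) u) (laurent_apply (snd i) w) (q - int j)))"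
      by (rule ev_sum_sum_list) (simp add: Yq_module)
    ultimately have "lext a (Yq Y (fls_pure f u) (fls_pure g w) q)
       = (\<Sum>(b, c)\<leftarrow>ps. Yq Y (lext b (fls_pure f u)) (lext c (fls_pure g w)) q)"
      by (simp add: fls_pure_eq_module lext_module case_prod_unfold) (rule ev_sum_unique)
    with add show ?case
      by (simp add: Yq_add_right lext_add case_prod_unfold sum_list_addf)
  qed
  with add show ?case
    using assms(3) by (simp add: Yq_add_left lext_add case_prod_unfold sum_list_addf)
qed

lemma coproduct_identity_add:
  "coproduct_identity Y a ps \<Longrightarrow> coproduct_identity Y b qs \<Longrightarrow> coproduct_identity Y (a + b) (ps @ qs)"
  by (simp add: coproduct_identity_def apply_Y_def)

lemma coproduct_identity_zero: "coproduct_identity Y 0 []"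
  by (simp add: coproduct_identity_def apply_Y_def)

lemma coproduct_identity_scale:
  "coproduct_identity Y a ps \<Longrightarrow> coproduct_identity Y (z *\<^sub>C a) (map (\<lambda>(b, c). (z *\<^sub>C b, c)) ps)"
proof -
  have *: "lext (z *\<^sub>C a) (fls_const v) = z *\<^sub>C lext a (fls_const v)" for v
    by simp
  have "z *\<^sub>C (\<Sum>(b, c)\<leftarrow>ps. Yq Y (laurent_apply b v) (laurent_apply c w) q)
     = (\<Sum>(b, c)\<leftarrow>ps. Yq Y (z *\<^sub>C laurent_apply b v) (laurent_apply c w) q)" for v w q
    by (induct ps) (auto simp: cvec.scale_right_distrib Yq_scale)
  then show "coproduct_identity Y a ps \<Longrightarrow> ?thesis"
    by (simp add: coproduct_identity_iff Yq_const o_def case_prod_unfold)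
qed

lemma coproduct_identity_one: "coproduct_identity Y 1 [(1, 1)]"
  by (simp add: coproduct_identity_iff Yq_const)

text \<open>After \<open>b\<close> has acted, the arguments are no longer constants. This is where
  the identity for \<open>a\<close> is needed on all of \<open>W\<close>.\<close>

lemma coproduct_identity_mult:
  assumes "coproduct_identity Y a ps" "coproduct_identity Y b qs"
  shows "coproduct_identity Y (a * b) [(b1 * c1, b2 * c2). (b1, b2) \<leftarrow> ps, (c1, c2) \<leftarrow> qs]"
  unfolding coproduct_identity_iff
proof (intro allI)
  fix v w q
  have "lext (a * b) (Yq Y (fls_const v) (fls_const w) q)
      = lext a (lext b (Yq Y (fls_const v) (fls_const w) q))"
    by (simp add: Yq_const laurent_apply_mult)
  also have "\<dots> = lext a (\<Sum>i\<leftarrow>qs. Yq Y (laurent_apply (fst i) v) (laurent_apply (snd i) w) q)"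
    using assms(2) by (simp add: coproduct_identity_iff case_prod_unfold)
  also have "\<dots> = (\<Sum>i\<leftarrow>qs. lext a (Yq Y (laurent_apply (fst i) v) (laurent_apply (snd i) w) q))"
    by (rule clinear_on_sum_list[OF subspace_laurent_tensor lext_linear_on]) simp
  also have "\<dots> = (\<Sum>i\<leftarrow>qs. \<Sum>k\<leftarrow>ps. Yq Y (laurent_apply (fst k * fst i) v) (laurent_apply (snd k * snd i) w) q)"
    by (simp add: coproduct_identity_lext[OF assms(1)] laurent_apply_mult case_prod_unfold)
  also have "\<dots> = (\<Sum>k\<leftarrow>ps. \<Sum>i\<leftarrow>qs. Yq Y (laurent_apply (fst k * fst i) v) (laurent_apply (snd k * snd i) w) q)"
    by (rule sum_list_swap)
  also have "\<dots> = (\<Sum>(b, c)\<leftarrow>[(b1 * c1, b2 * c2). (b1, b2) \<leftarrow> ps, (c1, c2) \<leftarrow> qs].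
      Yq Y (laurent_apply b v) (laurent_apply c w) q)"
    by (induct ps) (simp_all add: case_prod_unfold o_def)
  finally show "lext (a * b) (Yq Y (fls_const v) (fls_const w) q) = \<dots>" .
qed

text \<open>The derivative is taken in x_1 with x_2 fixed, so it hits f(x_1 - x_2) and g(x_1) by the
  product rule.\<close>

lemma Yq_ddx:
  assumes "\<alpha> \<in> W" "\<beta> \<in> W"
  shows "fls_ddx (Yq Y \<alpha> \<beta> q) = Yq Y (fls_ddx \<alpha>) \<beta> q + Yq Y \<alpha> (fls_ddx \<beta>) q"
  using assms(1)
proof (induct rule: laurent_tensor_induct)
  case (add f u \<alpha>)
  have "fls_ddx (Yq Y (fls_pure f u) \<beta> q) = Yq Y (fls_ddx (fls_pure f u)) \<beta> q + Yq Y (fls_pure f u) (fls_ddx \<beta>) q"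
    using assms(2)
  proof (induct rule: laurent_tensor_induct)
    case (add g w \<beta>)
    have "ev_sum (fls_ddx (Yq Y (fls_pure f u) (fls_pure g w) q))
       (\<lambda>j. fls_ddx (fls_pure (shift_coeff j f * g) (Y u w $$ (q - int j))))"
      by (rule ev_sum_linear[OF Yq_pure subspace_laurent_tensor fls_ddx_linear_on]) simp
    moreover have "ev_sum (Yq Y (fls_pure (fls_deriv f) u) (fls_pure g w) q + Yq Y (fls_pure f u) (fls_pure (fls_deriv g) w) q)
        (\<lambda>j. fls_pure (shift_coeff j (fls_deriv f) * g) (Y u w $$ (q - int j))
           + fls_pure (shift_coeff j f * fls_deriv g) (Y u w $$ (q - int j)))"
      by (rule ev_sum_add[OF Yq_pure Yq_pure])
    ultimately have "fls_ddx (Yq Y (fls_pure f u) (fls_pure g w) q)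
        = Yq Y (fls_pure (fls_deriv f) u) (fls_pure g w) q + Yq Y (fls_pure f u) (fls_pure (fls_deriv g) w) q"
      by (simp add: fls_ddx_pure fls_deriv_mult fls_pure_add_left fls_deriv_shift_coeff add.commute)
         (rule ev_sum_unique)
    with add show ?case
      by (simp add: Yq_add_right fls_ddx_add fls_ddx_pure laurent_tensor_ddx algebra_simps)
  qed (simp add: fls_ddx_pure)
  with add assms(2) show ?case
    by (simp add: Yq_add_left fls_ddx_add fls_ddx_pure laurent_tensor_ddx algebra_simps)
qed (simp add: assms laurent_tensor_ddx)

lemma coproduct_identity_ddx:
  assumes "coproduct_identity Y a ps"
  shows "coproduct_identity Y (laurent_ddx a)
    (map (\<lambda>(b, c). (laurent_ddx b, c)) ps @ map (\<lambda>(b, c). (b, laurent_ddx c)) ps)"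
  unfolding coproduct_identity_iff
proof (intro allI)
  fix v w q
  have "lext (laurent_ddx a) (Yq Y (fls_const v) (fls_const w) q)
      = fls_ddx (lext a (Yq Y (fls_const v) (fls_const w) q))"
    by (simp add: Yq_const laurent_apply_ddx)
  also have "\<dots> = fls_ddx (\<Sum>i\<leftarrow>ps. Yq Y (laurent_apply (fst i) v) (laurent_apply (snd i) w) q)"
    using assms by (simp add: coproduct_identity_iff case_prod_unfold)
  also have "\<dots> = (\<Sum>i\<leftarrow>ps. fls_ddx (Yq Y (laurent_apply (fst i) v) (laurent_apply (snd i) w) q))"
    by (rule clinear_on_sum_list[OF subspace_laurent_tensor fls_ddx_linear_on]) simp
  also have "\<dots> = (\<Sum>(b, c)\<leftarrow>map (\<lambda>(b, c). (laurent_ddx b, c)) ps @ map (\<lambda>(b, c). (b, laurent_ddx c)) ps.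
      Yq Y (laurent_apply b v) (laurent_apply c w) q)"
    by (simp add: Yq_ddx laurent_apply_ddx case_prod_unfold o_def sum_list_addf)
  finally show "lext (laurent_ddx a) (Yq Y (fls_const v) (fls_const w) q) = \<dots>" .
qed

text \<open>Y(u,x)1 has no negative powers, so only the term j = 0 in the expansion of f(x_1 - x_2)
  contributes at x_2^0.\<close>

lemma Yq_vac_right:
  assumes "\<alpha> \<in> W"
  shows "Yq Y \<alpha> (fls_const vac) 0 = \<alpha>"
  using assms
proof (induct rule: laurent_tensor_induct)
  case (add f u \<alpha>)
  have "ev_sum (Yq Y (fls_module f (fls_const u)) (fls_const vac) 0)
      (\<lambda>j. fls_module (shift_coeff j f) (fls_const (Y u vac $$ (0 - int j))))"
    using Yq_module_left[of "fls_const u" "fls_const vac" f 0] by (simp add: Yq_const)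
  moreover have "ev_sum (fls_module f (fls_const u))
      (\<lambda>j. fls_module (shift_coeff j f) (fls_const (Y u vac $$ (0 - int j))))"
    by (rule ev_sumI[of 0]) (auto simp: creation)
  ultimately have "Yq Y (fls_pure f u) (fls_const vac) 0 = fls_pure f u"
    unfolding fls_pure_eq_module by (rule ev_sum_unique)
  with add show ?case by (simp add: Yq_add_left)
qed simp

lemma Yq_vac_left:
  assumes "\<beta> \<in> W"
  shows "Yq Y (fls_const vac) \<beta> q = (if q = 0 then \<beta> else 0)"
  by (auto simp: fls_eq_iff Yq_const_left[OF assms] vacuum)

text \<open>The identity is evaluated at w = 1 and x_2^0, where the creation property returns the
  first argument.\<close>

lemma counit_law_right:
  assumes "coproduct_identity Y a ps"
    and "\<And>b c. (b, c) \<in> set ps \<Longrightarrow> laurent_apply c vac = fls_const (e c *\<^sub>C vac)"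
  shows "(\<Sum>(b, c)\<leftarrow>ps. e c *\<^sub>C b) = a"
proof (rule laurent_hom_eqI)
  fix v
  have "laurent_apply a v = lext a (Yq Y (fls_const v) (fls_const vac) 0)"
    by (simp add: Yq_const creation)
  also have "\<dots> = (\<Sum>(b, c)\<leftarrow>ps. Yq Y (laurent_apply b v) (laurent_apply c vac) 0)"
    using assms(1) by (simp add: coproduct_identity_iff)
  also have "\<dots> = (\<Sum>(b, c)\<leftarrow>ps. e c *\<^sub>C laurent_apply b v)"
  proof (rule arg_cong[where f = sum_list], rule map_cong)
    fix i assume "i \<in> set ps"
    moreover have "fls_const (z *\<^sub>C vac) = z *\<^sub>C fls_const vac" for z by (auto simp: fls_eq_iff)
    ultimately show "(case i of (b, c) \<Rightarrow> Yq Y (laurent_apply b v) (laurent_apply c vac) 0)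
       = (case i of (b, c) \<Rightarrow> e c *\<^sub>C laurent_apply b v)"
      using assms(2)[of "fst i" "snd i"] by (simp add: case_prod_unfold Yq_scale Yq_vac_right)
  qed simp
  finally show "laurent_apply (\<Sum>(b, c)\<leftarrow>ps. e c *\<^sub>C b) v = laurent_apply a v"
    by (simp add: laurent_apply_sum_list case_prod_unfold)
qed

text \<open>Here v = 1, and the vacuum axiom returns the second argument.\<close>

lemma counit_law_left:
  assumes "coproduct_identity Y a ps"
    and "\<And>b c. (b, c) \<in> set ps \<Longrightarrow> laurent_apply b vac = fls_const (e b *\<^sub>C vac)"
  shows "(\<Sum>(b, c)\<leftarrow>ps. e b *\<^sub>C c) = a"
proof (rule laurent_hom_eqI)
  fix v
  have "laurent_apply a v = lext a (Yq Y (fls_const vac) (fls_const v) 0)"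
    by (simp add: Yq_const vacuum)
  also have "\<dots> = (\<Sum>(b, c)\<leftarrow>ps. Yq Y (laurent_apply b vac) (laurent_apply c v) 0)"
    using assms(1) by (simp add: coproduct_identity_iff)
  also have "\<dots> = (\<Sum>(b, c)\<leftarrow>ps. e b *\<^sub>C laurent_apply c v)"
  proof (rule arg_cong[where f = sum_list], rule map_cong)
    fix i assume "i \<in> set ps"
    moreover have "fls_const (z *\<^sub>C vac) = z *\<^sub>C fls_const vac" for z by (auto simp: fls_eq_iff)
    ultimately show "(case i of (b, c) \<Rightarrow> Yq Y (laurent_apply b vac) (laurent_apply c v) 0)
       = (case i of (b, c) \<Rightarrow> e b *\<^sub>C laurent_apply c v)"
      using assms(2)[of "fst i" "snd i"] by (simp add: case_prod_unfold Yq_scale Yq_vac_left)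
  qed simp
  finally show "laurent_apply (\<Sum>(b, c)\<leftarrow>ps. e b *\<^sub>C c) v = laurent_apply a v"
    by (simp add: laurent_apply_sum_list case_prod_unfold)
qed

end

section \<open>Weak associativity and coassociativity\<close>

text \<open>Shifting the index by one aligns two expansions before Pascal's rule is applied to their
  terms.\<close>

lemma ev_sum_Suc:
  assumes "ev_sum x g"
  shows "ev_sum x (\<lambda>j. case j of 0 \<Rightarrow> 0 | Suc i \<Rightarrow> g i)"
proof -
  obtain M where M: "\<And>N. N \<ge> M \<Longrightarrow> x = (\<Sum>j\<le>N. g j)"
    using assms unfolding ev_sum_def eventually_sequentially by blast
  have "x = (\<Sum>j\<le>N. case j of 0 \<Rightarrow> 0 | Suc i \<Rightarrow> g i)" if N: "N \<ge> Suc M" for N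
  proof -
    obtain K where "N = Suc K" "K \<ge> M" using N by (cases N) auto
    then show ?thesis using M[of K] by (simp add: sum.atMost_Suc_shift del: sum.atMost_Suc)
  qed
  then show ?thesis unfolding ev_sum_def eventually_sequentially by blast
qed

section \<open>Multiplication by powers of x + y and substitution of x + y\<close>

lemma mult_add_power_0 [simp]: "mult_add_power 0 F = F"
  by (simp add: mult_add_power_def fun_eq_iff)

lemma mult_add_power_Suc:
  "mult_add_power (Suc l) F p q = mult_add_power l F (p - 1) q + mult_add_power l F p (q - 1)"
proof -
  define G where "G j = F (p - int (Suc l - j)) (q - int j)" for j
  have "mult_add_power (Suc l) F p q = (\<Sum>j\<le>Suc l. of_nat (Suc l choose j) *\<^sub>C G j)"
    by (simp only: mult_add_power_def G_def)
  also have "\<dots> = G 0 + (\<Sum>j\<le>l. of_nat (Suc l choose Suc j) *\<^sub>C G (Suc j))"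
    by (subst sum.atMost_Suc_shift) simp
  also have "\<dots> = (G 0 + (\<Sum>j\<le>l. of_nat (l choose Suc j) *\<^sub>C G (Suc j))) + (\<Sum>j\<le>l. of_nat (l choose j) *\<^sub>C G (Suc j))"
    by (simp add: cvec.scale_left_distrib sum.distrib algebra_simps)
  also have "G 0 + (\<Sum>j\<le>l. of_nat (l choose Suc j) *\<^sub>C G (Suc j)) = (\<Sum>j\<le>Suc l. of_nat (l choose j) *\<^sub>C G j)"
    by (subst sum.atMost_Suc_shift) simp
  also have "\<dots> = (\<Sum>j\<le>l. of_nat (l choose j) *\<^sub>C G j)" by simp
  also have "\<dots> = mult_add_power l F (p - 1) q"
    unfolding mult_add_power_def
  proof (rule sum.cong)
    fix j assume "j \<in> {..l}"
    then have "p - int (Suc l - j) = p - 1 - int (l - j)" by (simp add: of_nat_diff)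
    then show "of_nat (l choose j) *\<^sub>C G j = of_nat (l choose j) *\<^sub>C F (p - 1 - int (l - j)) (q - int j)"
      by (simp only: G_def)
  qed simp
  also have "(\<Sum>j\<le>l. of_nat (l choose j) *\<^sub>C G (Suc j)) = mult_add_power l F p (q - 1)"
    unfolding mult_add_power_def G_def by (rule sum.cong) (simp_all add: diff_diff_eq)
  finally show ?thesis .
qed

lemma mult_add_power_add: "mult_add_power (k + l) F = mult_add_power k (mult_add_power l F)"
  by (induct k) (auto simp: fun_eq_iff mult_add_power_Suc)

lemma mult_add_power_commute:
  "mult_add_power k (mult_add_power l F) = mult_add_power l (mult_add_power k F)"
  by (simp flip: mult_add_power_add add: add.commute)

lemma mult_add_power_sum:
  "mult_add_power l (\<lambda>p q. F p q + G p q) p q = mult_add_power l F p q + mult_add_power l G p q"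
  by (simp add: mult_add_power_def cvec.scale_right_distrib sum.distrib)

lemma mult_add_power_diff:
  "mult_add_power l (\<lambda>p q. F p q - G p q) p q = mult_add_power l F p q - mult_add_power l G p q"
  by (simp add: mult_add_power_def cvec.scale_right_diff_distrib sum_subtractf)

lemma mult_add_power_linear:
  assumes "cvec.subspace S" "clinear_on S T" "\<And>p q. F p q \<in> S"
  shows "mult_add_power l (\<lambda>p q. T (F p q)) p q = T (mult_add_power l F p q)"
proof -
  have "T (mult_add_power l F p q) = (\<Sum>j\<le>l. T (of_nat (l choose j) *\<^sub>C F (p - int (l - j)) (q - int j)))"
    unfolding mult_add_power_def
    by (rule clinear_on_sum[OF assms(1,2)]) (simp add: cvec.subspace_scale[OF assms(1)] assms(3))
  then show ?thesis using assms(2,3) by (simp add: mult_add_power_def clinear_on_def)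
qed

lemma mult_add_power_ev_sum:
  assumes "\<And>p q. ev_sum (X p q) (\<lambda>j. F j p q)"
  shows "ev_sum (mult_add_power l X p q) (\<lambda>j. mult_add_power l (F j) p q)"
  unfolding mult_add_power_def
  by (intro ev_sum_sum ev_sum_clinear[OF assms]) (simp_all add: clinear_iff cvec.scale_right_distrib mult.commute)

text \<open>On series whose exponents in the second variable are bounded below, multiplication by
  $(x + y)^l$ and the substitution of $x + y$ for $x$ are injective.\<close>

definition bounded_snd :: "int \<Rightarrow> (int \<Rightarrow> int \<Rightarrow> 'a::zero) \<Rightarrow> bool" where
  "bounded_snd T F \<longleftrightarrow> (\<forall>p q. q < T \<longrightarrow> F p q = 0)"

lemma bounded_snd_mult_add_power: "bounded_snd T F \<Longrightarrow> bounded_snd T (mult_add_power l F)"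
  by (auto simp: bounded_snd_def mult_add_power_def intro!: sum.neutral)

lemma subst_shift_finite:
  assumes "bounded_snd T F" "q - int J \<le> T"
  shows "subst_shift 1 F p q = (\<Sum>j\<le>J. (of_int (p + int j) gchoose j) *\<^sub>C F (p + int j) (q - int j))"
proof -
  have "subst_shift 1 F p q = Sum_any (\<lambda>j. (of_int (p + int j) gchoose j) *\<^sub>C F (p + int j) (q - int j))"
    by (simp add: subst_shift_def)
  also have "\<dots> = (\<Sum>j\<le>J. (of_int (p + int j) gchoose j) *\<^sub>C F (p + int j) (q - int j))"
  proof (rule Sum_any.expand_superset)
    have "F (p + int j) (q - int j) = 0" if "j \<notin> {..J}" for j
      using assms that by (auto simp: bounded_snd_def)
    then show "{j. (of_int (p + int j) gchoose j) *\<^sub>C F (p + int j) (q - int j) \<noteq> 0} \<subseteq> {..J}"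
      by fastforce
  qed simp
  finally show ?thesis .
qed

lemma subst_shift_ev_sum:
  assumes "bounded_snd T F"
  shows "ev_sum (subst_shift 1 F p q) (\<lambda>j. (of_int (p + int j) gchoose j) *\<^sub>C F (p + int j) (q - int j))"
  unfolding ev_sum_def
  by (rule eventually_sequentiallyI[of "nat (q - T)"]) (rule subst_shift_finite[OF assms], simp)

lemma bounded_snd_subst_shift:
  assumes "bounded_snd T F" shows "bounded_snd T (subst_shift 1 F)"
  unfolding bounded_snd_def
proof (intro allI impI)
  fix p q assume "q < T"
  then show "subst_shift 1 F p q = 0"
    using assms by (subst subst_shift_finite[OF assms, of _ 0]) (auto simp: bounded_snd_def)
qed

lemma subst_shift_linear:
  assumes "bounded_snd T0 F" "cvec.subspace S" "clinear_on S T" "\<And>p q. F p q \<in> S"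
  shows "subst_shift 1 (\<lambda>p q. T (F p q)) p q = T (subst_shift 1 F p q)"
proof (rule ev_sum_unique)
  have "bounded_snd T0 (\<lambda>p q. T (F p q))"
    using assms(1) clinear_on_0[OF assms(2,3)] by (auto simp: bounded_snd_def)
  from subst_shift_ev_sum[OF this]
  show "ev_sum (subst_shift 1 (\<lambda>p q. T (F p q)) p q)
    (\<lambda>j. (of_int (p + int j) gchoose j) *\<^sub>C T (F (p + int j) (q - int j)))" .
  have "ev_sum (T (subst_shift 1 F p q))
      (\<lambda>j. T ((of_int (p + int j) gchoose j) *\<^sub>C F (p + int j) (q - int j)))"
    by (rule ev_sum_linear[OF subst_shift_ev_sum[OF assms(1)] assms(2,3)])
       (simp add: cvec.subspace_scale[OF assms(2)] assms(4))
  then show "ev_sum (T (subst_shift 1 F p q))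
      (\<lambda>j. (of_int (p + int j) gchoose j) *\<^sub>C T (F (p + int j) (q - int j)))"
    using assms(3,4) by (simp add: clinear_on_def)
qed

lemma subst_shift_in:
  assumes "bounded_snd T F" "cvec.subspace S" "\<And>p q. F p q \<in> S"
  shows "subst_shift 1 F p q \<in> S"
  by (subst subst_shift_finite[OF assms(1), where J = "nat (q - T)"])
     (auto intro!: cvec.subspace_sum cvec.subspace_scale assms)

lemma subst_shift_add:
  assumes "bounded_snd T F" "bounded_snd T' G"
  shows "subst_shift 1 (\<lambda>p q. F p q + G p q) p q = subst_shift 1 F p q + subst_shift 1 G p q"
proof (rule ev_sum_unique)
  have "bounded_snd (min T T') (\<lambda>p q. F p q + G p q)"
    using assms by (auto simp: bounded_snd_def)
  from subst_shift_ev_sum[OF this]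
  show "ev_sum (subst_shift 1 (\<lambda>p q. F p q + G p q) p q)
    (\<lambda>j. (of_int (p + int j) gchoose j) *\<^sub>C F (p + int j) (q - int j)
       + (of_int (p + int j) gchoose j) *\<^sub>C G (p + int j) (q - int j))"
    by (simp add: cvec.scale_right_distrib)
  show "ev_sum (subst_shift 1 F p q + subst_shift 1 G p q)
    (\<lambda>j. (of_int (p + int j) gchoose j) *\<^sub>C F (p + int j) (q - int j)
       + (of_int (p + int j) gchoose j) *\<^sub>C G (p + int j) (q - int j))"
    by (rule ev_sum_add[OF assms[THEN subst_shift_ev_sum]])
qed

lemma subst_shift_diff:
  assumes "bounded_snd T F" "bounded_snd T' G"
  shows "subst_shift 1 (\<lambda>p q. F p q - G p q) p q = subst_shift 1 F p q - subst_shift 1 G p q"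
proof -
  have "bounded_snd (min T T') (\<lambda>p q. F p q - G p q)"
    using assms by (auto simp: bounded_snd_def)
  from subst_shift_add[OF this assms(2), of p q] show ?thesis by simp
qed

text \<open>Multiplication by x turns into multiplication by x + y under the substitution. In the
  coefficients this is Pascal's rule.\<close>

lemma subst_shift_mult_fst:
  assumes "bounded_snd T F"
  shows "subst_shift 1 (\<lambda>p q. F (p - 1) q) p q = subst_shift 1 F (p - 1) q + subst_shift 1 F p (q - 1)"
proof (rule ev_sum_unique)
  have "bounded_snd T (\<lambda>p q. F (p - 1) q)" using assms by (auto simp: bounded_snd_def)
  from subst_shift_ev_sum[OF this]
  show "ev_sum (subst_shift 1 (\<lambda>p q. F (p - 1) q) p q)
    (\<lambda>j. (of_int (p + int j) gchoose j) *\<^sub>C F (p + int j - 1) (q - int j))" .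
  have "ev_sum (subst_shift 1 F (p - 1) q + subst_shift 1 F p (q - 1))
     (\<lambda>j. (of_int (p - 1 + int j) gchoose j) *\<^sub>C F (p - 1 + int j) (q - int j)
        + (case j of 0 \<Rightarrow> 0 | Suc i \<Rightarrow> (of_int (p + int i) gchoose i) *\<^sub>C F (p + int i) (q - 1 - int i)))"
    by (rule ev_sum_add[OF subst_shift_ev_sum[OF assms] ev_sum_Suc[OF subst_shift_ev_sum[OF assms]]])
  moreover have "(of_int (p - 1 + int j) gchoose j) *\<^sub>C F (p - 1 + int j) (q - int j)
        + (case j of 0 \<Rightarrow> 0 | Suc i \<Rightarrow> (of_int (p + int i) gchoose i) *\<^sub>C F (p + int i) (q - 1 - int i))
      = (of_int (p + int j) gchoose j) *\<^sub>C F (p + int j - 1) (q - int j)" for j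
  proof (cases j)
    case (Suc i)
    have "(of_int (p + int j) gchoose Suc i :: complex)
        = (of_int (p + int i) gchoose i) + (of_int (p + int i) gchoose Suc i)"
      using gbinomial_Suc_Suc[of "of_int (p + int i) :: complex" i] by (simp add: Suc add_ac)
    moreover have "p - 1 + int j = p + int i" "p + int j - 1 = p + int i" "q - 1 - int i = q - int j"
      by (simp_all add: Suc)
    ultimately show ?thesis by (simp add: Suc cvec.scale_left_distrib add.commute diff_diff_eq)
  qed simp
  ultimately show "ev_sum (subst_shift 1 F (p - 1) q + subst_shift 1 F p (q - 1))
    (\<lambda>j. (of_int (p + int j) gchoose j) *\<^sub>C F (p + int j - 1) (q - int j))"
    by simp
qed

lemma subst_shift_mult_power:
  assumes "bounded_snd T F"
  shows "subst_shift 1 (\<lambda>p q. F (p - int n) q) = mult_add_power n (subst_shift 1 F)"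
proof (induct n)
  case (Suc n)
  have "bounded_snd T (\<lambda>p q. F (p - int n) q)" using assms by (auto simp: bounded_snd_def)
  note subst_shift_mult_fst[OF this]
  moreover have "(\<lambda>p q. F (p - int (Suc n)) q) = (\<lambda>p q. F (p - 1 - int n) q)"
    by (simp add: diff_diff_eq)
  ultimately show ?case by (simp add: fun_eq_iff mult_add_power_Suc Suc del: of_nat_Suc)
qed simp

text \<open>Induction on the exponent of y, upwards from \<open>T\<close>. It serves where the
  lowest power of y in a transformed series controls that of the original.\<close>

lemma bounded_snd_eq_0:
  assumes "bounded_snd T F" "\<And>p q. (\<And>p' q'. q' < q \<Longrightarrow> F p' q' = 0) \<Longrightarrow> F p q = 0"
  shows "F p q = 0"
proof (induct "nat (q - T)" arbitrary: p q rule: less_induct)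
  case less
  show ?case
  proof (cases "q < T")
    case False
    show ?thesis
    proof (rule assms(2))
      fix p' q' assume "q' < q"
      show "F p' q' = 0"
      proof (cases "q' < T")
        case False
        then show ?thesis using \<open>q' < q\<close> by (intro less) simp
      qed (use assms(1) in \<open>auto simp: bounded_snd_def\<close>)
    qed
  qed (use assms(1) in \<open>auto simp: bounded_snd_def\<close>)
qed

text \<open>The lowest power of y in (x + y)F has x times the coefficient it has in F, so
  multiplication by x + y cannot annihilate a nonzero F.\<close>

lemma mult_add_power_eq_0:
  assumes "bounded_snd T F" "\<And>p q. mult_add_power l F p q = 0"
  shows "F p q = 0"
  using assms(2)
proof (induct l arbitrary: p q)
  case (Suc l)
  have "mult_add_power l F p q = 0" for p q
  proof (rule bounded_snd_eq_0[OF bounded_snd_mult_add_power[OF assms(1)]])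
    fix p q assume "\<And>p' q'. q' < q \<Longrightarrow> mult_add_power l F p' q' = 0"
    then have "mult_add_power l F (p + 1) (q - 1) = 0" by simp
    then show "mult_add_power l F p q = 0"
      using Suc.prems[of "p + 1" q] by (simp add: mult_add_power_Suc)
  qed
  then show ?case by (rule Suc.hyps)
qed simp

text \<open>Terms with j > 0 involve smaller powers of y, so the substitution leaves the lowest
  coefficient in y unchanged.\<close>

lemma subst_shift_eq_0:
  assumes "bounded_snd T F" "\<And>p q. subst_shift 1 F p q = 0"
  shows "F p q = 0"
proof (rule bounded_snd_eq_0[OF assms(1)])
  fix p q assume *: "\<And>p' q'. q' < q \<Longrightarrow> F p' q' = 0"
  have "ev_sum (F p q) (\<lambda>j. (of_int (p + int j) gchoose j) *\<^sub>C F (p + int j) (q - int j))"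
    by (rule ev_sumI[of 0]) (auto simp: *)
  from ev_sum_unique[OF this subst_shift_ev_sum[OF assms(1)]] assms(2) show "F p q = 0" by simp
qed

lemma mult_subst_inject:
  assumes "bounded_snd T F" "bounded_snd T' G"
    "mult_add_power l (subst_shift 1 F) = mult_add_power l (subst_shift 1 G)"
  shows "F p q = G p q"
proof -
  let ?D = "\<lambda>p q. F p q - G p q"
  have D: "bounded_snd (min T T') ?D" using assms by (auto simp: bounded_snd_def)
  have eq: "subst_shift 1 ?D = (\<lambda>p q. subst_shift 1 F p q - subst_shift 1 G p q)"
    using subst_shift_diff[OF assms(1,2)] by (simp add: fun_eq_iff)
  have "mult_add_power l (subst_shift 1 ?D) p q = 0" for p q
    unfolding eq mult_add_power_diff using assms(3) by simp
  then have "subst_shift 1 ?D p q = 0" for p q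
    by (rule mult_add_power_eq_0[OF bounded_snd_subst_shift[OF D]])
  then have "?D p q = 0" by (rule subst_shift_eq_0[OF D])
  then show ?thesis by simp
qed

text \<open>The common bound \<open>T\<close> makes the substitution a finite sum whose length does
  not depend on j. It can then be exchanged with the sum over j.\<close>

lemma subst_shift_ev_sum_family:
  assumes "\<And>j. bounded_snd T (F j)" "\<And>p q. ev_sum (X p q) (\<lambda>j. F j p q)"
  shows "ev_sum (subst_shift 1 X p q) (\<lambda>j. subst_shift 1 (F j) p q)"
proof -
  have X: "bounded_snd T X"
    unfolding bounded_snd_def
  proof (intro allI impI)
    fix p q assume "q < T"
    then have "(\<lambda>j. F j p q) = (\<lambda>j. 0)" using assms(1) by (auto simp: bounded_snd_def)
    then have "ev_sum (X p q) (\<lambda>j. 0)" using assms(2)[of p q] by simp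
    then show "X p q = 0" by (rule ev_sum_unique[OF _ ev_sum_zero])
  qed
  have J: "q - int (nat (q - T)) \<le> T" by simp
  show ?thesis
    unfolding subst_shift_finite[OF X J] subst_shift_finite[OF assms(1) J]
    by (intro ev_sum_sum ev_sum_clinear[OF assms(2)])
       (simp_all add: clinear_iff cvec.scale_right_distrib mult.commute)
qed

section \<open>Weak associativity on V \<otimes> C((x))\<close>

context nonlocal_vertex_algebra
begin

text \<open>The coefficients of $x_1^s x_2^t$ in $Y(\alpha, x_1) Y(\beta, x_2) \gamma$ and in
  $Y(Y(\alpha, x_1)\beta, x_2)\gamma$, for the operators on $V \otimes C((x))$.\<close>

definition nested :: "'v fls \<Rightarrow> 'v fls \<Rightarrow> 'v fls \<Rightarrow> int \<Rightarrow> int \<Rightarrow> 'v fls" where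
  "nested \<alpha> \<beta> \<gamma> s t = Yq Y \<alpha> (Yq Y \<beta> \<gamma> t) s"

definition iterated :: "'v fls \<Rightarrow> 'v fls \<Rightarrow> 'v fls \<Rightarrow> int \<Rightarrow> int \<Rightarrow> 'v fls" where
  "iterated \<alpha> \<beta> \<gamma> s t = Yq Y (Yq Y \<alpha> \<beta> s) \<gamma> t"

text \<open>\<open>F\<close> is a series in x_1 and x_2, in which x_1 becomes x_0 + x_2, whereas
  \<open>G\<close> is already a series in x_0 and x_2. Hence only \<open>F\<close> is
  substituted.\<close>

definition weakly_assoc :: "nat \<Rightarrow> (int \<Rightarrow> int \<Rightarrow> 'v fls) \<Rightarrow> (int \<Rightarrow> int \<Rightarrow> 'v fls) \<Rightarrow> bool" where
  "weakly_assoc l F G \<longleftrightarrow> mult_add_power l (subst_shift 1 F) = mult_add_power l G"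

lemma weakly_assoc_mono: "weakly_assoc l F G \<Longrightarrow> weakly_assoc (k + l) F G"
  by (simp add: weakly_assoc_def mult_add_power_add)

lemma weakly_assoc_add:
  assumes "weakly_assoc l F G" "weakly_assoc k F' G'" "bounded_snd T F" "bounded_snd T' F'"
  shows "weakly_assoc (k + l) (\<lambda>s t. F s t + F' s t) (\<lambda>s t. G s t + G' s t)"
proof -
  have *: "weakly_assoc (k + l) F G" "weakly_assoc (k + l) F' G'"
    using weakly_assoc_mono[OF assms(1), of k] weakly_assoc_mono[OF assms(2), of l]
    by (simp_all add: add.commute)
  have eq: "subst_shift 1 (\<lambda>s t. F s t + F' s t) = (\<lambda>s t. subst_shift 1 F s t + subst_shift 1 F' s t)"
    using subst_shift_add[OF assms(3,4)] by (simp add: fun_eq_iff)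
  show ?thesis
    unfolding weakly_assoc_def eq fun_eq_iff mult_add_power_sum
    using * by (simp add: weakly_assoc_def)
qed

lemma weak_assoc_combine:
  assumes "\<exists>l. weakly_assoc l F G" "\<exists>l. weakly_assoc l F' G'"
    and "\<exists>T. bounded_snd T F" "\<exists>T. bounded_snd T F'"
  shows "\<exists>l. weakly_assoc l (\<lambda>s t. F s t + F' s t) (\<lambda>s t. G s t + G' s t)"
  using assms weakly_assoc_add by blast

lemma weakly_assoc_zero: "weakly_assoc 0 (\<lambda>s t. 0) (\<lambda>s t. 0)"
  by (simp add: weakly_assoc_def subst_shift_def fun_eq_iff)

lemma nested_in [simp]: "\<alpha> \<in> W \<Longrightarrow> \<beta> \<in> W \<Longrightarrow> \<gamma> \<in> W \<Longrightarrow> nested \<alpha> \<beta> \<gamma> s t \<in> W"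
  by (simp add: nested_def)

lemma iterated_in [simp]: "\<alpha> \<in> W \<Longrightarrow> \<beta> \<in> W \<Longrightarrow> \<gamma> \<in> W \<Longrightarrow> iterated \<alpha> \<beta> \<gamma> s t \<in> W"
  by (simp add: iterated_def)

lemma nested_bounded:
  assumes "\<alpha> \<in> W" "\<beta> \<in> W" "\<gamma> \<in> W"
  obtains T where "bounded_snd T (nested \<alpha> \<beta> \<gamma>)"
proof -
  obtain N where "\<And>n. n < N \<Longrightarrow> Yq Y \<beta> \<gamma> n = 0" using Yq_bound assms(2,3) by blast
  then have "bounded_snd N (nested \<alpha> \<beta> \<gamma>)" by (simp add: bounded_snd_def nested_def assms(1))
  then show thesis by (rule that)
qed

lemma weakly_assoc_const:
  "\<exists>l. weakly_assoc l (nested (fls_const u) (fls_const v) (fls_const w))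
         (iterated (fls_const u) (fls_const v) (fls_const w))"
proof -
  obtain l where l: "mult_add_power l (subst_shift 1 (\<lambda>m n. Y u (Y v w $$ n) $$ m))
     = mult_add_power l (\<lambda>p q. Y (Y u v $$ p) w $$ q)"
    using weak_assoc by blast
  have c: "clinear_on UNIV (fls_const :: 'v \<Rightarrow> 'v fls)"
    by (auto simp: clinear_on_def fls_eq_iff)
  have b: "bounded_snd (fls_subdegree (Y v w)) (\<lambda>m n. Y u (Y v w $$ n) $$ m)"
    by (simp add: bounded_snd_def)
  have 1: "nested (fls_const u) (fls_const v) (fls_const w) = (\<lambda>s t. fls_const (Y u (Y v w $$ t) $$ s))"
    "iterated (fls_const u) (fls_const v) (fls_const w) = (\<lambda>s t. fls_const (Y (Y u v $$ s) w $$ t))"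
    by (simp_all add: fun_eq_iff nested_def iterated_def Yq_const)
  have 2: "subst_shift 1 (\<lambda>s t. fls_const (Y u (Y v w $$ t) $$ s))
      = (\<lambda>s t. fls_const (subst_shift 1 (\<lambda>m n. Y u (Y v w $$ n) $$ m) s t))"
    using subst_shift_linear[OF b cvec.subspace_UNIV c] by (simp add: fun_eq_iff)
  have "weakly_assoc l (nested (fls_const u) (fls_const v) (fls_const w))
         (iterated (fls_const u) (fls_const v) (fls_const w))"
    unfolding weakly_assoc_def 1 2 fun_eq_iff
    using mult_add_power_linear[OF cvec.subspace_UNIV c] l by simp
  then show ?thesis ..
qed

lemma fls_module_linear_on: "clinear_on S (fls_module h)"
  by (simp add: clinear_on_def fls_module_add fls_module_scale)

lemma subst_shift_module:
  assumes "bounded_snd T F"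
  shows "subst_shift 1 (\<lambda>s t. fls_module h (F s t)) = (\<lambda>s t. fls_module h (subst_shift 1 F s t))"
  using subst_shift_linear[OF assms cvec.subspace_UNIV fls_module_linear_on] by (simp add: fun_eq_iff)

lemma mult_add_power_module:
  "mult_add_power l (\<lambda>s t. fls_module h (F s t)) = (\<lambda>s t. fls_module h (mult_add_power l F s t))"
  by (intro ext mult_add_power_linear[OF cvec.subspace_UNIV fls_module_linear_on]) simp

lemma weakly_assoc_module_3:
  assumes W: "\<alpha> \<in> W" "\<beta> \<in> W" "\<gamma> \<in> W"
    and "weakly_assoc l (nested \<alpha> \<beta> \<gamma>) (iterated \<alpha> \<beta> \<gamma>)"
  shows "weakly_assoc l (nested \<alpha> \<beta> (fls_module h \<gamma>)) (iterated \<alpha> \<beta> (fls_module h \<gamma>))"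
proof -
  obtain T where T: "bounded_snd T (nested \<alpha> \<beta> \<gamma>)" using nested_bounded[OF W] .
  have 1: "nested \<alpha> \<beta> (fls_module h \<gamma>) = (\<lambda>s t. fls_module h (nested \<alpha> \<beta> \<gamma> s t))"
    "iterated \<alpha> \<beta> (fls_module h \<gamma>) = (\<lambda>s t. fls_module h (iterated \<alpha> \<beta> \<gamma> s t))"
    using W by (simp_all add: fun_eq_iff nested_def iterated_def Yq_module_right)
  show ?thesis
    using assms(4) by (simp add: weakly_assoc_def 1 subst_shift_module[OF T] mult_add_power_module)
qed

text \<open>On both sides \<open>g\<close> contributes g(x - x_2). Its expansion only shifts the
  exponent of x_2, which commutes with the substitution and with multiplication by powers of x_0 +
  x_2.\<close>

lemma weakly_assoc_module_2:
  assumes W: "\<alpha> \<in> W" "\<beta> \<in> W" "\<gamma> \<in> W"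
    and "weakly_assoc l (nested \<alpha> \<beta> \<gamma>) (iterated \<alpha> \<beta> \<gamma>)"
  shows "weakly_assoc l (nested \<alpha> (fls_module g \<beta>) \<gamma>) (iterated \<alpha> (fls_module g \<beta>) \<gamma>)"
proof -
  let ?A = "nested \<alpha> \<beta> \<gamma>" and ?B = "iterated \<alpha> \<beta> \<gamma>"
  obtain T where T: "bounded_snd T ?A" using nested_bounded[OF W] .
  have A: "ev_sum (nested \<alpha> (fls_module g \<beta>) \<gamma> s t) (\<lambda>j. fls_module (shift_coeff j g) (?A s (t - int j)))" for s t
  proof -
    have "ev_sum (Yq Y \<alpha> (Yq Y (fls_module g \<beta>) \<gamma> t) s)
       (\<lambda>j. Yq Y \<alpha> (fls_module (shift_coeff j g) (Yq Y \<beta> \<gamma> (t - int j))) s)"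
      by (rule ev_sum_linear[OF Yq_module_left subspace_laurent_tensor Yq_linear_on(2)])
         (use W in \<open>simp_all add: laurent_tensor_module\<close>)
    then show ?thesis using W by (simp add: nested_def Yq_module_right)
  qed
  have B: "ev_sum (iterated \<alpha> (fls_module g \<beta>) \<gamma> s t) (\<lambda>j. fls_module (shift_coeff j g) (?B s (t - int j)))" for s t
    using W by (simp add: iterated_def Yq_module_right Yq_module_left)
  have Tj: "bounded_snd T (\<lambda>s t. ?A s (t - int j))" for j
    using T by (auto simp: bounded_snd_def)
  have sh: "subst_shift 1 (\<lambda>s t. ?A s (t - int j)) = (\<lambda>s t. subst_shift 1 ?A s (t - int j))" for j
    by (simp add: fun_eq_iff subst_shift_def algebra_simps)
  have ml: "mult_add_power l (\<lambda>s t. F s (t - int j)) = (\<lambda>s t. mult_add_power l F s (t - int j))" for j and F :: "int \<Rightarrow> int \<Rightarrow> 'v fls"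
    by (simp add: fun_eq_iff mult_add_power_def algebra_simps)
  have "bounded_snd T (\<lambda>s t. fls_module (shift_coeff j g) (?A s (t - int j)))" for j
    using Tj by (auto simp: bounded_snd_def)
  from subst_shift_ev_sum_family[OF this A]
  have "ev_sum (subst_shift 1 (nested \<alpha> (fls_module g \<beta>) \<gamma>) s t)
     (\<lambda>j. fls_module (shift_coeff j g) (subst_shift 1 ?A s (t - int j)))" for s t
    by (simp only: subst_shift_module[OF Tj] sh)
  from mult_add_power_ev_sum[where X = "subst_shift 1 (nested \<alpha> (fls_module g \<beta>) \<gamma>)" and l = l, OF this]
  have 1: "ev_sum (mult_add_power l (subst_shift 1 (nested \<alpha> (fls_module g \<beta>) \<gamma>)) s t)
     (\<lambda>j. fls_module (shift_coeff j g) (mult_add_power l (subst_shift 1 ?A) s (t - int j)))" for s t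
    by (simp only: mult_add_power_module ml)
  from mult_add_power_ev_sum[where X = "iterated \<alpha> (fls_module g \<beta>) \<gamma>" and l = l, OF B]
  have 2: "ev_sum (mult_add_power l (iterated \<alpha> (fls_module g \<beta>) \<gamma>) s t)
     (\<lambda>j. fls_module (shift_coeff j g) (mult_add_power l ?B s (t - int j)))" for s t
    by (simp only: mult_add_power_module ml)
  show ?thesis
    unfolding weakly_assoc_def fun_eq_iff
    using ev_sum_unique[OF 1] 2 assms(4) by (simp add: weakly_assoc_def)
qed

text \<open>The inner operator turns f into f(x - x_0), and the outer one turns this into f(x - x_2
  - x_0). Collecting by powers of x_0 + x_2 produces \<open>mult_add_power\<close>.\<close>

lemma iterated_module_1:
  assumes W: "\<alpha> \<in> W" "\<beta> \<in> W" "\<gamma> \<in> W"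
  shows "ev_sum (iterated (fls_module f \<alpha>) \<beta> \<gamma> s t)
    (\<lambda>n. fls_module (shift_coeff n f) (mult_add_power n (iterated \<alpha> \<beta> \<gamma>) s t))"
proof -
  let ?B = "iterated \<alpha> \<beta> \<gamma>"
  obtain R where R: "\<And>r. r < R \<Longrightarrow> Yq Y \<alpha> \<beta> r = 0" using Yq_bound[OF W(1,2)] by blast
  define I where "I = nat (s - R)"
  have I: "Yq Y \<alpha> \<beta> (s - int i) = 0" if "i > I" for i
    using that by (intro R) (auto simp: I_def)
  have "\<exists>J. \<forall>j>J. ?B (s - int i) (t - int j) = 0" for i
  proof -
    obtain N where N: "\<And>n. n < N \<Longrightarrow> Yq Y (Yq Y \<alpha> \<beta> (s - int i)) \<gamma> n = 0"
      using Yq_bound[OF Yq_in[OF W(1,2)] W(3)] by blast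
    then show ?thesis by (intro exI[of _ "nat (t - N)"]) (auto simp: iterated_def)
  qed
  then obtain J where J: "\<And>i j. j > J i \<Longrightarrow> ?B (s - int i) (t - int j) = 0" by metis
  \<comment> \<open>For i > I the inner coefficient is already zero, so only the finitely many
    bounds J i with i \<le> I matter.\<close>
  define M where "M = Max (insert I (J ` {..I}))"
  have M: "I \<le> M" "i \<le> I \<Longrightarrow> J i \<le> M" for i
    unfolding M_def by (auto intro!: Max_ge simp del: Max_insert)
  define z where "z j i = fls_module (shift_coeff j (shift_coeff i f)) (?B (s - int i) (t - int j))" for j i
  have z0: "z j i = 0" if "j > M \<or> i > M" for i j
  proof (cases "i > I")
    case True
    then show ?thesis by (simp add: z_def iterated_def I W)
  next
    case False
    then have "j > J i" using that M(1) M(2)[of i] by auto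
    then show ?thesis by (simp add: z_def J)
  qed
  have "ev_sum (Yq Y (fls_module f \<alpha>) \<beta> s) (\<lambda>i. fls_module (shift_coeff i f) (Yq Y \<alpha> \<beta> (s - int i)))"
    by (rule Yq_module_left[OF W(1,2)])
  then have "ev_sum (iterated (fls_module f \<alpha>) \<beta> \<gamma> s t)
       (\<lambda>i. Yq Y (fls_module (shift_coeff i f) (Yq Y \<alpha> \<beta> (s - int i))) \<gamma> t)"
    unfolding iterated_def
    by (rule ev_sum_linear[OF _ subspace_laurent_tensor Yq_linear_on(1)])
       (use W in \<open>simp_all add: laurent_tensor_module\<close>)
  moreover have "Yq Y (fls_module (shift_coeff i f) (Yq Y \<alpha> \<beta> (s - int i))) \<gamma> t = (\<Sum>j\<le>M. z j i)" for i
  proof (rule ev_sum_unique)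
    show "ev_sum (Yq Y (fls_module (shift_coeff i f) (Yq Y \<alpha> \<beta> (s - int i))) \<gamma> t) (\<lambda>j. z j i)"
      unfolding z_def iterated_def by (rule Yq_module_left) (use W in auto)
    show "ev_sum (\<Sum>j\<le>M. z j i) (\<lambda>j. z j i)"
      by (rule ev_sumI[of M]) (auto simp: z0)
  qed
  ultimately have "ev_sum (iterated (fls_module f \<alpha>) \<beta> \<gamma> s t) (\<lambda>i. \<Sum>j\<le>M. z j i)"
    by simp
  moreover have "ev_sum (\<Sum>i\<le>M. \<Sum>j\<le>M. z j i) (\<lambda>i. \<Sum>j\<le>M. z j i)"
    by (rule ev_sumI[of M]) (auto simp: z0)
  ultimately have "iterated (fls_module f \<alpha>) \<beta> \<gamma> s t = (\<Sum>i\<le>M. \<Sum>j\<le>M. z j i)"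
    by (rule ev_sum_unique)
  also have "\<dots> = (\<Sum>j\<le>M. \<Sum>i\<le>M. z j i)" by (rule sum.swap)
  finally have "ev_sum (iterated (fls_module f \<alpha>) \<beta> \<gamma> s t) (\<lambda>n. \<Sum>j\<le>n. z j (n - j))"
    using ev_sum_triangle[of M z] z0 by simp
  moreover have "(\<Sum>j\<le>n. z j (n - j)) = fls_module (shift_coeff n f) (mult_add_power n ?B s t)" for n
    unfolding mult_add_power_def fls_module_sum fls_module_scale
  proof (rule sum.cong)
    fix j assume j: "j \<in> {..n}"
    then have "shift_coeff j (shift_coeff (n - j) f) = of_nat (n choose j) *\<^sub>C shift_coeff n f"
      by (simp add: shift_coeff_shift_coeff)
    then show "z j (n - j) = of_nat (n choose j) *\<^sub>C fls_module (shift_coeff n f) (?B (s - int (n - j)) (t - int j))"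
      using W by (simp add: z_def fls_module_scale_left)
  qed simp
  ultimately show ?thesis by simp
qed

text \<open>The nested side carries f(x - x_1), and under x_1 = x_0 + x_2 the power x_1^n becomes
  (x_0 + x_2)^n. This matches \<open>iterated_module_1\<close> term by term, with the same power
  l.\<close>

lemma weakly_assoc_module_1:
  assumes W: "\<alpha> \<in> W" "\<beta> \<in> W" "\<gamma> \<in> W"
    and "weakly_assoc l (nested \<alpha> \<beta> \<gamma>) (iterated \<alpha> \<beta> \<gamma>)"
  shows "weakly_assoc l (nested (fls_module f \<alpha>) \<beta> \<gamma>) (iterated (fls_module f \<alpha>) \<beta> \<gamma>)"
proof -
  let ?A = "nested \<alpha> \<beta> \<gamma>" and ?B = "iterated \<alpha> \<beta> \<gamma>"
  obtain T where T: "bounded_snd T ?A" using nested_bounded[OF W] .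
  have A: "ev_sum (nested (fls_module f \<alpha>) \<beta> \<gamma> s t) (\<lambda>n. fls_module (shift_coeff n f) (?A (s - int n) t))" for s t
    using W by (simp add: nested_def Yq_module_left)
  have Tj: "bounded_snd T (\<lambda>s t. ?A (s - int n) t)" for n
    using T by (auto simp: bounded_snd_def)
  have "bounded_snd T (\<lambda>s t. fls_module (shift_coeff n f) (?A (s - int n) t))" for n
    using Tj by (auto simp: bounded_snd_def)
  from subst_shift_ev_sum_family[OF this A]
  have "ev_sum (subst_shift 1 (nested (fls_module f \<alpha>) \<beta> \<gamma>) s t)
     (\<lambda>n. fls_module (shift_coeff n f) (mult_add_power n (subst_shift 1 ?A) s t))" for s t
    by (simp only: subst_shift_module[OF Tj] subst_shift_mult_power[OF T])
  from mult_add_power_ev_sum[where X = "subst_shift 1 (nested (fls_module f \<alpha>) \<beta> \<gamma>)" and l = l, OF this]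
  have 1: "ev_sum (mult_add_power l (subst_shift 1 (nested (fls_module f \<alpha>) \<beta> \<gamma>)) s t)
     (\<lambda>n. fls_module (shift_coeff n f) (mult_add_power n (mult_add_power l (subst_shift 1 ?A)) s t))" for s t
    by (simp only: mult_add_power_module mult_add_power_commute[of l])
  from mult_add_power_ev_sum[where X = "iterated (fls_module f \<alpha>) \<beta> \<gamma>" and l = l, OF iterated_module_1[OF W]]
  have 2: "ev_sum (mult_add_power l (iterated (fls_module f \<alpha>) \<beta> \<gamma>) s t)
     (\<lambda>n. fls_module (shift_coeff n f) (mult_add_power n (mult_add_power l ?B) s t))" for s t
    by (simp only: mult_add_power_module mult_add_power_commute[of l])
  show ?thesis
    unfolding weakly_assoc_def fun_eq_iff
    using ev_sum_unique[OF 1] 2 assms(4) by (simp add: weakly_assoc_def)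
qed

text \<open>The power is left existential because it may grow when triples are added.\<close>

definition assoc_triple :: "'v fls \<Rightarrow> 'v fls \<Rightarrow> 'v fls \<Rightarrow> bool" where
  "assoc_triple \<alpha> \<beta> \<gamma> \<longleftrightarrow> (\<exists>l. weakly_assoc l (nested \<alpha> \<beta> \<gamma>) (iterated \<alpha> \<beta> \<gamma>))"

lemma assoc_triple_sumI:
  assumes "assoc_triple \<alpha> \<beta> \<gamma>" "assoc_triple \<alpha>' \<beta>' \<gamma>'"
    and "{\<alpha>, \<beta>, \<gamma>, \<alpha>', \<beta>', \<gamma>'} \<subseteq> W"
    and "nested \<alpha>'' \<beta>'' \<gamma>'' = (\<lambda>s t. nested \<alpha> \<beta> \<gamma> s t + nested \<alpha>' \<beta>' \<gamma>' s t)"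
    and "iterated \<alpha>'' \<beta>'' \<gamma>'' = (\<lambda>s t. iterated \<alpha> \<beta> \<gamma> s t + iterated \<alpha>' \<beta>' \<gamma>' s t)"
  shows "assoc_triple \<alpha>'' \<beta>'' \<gamma>''"
proof -
  have bd: "\<exists>T. bounded_snd T (nested \<alpha> \<beta> \<gamma>)" if "{\<alpha>, \<beta>, \<gamma>} \<subseteq> W" for \<alpha> \<beta> \<gamma>
    by (rule nested_bounded[of \<alpha> \<beta> \<gamma>]) (use that in auto)
  have "\<exists>T. bounded_snd T (nested \<alpha> \<beta> \<gamma>)" "\<exists>T. bounded_snd T (nested \<alpha>' \<beta>' \<gamma>')"
    using assms(3) by (simp_all add: bd)
  with assms(1,2) show ?thesis
    unfolding assoc_triple_def assms(4,5) by (rule weak_assoc_combine)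
qed

lemma assoc_triple_zeroI:
  "nested \<alpha> \<beta> \<gamma> = (\<lambda>s t. 0) \<Longrightarrow> iterated \<alpha> \<beta> \<gamma> = (\<lambda>s t. 0) \<Longrightarrow> assoc_triple \<alpha> \<beta> \<gamma>"
  unfolding assoc_triple_def using weakly_assoc_zero by auto

lemmas nested_iterated_simps = nested_def iterated_def fun_eq_iff Yq_add_left Yq_add_right

text \<open>On pure tensors the scalars are attached to the axiom for V one argument at a time,
  without raising the power. Sums are then built up separately in the three arguments.\<close>

lemma weak_assoc_series:
  assumes "\<alpha> \<in> W" "\<beta> \<in> W" "\<gamma> \<in> W"
  shows "assoc_triple \<alpha> \<beta> \<gamma>"
proof -
  have 1: "assoc_triple (fls_pure f u) (fls_pure g v) (fls_pure h w)" for f g h u v w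
  proof -
    obtain l where "weakly_assoc l (nested (fls_const u) (fls_const v) (fls_const w))
         (iterated (fls_const u) (fls_const v) (fls_const w))"
      using weakly_assoc_const by blast
    then show ?thesis
      unfolding assoc_triple_def fls_pure_eq_module
      by (intro exI[of _ l] weakly_assoc_module_1 weakly_assoc_module_2 weakly_assoc_module_3)
         (simp_all add: laurent_tensor_module)
  qed
  have 2: "assoc_triple (fls_pure f u) (fls_pure g v) \<gamma>" for f g u v
    using assms(3)
  proof (induct rule: laurent_tensor_induct)
    case (add h w \<gamma>)
    then show ?case
      by (intro assoc_triple_sumI[OF 1[of f u g v h w] add(2)]) (simp_all add: nested_iterated_simps)
  qed (rule assoc_triple_zeroI; simp add: nested_iterated_simps)
  have 3: "assoc_triple (fls_pure f u) \<beta> \<gamma>" for f u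
    using assms(2)
  proof (induct rule: laurent_tensor_induct)
    case (add g v \<beta>)
    then show ?case
      by (intro assoc_triple_sumI[OF 2[of f u g v] add(2)]) (simp_all add: nested_iterated_simps assms)
  qed (rule assoc_triple_zeroI; simp add: nested_iterated_simps assms)
  show ?thesis
    using assms(1)
  proof (induct rule: laurent_tensor_induct)
    case (add f u \<alpha>)
    then show ?case
      by (intro assoc_triple_sumI[OF 3[of f u] add(2)]) (simp_all add: nested_iterated_simps assms)
  qed (rule assoc_triple_zeroI; simp add: nested_iterated_simps assms)
qed

text \<open>The lower bound is carried through the induction because adding two weakly associative
  pairs depends on it.\<close>

lemma weak_assoc_sum_list:
  assumes "\<And>i. i \<in> set ts \<Longrightarrow> \<alpha> i \<in> W \<and> \<beta> i \<in> W \<and> \<gamma> i \<in> W"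
  shows "(\<exists>l. weakly_assoc l (\<lambda>s t. \<Sum>i\<leftarrow>ts. nested (\<alpha> i) (\<beta> i) (\<gamma> i) s t)
               (\<lambda>s t. \<Sum>i\<leftarrow>ts. iterated (\<alpha> i) (\<beta> i) (\<gamma> i) s t))
       \<and> (\<exists>T. bounded_snd T (\<lambda>s t. \<Sum>i\<leftarrow>ts. nested (\<alpha> i) (\<beta> i) (\<gamma> i) s t))"
  using assms
proof (induct ts)
  case Nil
  then show ?case
    using weakly_assoc_zero by (auto simp: bounded_snd_def)
next
  case (Cons i ts)
  then obtain l T where 1: "weakly_assoc l (\<lambda>s t. \<Sum>i\<leftarrow>ts. nested (\<alpha> i) (\<beta> i) (\<gamma> i) s t)
               (\<lambda>s t. \<Sum>i\<leftarrow>ts. iterated (\<alpha> i) (\<beta> i) (\<gamma> i) s t)"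
    "bounded_snd T (\<lambda>s t. \<Sum>i\<leftarrow>ts. nested (\<alpha> i) (\<beta> i) (\<gamma> i) s t)"
    by auto
  have W: "\<alpha> i \<in> W" "\<beta> i \<in> W" "\<gamma> i \<in> W" using Cons.prems by auto
  obtain k where 2: "weakly_assoc k (nested (\<alpha> i) (\<beta> i) (\<gamma> i)) (iterated (\<alpha> i) (\<beta> i) (\<gamma> i))"
    using weak_assoc_series[OF W] unfolding assoc_triple_def by blast
  obtain T' where 3: "bounded_snd T' (nested (\<alpha> i) (\<beta> i) (\<gamma> i))" using nested_bounded[OF W] .
  have "bounded_snd (min T' T) (\<lambda>s t. nested (\<alpha> i) (\<beta> i) (\<gamma> i) s t + (\<Sum>i\<leftarrow>ts. nested (\<alpha> i) (\<beta> i) (\<gamma> i) s t))"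
    using 1(2) 3 by (auto simp: bounded_snd_def)
  then show ?case using weakly_assoc_add[OF 2 1(1) 3 1(2)] by auto
qed

text \<open>Letting $a$ act on both sides of weak associativity for $u, v, w$ gives the two iterated
  coproducts, up to a power of $x_1 + x_2$ that can be cancelled.\<close>

lemma coassociativity_series:
  assumes a: "coproduct_identity Y a ps"
    and Q: "\<And>b c. (b, c) \<in> set ps \<Longrightarrow> coproduct_identity Y b (Q b) \<and> coproduct_identity Y c (Q c)"
  shows "(\<Sum>(b, c)\<leftarrow>ps. \<Sum>(b1, b2)\<leftarrow>Q b. nested (laurent_apply b1 u) (laurent_apply b2 v) (laurent_apply c w) s t)
       = (\<Sum>(b, c)\<leftarrow>ps. \<Sum>(c1, c2)\<leftarrow>Q c. nested (laurent_apply b u) (laurent_apply c1 v) (laurent_apply c2 w) s t)"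
proof -
  let ?u = "fls_const u" and ?v = "fls_const v" and ?w = "fls_const w"
  \<comment> \<open>These triples arise by taking coproducts of the first components. They index
    what \<open>a\<close> produces on the iterated product.\<close>
  define L where "L = concat (map (\<lambda>(b, c). map (\<lambda>(b1, b2). (b1, b2, c)) (Q b)) ps)"
  define \<alpha> \<beta> \<gamma> where "\<alpha> i = laurent_apply (fst i) u" and "\<beta> i = laurent_apply (fst (snd i)) v"
    and "\<gamma> i = laurent_apply (snd (snd i)) w" for i :: "'v laurent_hom \<times> 'v laurent_hom \<times> 'v laurent_hom"
  have sumL: "(\<Sum>i\<leftarrow>L. f (fst i) (fst (snd i)) (snd (snd i))) = (\<Sum>(b, c)\<leftarrow>ps. \<Sum>(b1, b2)\<leftarrow>Q b. f b1 b2 c)" for f :: "_ \<Rightarrow> _ \<Rightarrow> _ \<Rightarrow> 'v fls"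
    unfolding L_def by (induct ps) (simp_all add: case_prod_unfold o_def)
  define R where "R s t = (\<Sum>(b, c)\<leftarrow>ps. \<Sum>(c1, c2)\<leftarrow>Q c.
      nested (laurent_apply b u) (laurent_apply c1 v) (laurent_apply c2 w) s t)" for s t
  have "lext a (nested ?u ?v ?w s t) = R s t" for s t
  proof -
    have "lext a (nested ?u ?v ?w s t) = (\<Sum>(b, c)\<leftarrow>ps. Yq Y (laurent_apply b u) (lext c (Yq Y ?v ?w t)) s)"
      using coproduct_identity_lext[OF a] by (simp add: nested_def)
    also have "\<dots> = R s t"
      unfolding R_def
    proof (rule arg_cong[where f = sum_list], rule map_cong)
      fix i assume i: "i \<in> set ps"
      have "lext (snd i) (Yq Y ?v ?w t) = (\<Sum>j\<leftarrow>Q (snd i). Yq Y (laurent_apply (fst j) v) (laurent_apply (snd j) w) t)"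
        using Q[of "fst i" "snd i"] i coproduct_identity_lext[of "snd i" "Q (snd i)" ?v ?w t]
        by (simp add: case_prod_unfold)
      then have "Yq Y (laurent_apply (fst i) u) (lext (snd i) (Yq Y ?v ?w t)) s
          = (\<Sum>j\<leftarrow>Q (snd i). Yq Y (laurent_apply (fst i) u) (Yq Y (laurent_apply (fst j) v) (laurent_apply (snd j) w) t) s)"
        by (simp only:) (rule clinear_on_sum_list[OF subspace_laurent_tensor Yq_linear_on(2)], simp_all)
      then show "(case i of (b, c) \<Rightarrow> Yq Y (laurent_apply b u) (lext c (Yq Y ?v ?w t)) s)
        = (case i of (b, c) \<Rightarrow> \<Sum>(c1, c2)\<leftarrow>Q c. nested (laurent_apply b u) (laurent_apply c1 v) (laurent_apply c2 w) s t)"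
        by (simp add: case_prod_unfold nested_def)
    qed simp
    finally show ?thesis .
  qed
  moreover have "lext a (iterated ?u ?v ?w s t) = (\<Sum>i\<leftarrow>L. iterated (\<alpha> i) (\<beta> i) (\<gamma> i) s t)" for s t
  proof -
    have "lext a (iterated ?u ?v ?w s t) = (\<Sum>(b, c)\<leftarrow>ps. Yq Y (lext b (Yq Y ?u ?v s)) (laurent_apply c w) t)"
      using coproduct_identity_lext[OF a] by (simp add: iterated_def)
    also have "\<dots> = (\<Sum>(b, c)\<leftarrow>ps. \<Sum>(b1, b2)\<leftarrow>Q b. iterated (laurent_apply b1 u) (laurent_apply b2 v) (laurent_apply c w) s t)"
    proof (rule arg_cong[where f = sum_list], rule map_cong)
      fix i assume i: "i \<in> set ps"
      have "lext (fst i) (Yq Y ?u ?v s) = (\<Sum>j\<leftarrow>Q (fst i). Yq Y (laurent_apply (fst j) u) (laurent_apply (snd j) v) s)"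
        using Q[of "fst i" "snd i"] i coproduct_identity_lext[of "fst i" "Q (fst i)" ?u ?v s]
        by (simp add: case_prod_unfold)
      then have "Yq Y (lext (fst i) (Yq Y ?u ?v s)) (laurent_apply (snd i) w) t
          = (\<Sum>j\<leftarrow>Q (fst i). Yq Y (Yq Y (laurent_apply (fst j) u) (laurent_apply (snd j) v) s) (laurent_apply (snd i) w) t)"
        by (simp only:) (rule clinear_on_sum_list[OF subspace_laurent_tensor Yq_linear_on(1)], simp_all)
      then show "(case i of (b, c) \<Rightarrow> Yq Y (lext b (Yq Y ?u ?v s)) (laurent_apply c w) t)
        = (case i of (b, c) \<Rightarrow> \<Sum>(b1, b2)\<leftarrow>Q b. iterated (laurent_apply b1 u) (laurent_apply b2 v) (laurent_apply c w) s t)"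
        by (simp add: case_prod_unfold iterated_def)
    qed simp
    also have "\<dots> = (\<Sum>i\<leftarrow>L. iterated (\<alpha> i) (\<beta> i) (\<gamma> i) s t)"
      unfolding \<alpha>_def \<beta>_def \<gamma>_def
      by (rule sumL[of "\<lambda>b1 b2 c. iterated (laurent_apply b1 u) (laurent_apply b2 v) (laurent_apply c w) s t", symmetric])
    finally show ?thesis .
  qed
  moreover obtain l where l: "weakly_assoc l (nested ?u ?v ?w) (iterated ?u ?v ?w)"
    using weakly_assoc_const by blast
  moreover obtain T where T: "bounded_snd T (nested ?u ?v ?w)"
    using nested_bounded[of ?u ?v ?w] by auto
  ultimately have "weakly_assoc l R (\<lambda>s t. \<Sum>i\<leftarrow>L. iterated (\<alpha> i) (\<beta> i) (\<gamma> i) s t)" and TR: "bounded_snd T R"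
  proof -
    assume 1: "\<And>s t. lext a (nested ?u ?v ?w s t) = R s t"
      and 2: "\<And>s t. lext a (iterated ?u ?v ?w s t) = (\<Sum>i\<leftarrow>L. iterated (\<alpha> i) (\<beta> i) (\<gamma> i) s t)"
    have S: "subst_shift 1 R s t = lext a (subst_shift 1 (nested ?u ?v ?w) s t)" for s t
      unfolding 1[symmetric]
      by (rule subst_shift_linear[OF T subspace_laurent_tensor lext_linear_on]) simp
    have SW: "subst_shift 1 (nested ?u ?v ?w) s t \<in> W" for s t
      by (rule subst_shift_in[OF T subspace_laurent_tensor]) simp
    have "mult_add_power l (subst_shift 1 R) s t = lext a (mult_add_power l (subst_shift 1 (nested ?u ?v ?w)) s t)" for s t
      unfolding S
      by (rule mult_add_power_linear[OF subspace_laurent_tensor lext_linear_on SW])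
    moreover have "mult_add_power l (\<lambda>s t. \<Sum>i\<leftarrow>L. iterated (\<alpha> i) (\<beta> i) (\<gamma> i) s t) s t
       = lext a (mult_add_power l (iterated ?u ?v ?w) s t)" for s t
      unfolding 2[symmetric]
      by (rule mult_add_power_linear[OF subspace_laurent_tensor lext_linear_on]) simp
    ultimately show "weakly_assoc l R (\<lambda>s t. \<Sum>i\<leftarrow>L. iterated (\<alpha> i) (\<beta> i) (\<gamma> i) s t)"
      using l by (simp add: weakly_assoc_def fun_eq_iff)
    show "bounded_snd T R" unfolding bounded_snd_def 1[symmetric] using T by (simp add: bounded_snd_def)
  qed
  \<comment> \<open>The terms indexed by \<open>L\<close> are weakly associative in their own right.
    So \<open>R\<close> and the nested sum over \<open>L\<close> have the same iterated partner, and
    the power k + l compares them directly.\<close>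
  moreover obtain k T' where k: "weakly_assoc k (\<lambda>s t. \<Sum>i\<leftarrow>L. nested (\<alpha> i) (\<beta> i) (\<gamma> i) s t)
      (\<lambda>s t. \<Sum>i\<leftarrow>L. iterated (\<alpha> i) (\<beta> i) (\<gamma> i) s t)"
    "bounded_snd T' (\<lambda>s t. \<Sum>i\<leftarrow>L. nested (\<alpha> i) (\<beta> i) (\<gamma> i) s t)"
    using weak_assoc_sum_list[of L \<alpha> \<beta> \<gamma>] by (auto simp: \<alpha>_def \<beta>_def \<gamma>_def)
  ultimately have "mult_add_power (k + l) (subst_shift 1 (\<lambda>s t. \<Sum>i\<leftarrow>L. nested (\<alpha> i) (\<beta> i) (\<gamma> i) s t))
      = mult_add_power (k + l) (subst_shift 1 R)"
    using weakly_assoc_mono[of l R _ k] weakly_assoc_mono[OF k(1), of l]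
    by (simp add: weakly_assoc_def add.commute)
  from mult_subst_inject[OF k(2) TR this]
  have "(\<Sum>i\<leftarrow>L. nested (\<alpha> i) (\<beta> i) (\<gamma> i) s t) = R s t" .
  then show ?thesis
    unfolding \<alpha>_def \<beta>_def \<gamma>_def R_def
      sumL[of "\<lambda>b1 b2 c. nested (laurent_apply b1 u) (laurent_apply b2 v) (laurent_apply c w) s t"] .
qed

end

section \<open>Consequences of nondegeneracy\<close>

lemma iter_laurent_add:
  "F \<in> iter_laurent n \<Longrightarrow> G \<in> iter_laurent n \<Longrightarrow> F + G \<in> (iter_laurent n :: (int list \<Rightarrow> 'a::complex_vector) set)"
proof (induct n arbitrary: F G)
  case (Suc n)
  obtain N where N: "\<forall>k<N. \<forall>ks. F (ks @ [k]) = 0" using Suc.prems(1) by auto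
  obtain M where M: "\<forall>k<M. \<forall>ks. G (ks @ [k]) = 0" using Suc.prems(2) by auto
  have "(\<lambda>ks. F (ks @ [k])) + (\<lambda>ks. G (ks @ [k])) \<in> iter_laurent n" for k
    by (rule Suc.hyps) (use Suc.prems in auto)
  moreover have "\<exists>L. \<forall>k<L. \<forall>ks. F (ks @ [k]) + G (ks @ [k]) = 0"
    using N M by (intro exI[of _ "min N M"]) simp
  ultimately show ?case using Suc.prems by (auto simp: plus_fun_def)
qed simp

lemma iter_laurent_scale:
  "F \<in> iter_laurent n \<Longrightarrow> c *\<^sub>C F \<in> (iter_laurent n :: (int list \<Rightarrow> 'a::complex_vector) set)"
proof (induct n arbitrary: F)
  case (Suc n)
  obtain N where N: "\<forall>k<N. \<forall>ks. F (ks @ [k]) = 0" using Suc.prems(1) by auto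
  have "c *\<^sub>C (\<lambda>ks. F (ks @ [k])) \<in> iter_laurent n" for k
    by (rule Suc.hyps) (use Suc.prems in auto)
  then show ?case using Suc.prems N by (auto simp: scaleC_fun_def)
qed (simp add: scaleC_fun_def)

lemma iter_laurent_zero: "(\<lambda>_. 0) \<in> iter_laurent n"
  by (induct n) auto

lemma subspace_iter_laurent: "cvec.subspace (iter_laurent n :: (int list \<Rightarrow> 'a::complex_vector) set)"
  by (auto simp: cvec.subspace_def iter_laurent_add iter_laurent_scale iter_laurent_zero zero_fun_def)

text \<open>This covers the scalars that arise from f(x - y), whose expansion has only nonnegative
  powers of y.\<close>

lemma iter_laurentI_nonneg:
  assumes "\<And>ks. F ks \<noteq> 0 \<Longrightarrow> length ks = n \<and> (\<forall>k\<in>set ks. 0 \<le> k)"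
  shows "F \<in> iter_laurent n"
  using assms
proof (induct n arbitrary: F)
  case (Suc n)
  have "F [] = 0" using Suc.prems[of "[]"] by auto
  moreover have "\<forall>k<0. \<forall>ks. F (ks @ [k]) = 0" using Suc.prems by force
  moreover have "(\<lambda>ks. F (ks @ [k])) \<in> iter_laurent n" for k
    by (rule Suc.hyps) (use Suc.prems in force)
  ultimately show ?case by auto
qed auto

lemma iter_laurent_mult_support:
  assumes "F \<in> iter_laurent n" "G \<in> iter_laurent n"
  shows "finite {is. (if length is = length ks then F is *\<^sub>C G (map2 (-) ks is) else 0) \<noteq> 0}"
proof (cases "length ks = n")
  case True
  show ?thesis
    by (rule finite_subset[OF _ iter_laurent_mult_finite[OF assms True]]) (auto simp: True)
next
  case False
  then have "F is = 0" if "length is = length ks" for "is"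
    using iter_laurent_length[OF assms(1), of "is"] that by auto
  then have "{is. (if length is = length ks then F is *\<^sub>C G (map2 (-) ks is) else 0) \<noteq> 0} = {}"
    by auto
  then show ?thesis by simp
qed

lemma iter_laurent_mult_add_left:
  assumes "F \<in> iter_laurent n" "F' \<in> iter_laurent n" "G \<in> iter_laurent n"
  shows "iter_laurent_mult (F + F') G = iter_laurent_mult F G + iter_laurent_mult F' G"
proof
  fix ks
  show "iter_laurent_mult (F + F') G ks = (iter_laurent_mult F G + iter_laurent_mult F' G) ks"
    unfolding iter_laurent_mult_def plus_fun_apply
    by (subst Sum_any.distrib[symmetric, OF iter_laurent_mult_support[OF assms(1,3)] iter_laurent_mult_support[OF assms(2,3)]])
       (auto intro!: Sum_any.cong simp: cvec.scale_left_distrib)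
qed

lemma iter_laurent_mult_add_right:
  assumes "F \<in> iter_laurent n" "G \<in> iter_laurent n" "G' \<in> iter_laurent n"
  shows "iter_laurent_mult F (G + G') = iter_laurent_mult F G + iter_laurent_mult F G'"
proof
  fix ks
  show "iter_laurent_mult F (G + G') ks = (iter_laurent_mult F G + iter_laurent_mult F G') ks"
    unfolding iter_laurent_mult_def plus_fun_apply
    by (subst Sum_any.distrib[symmetric, OF iter_laurent_mult_support[OF assms(1,2)] iter_laurent_mult_support[OF assms(1,3)]])
       (auto intro!: Sum_any.cong simp: cvec.scale_right_distrib)
qed

lemma iter_laurent_mult_scale:
  assumes "F \<in> iter_laurent n" "G \<in> iter_laurent n"
  shows "iter_laurent_mult (c *\<^sub>C F) G = c *\<^sub>C iter_laurent_mult F G"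
    "iter_laurent_mult F (c *\<^sub>C G) = c *\<^sub>C iter_laurent_mult F G"
proof -
  show "iter_laurent_mult (c *\<^sub>C F) G = c *\<^sub>C iter_laurent_mult F G"
  proof
    fix ks
    show "iter_laurent_mult (c *\<^sub>C F) G ks = (c *\<^sub>C iter_laurent_mult F G) ks"
      unfolding iter_laurent_mult_def scaleC_fun_def
      by (subst Sum_any_scaleC[symmetric, OF iter_laurent_mult_support[OF assms]])
         (auto intro!: Sum_any.cong simp: scaleC_complex_def)
  qed
  show "iter_laurent_mult F (c *\<^sub>C G) = c *\<^sub>C iter_laurent_mult F G"
  proof
    fix ks
    show "iter_laurent_mult F (c *\<^sub>C G) ks = (c *\<^sub>C iter_laurent_mult F G) ks"
      unfolding iter_laurent_mult_def scaleC_fun_def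
      by (subst Sum_any_scaleC[symmetric, OF iter_laurent_mult_support[OF assms]])
         (auto intro!: Sum_any.cong simp: mult.commute)
  qed
qed

lemma sum_list_map_eq_0: "(\<And>x. x \<in> set xs \<Longrightarrow> f x = 0) \<Longrightarrow> sum_list (map f xs) = (0::'a::comm_monoid_add)"
  by (induct xs) auto

lemma complex_scaleC [simp]: "c *\<^sub>C (x::complex) = c * x"
  by (simp add: scaleC_complex_def)

lemma clinear_span_in:
  assumes "clinear T" "cvec.subspace S" "\<And>x. x \<in> A \<Longrightarrow> T x \<in> S" "t \<in> cvec.span A"
  shows "T t \<in> S"
  using assms(4)
proof (induct rule: cvec.span_induct_alt)
  case base
  then show ?case using assms(1,2) by (metis clinear_iff cvec.scale_zero_left cvec.subspace_0)
next
  case (step c x y)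
  then show ?case using assms(1,2,3) by (auto simp: clinear_iff intro!: cvec.subspace_add cvec.subspace_scale)
qed

text \<open>The coefficient of $y_1^{j_1} \cdots y_n^{j_n}$ in $f_1(x - y_1) \cdots f_n(x - y_n)$.\<close>

fun shift_coeffs :: "complex fls list \<Rightarrow> int list \<Rightarrow> complex fls" where
  "shift_coeffs [] [] = 1"
| "shift_coeffs (f # fs) (j # js) = (if 0 \<le> j then shift_coeff (nat j) f * shift_coeffs fs js else 0)"
| "shift_coeffs _ _ = 0"

lemma shift_coeffs_support:
  "shift_coeffs fs js \<noteq> 0 \<Longrightarrow> length js = length fs \<and> (\<forall>j\<in>set js. 0 \<le> j)"
  by (induct fs js rule: shift_coeffs.induct) (auto split: if_splits)

text \<open>The tensor product of the functionals \<open>\<phi>s\<close> on a tensor power, extended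
  by 0 to other lengths so that it is defined on the whole tensor algebra.\<close>

fun functional_prod :: "('v \<Rightarrow> complex) list \<Rightarrow> 'v list \<Rightarrow> complex" where
  "functional_prod [] [] = 1"
| "functional_prod (\<phi> # \<phi>s) (u # us) = \<phi> u * functional_prod \<phi>s us"
| "functional_prod _ _ = 0"

lemma cmultilinear_functional_prod:
  fixes \<phi>s :: "('v::complex_vector \<Rightarrow> complex) list"
  assumes "\<And>\<phi>. \<phi> \<in> set \<phi>s \<Longrightarrow> clinear \<phi>"
  shows "cmultilinear (functional_prod \<phi>s)"
proof -
  have "clinear (\<lambda>a. functional_prod \<phi>s (xs @ a # ys))" for xs ys
    using assms
  proof (induct xs arbitrary: \<phi>s)
    case Nil
    show ?case
    proof (cases \<phi>s)
      case (Cons \<phi> \<psi>s)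
      then have "\<phi> (x + y) = \<phi> x + \<phi> y" "\<phi> (c *\<^sub>C x) = c * \<phi> x" for x y c
        using Nil[of \<phi>] unfolding clinear_iff by auto
      then show ?thesis unfolding clinear_iff by (simp add: Cons distrib_right)
    qed (unfold clinear_iff, simp)
  next
    case (Cons x xs)
    show ?case
    proof (cases \<phi>s)
      case Nil
      then show ?thesis unfolding clinear_iff by simp
    next
      case (Cons \<phi> \<psi>s)
      then show ?thesis
        using Cons.hyps[of \<psi>s] Cons.prems unfolding clinear_iff by (auto simp: algebra_simps)
    qed
  qed
  then show ?thesis by (simp add: cmultilinear_def)
qed

section \<open>Products of vertex operators applied to the vacuum\<close>

context nonlocal_vertex_algebra
begin

lemma Y_product_length: "Y_product Y w vs ks \<noteq> 0 \<Longrightarrow> length ks = length vs"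
proof -
  have "length ks \<noteq> length vs \<Longrightarrow> Y_product Y w vs ks = 0"
    by (induct vs arbitrary: ks; case_tac ks) auto
  then show "Y_product Y w vs ks \<noteq> 0 \<Longrightarrow> length ks = length vs" by blast
qed

lemma Y_product_zero: "Y_product Y 0 vs ks = 0"
  by (induct vs arbitrary: ks; case_tac ks) auto

text \<open>\<open>iter_laurent\<close> splits off the last variable, whereas
  \<open>Y_product\<close> recurses on the first. Removing the last factor replaces the vacuum by
  another vector, so the end vector is kept arbitrary.\<close>

lemma Y_product_snoc:
  "Y_product Y w (vs @ [v]) (ks @ [k]) = Y_product Y (Y v w $$ k) vs ks"
proof (cases "length ks = length vs")
  case True
  then show ?thesis by (induct ks vs rule: list_induct2) auto
next
  case False
  then have "Y_product Y (Y v w $$ k) vs ks = 0" using Y_product_length by blast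
  moreover have "Y_product Y w (vs @ [v]) (ks @ [k]) = 0" using False Y_product_length by fastforce
  ultimately show ?thesis by simp
qed

lemma Y_product_iter_laurent: "Y_product Y w vs \<in> iter_laurent (length vs)"
proof (induct vs arbitrary: w rule: rev_induct)
  case Nil
  have "Y_product Y w [] ks = 0" if "ks \<noteq> []" for ks using that by (cases ks) auto
  then show ?case by simp
next
  case (snoc v vs)
  have "Y_product Y w (vs @ [v]) [] = 0" using Y_product_length[of w "vs @ [v]" "[]"] by auto
  moreover have "\<exists>N. \<forall>k<N. \<forall>ks. Y_product Y (Y v w $$ k) vs ks = 0"
    by (intro exI[of _ "fls_subdegree (Y v w)"]) (simp add: Y_product_zero)
  ultimately show ?case using snoc by (auto simp: Y_product_snoc)
qed

lemma cmultilinear_Y_product: "cmultilinear (Y_product Y w)"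
proof -
  have "Y_product Y w (xs @ (a + b) # ys) ks = Y_product Y w (xs @ a # ys) ks + Y_product Y w (xs @ b # ys) ks"
    "Y_product Y w (xs @ (c *\<^sub>C a) # ys) ks = c *\<^sub>C Y_product Y w (xs @ a # ys) ks" for xs a b c ys ks
    by (induct xs arbitrary: ks; case_tac ks; simp)+
  then show ?thesis
    by (simp add: cmultilinear_def clinear_iff fun_eq_iff scaleC_fun_def)
qed

definition Z_bilinear :: "'v tensor_alg \<Rightarrow> (int list \<Rightarrow> complex) \<Rightarrow> int list \<Rightarrow> 'v" where
  "Z_bilinear t F = iter_laurent_mult F (tensor_alg_lift (Y_product Y vac) t)"

lemma cbilinear_on_Z: "cbilinear_on (tensor_power n) (iter_laurent n) Z_bilinear"
proof -
  note lin = clinear_tensor_alg_lift[OF cmultilinear_Y_product, of vac]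
  have *: "tensor_alg_lift (Y_product Y vac) t \<in> iter_laurent n" if "t \<in> tensor_power n" for t
    using that unfolding tensor_power_def
    by (rule clinear_span_in[OF lin subspace_iter_laurent, rotated])
       (use Y_product_iter_laurent in \<open>auto simp: tensor_alg_lift_pure[OF cmultilinear_Y_product]\<close>)
  show ?thesis
    using lin by (auto simp: cbilinear_on_def clinear_on_def Z_bilinear_def clinear_iff
        iter_laurent_mult_add_left[OF _ _ *] iter_laurent_mult_add_right[OF _ * *]
        iter_laurent_mult_scale[OF _ *])
qed

text \<open>Nondegeneracy makes the sum of the tensors us \<otimes> F itself zero, and
  \<open>\<Phi>\<close> can then be applied to its first factor.\<close>

lemma nondegenerate_multilinear:
  assumes nd: "nondegenerate Y vac" and n: "n > 0"
    and qs: "\<And>us F. (us, F) \<in> set qs \<Longrightarrow> length us = n \<and> F \<in> iter_laurent n"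
    and 0: "\<And>ks. (\<Sum>(us, F)\<leftarrow>qs. iter_laurent_mult F (Y_product Y vac us) ks) = 0"
    and \<Phi>: "cmultilinear (\<Phi> :: 'v list \<Rightarrow> complex)"
  shows "(\<Sum>(us, F)\<leftarrow>qs. \<Phi> us * F ks) = 0"
proof -
  define ps where "ps = map (\<lambda>(us, F). (pure_tensors us :: 'v tensor_alg, F)) qs"
  define t where "t = (\<Sum>(a, b)\<leftarrow>ps. a \<otimes> b)"
  have sub: "cvec.subspace (tensor_power n :: 'v tensor_alg set)"
    by (simp add: tensor_power_def)
  have ps: "set ps \<subseteq> tensor_power n \<times> iter_laurent n"
    using qs by (auto simp: ps_def tensor_power_def intro!: cvec.span_base)
  have t_in: "t \<in> tensor_power n \<otimes>\<^sub>S iter_laurent n"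
    unfolding t_def tensor_sub_def
    by (rule subspace_sum_list) (use ps in \<open>auto intro!: cvec.span_base\<close>)
  have Z: "Z_map Y vac n (\<Sum>(a, b)\<leftarrow>rs. a \<otimes> b) = (\<Sum>(a, b)\<leftarrow>rs. Z_bilinear a b)"
    if "set rs \<subseteq> tensor_power n \<times> iter_laurent n" for rs
    unfolding Z_map_def Z_bilinear_def[symmetric]
    by (rule tensor_lift_on_eq[OF sub subspace_iter_laurent cbilinear_on_Z that])
  have "(\<Sum>(a, b)\<leftarrow>ps. Z_bilinear a b) ks = (\<Sum>(us, F)\<leftarrow>qs. iter_laurent_mult F (Y_product Y vac us) ks)" for ks
    unfolding ps_def
    by (induct qs) (auto simp: Z_bilinear_def tensor_alg_lift_pure[OF cmultilinear_Y_product])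
  then have "Z_map Y vac n t = 0"
    unfolding t_def Z[OF ps] using 0 by (simp add: fun_eq_iff)
  moreover have "Z_map Y vac n 0 = 0" using Z[of "[]"] by simp
  moreover have "0 \<in> tensor_power n \<otimes>\<^sub>S (iter_laurent n :: (int list \<Rightarrow> complex) set)"
    unfolding tensor_sub_def by (rule cvec.span_zero)
  ultimately have t0: "t = 0"
    using nd n t_in unfolding nondegenerate_def inj_on_def by metis
  define f where "f s F = tensor_alg_lift \<Phi> s *\<^sub>C F" for s and F :: "int list \<Rightarrow> complex"
  have f: "cbilinear f"
    using clinear_tensor_alg_lift[OF \<Phi>]
    by (simp add: cbilinear_def clinear_iff f_def cvec.scale_left_distrib cvec.scale_right_distrib mult.commute)
  have "(\<Sum>(a, b)\<leftarrow>ps. f a b) = 0"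
    using tensor_lift_sum[OF f, of ps] t0 clinear_tensor_lift[OF f] unfolding t_def[symmetric]
    by (metis clinear_iff cvec.scale_zero_left)
  moreover have "(\<Sum>(a, b)\<leftarrow>ps. f a b) ks = (\<Sum>(us, F)\<leftarrow>qs. \<Phi> us * F ks)"
    unfolding ps_def
    by (induct qs) (auto simp: f_def tensor_alg_lift_pure[OF \<Phi>] scaleC_fun_def)
  ultimately show ?thesis by simp
qed

text \<open>Each entry (f, u) stands for f \<otimes> u. Keeping the two parts apart lets functionals
  act on the vectors and leave the scalars.\<close>

fun Yq_product :: "(complex fls \<times> 'v) list \<Rightarrow> int list \<Rightarrow> 'v fls" where
  "Yq_product [] [] = fls_const vac"
| "Yq_product (x # xs) (k # ks) = Yq Y (fls_pure (fst x) (snd x)) (Yq_product xs ks) k"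
| "Yq_product _ _ = 0"

text \<open>Iterating \<open>Yq_pure\<close> collects the scalars into f_1(x - y_1) ... f_n(x -
  y_n). Vanishing outside \<open>S\<close> is part of the claim because both the induction and the
  infinite sum in \<open>iter_laurent_mult\<close> depend on it.\<close>

lemma Yq_product_expand:
  assumes "length ks = length xs"
  shows "\<exists>S. finite S
     \<and> (\<forall>js. js \<notin> S \<longrightarrow> shift_coeffs (map fst xs) js = 0 \<or> Y_product Y vac (map snd xs) (map2 (-) ks js) = 0)
     \<and> Yq_product xs ks = (\<Sum>js\<in>S. fls_pure (shift_coeffs (map fst xs) js) (Y_product Y vac (map snd xs) (map2 (-) ks js)))"
  using assms
proof (induct ks xs rule: list_induct2)
  case Nil
  have "shift_coeffs [] js = 0" if "js \<noteq> []" for js using that by (cases js) auto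
  then show ?case by (intro exI[of _ "{[]}"]) (auto simp: fls_pure_1)
next
  case (Cons k ks x xs)
  define c where "c = shift_coeffs (map fst xs)"
  define y where "y js = Y_product Y vac (map snd xs) (map2 (-) ks js)" for js
  obtain S where S: "finite S" "\<And>js. js \<notin> S \<Longrightarrow> c js = 0 \<or> y js = 0"
    "Yq_product xs ks = (\<Sum>js\<in>S. fls_pure (c js) (y js))"
    using Cons(2) by (auto simp: c_def y_def)
  obtain f u where x: "x = (f, u)" by (cases x)
  define J where "J js = nat (k - fls_subdegree (Y u (y js)))" for js
  \<comment> \<open>An index beyond which the expansion contributes nothing, for all of the finitely
    many vectors y js at once.\<close>
  define M where "M = Max (insert 0 (J ` S))"
  have M: "J js \<le> M" if "js \<in> S" for js
    unfolding M_def using that S(1) by (auto intro!: Max_ge simp del: Max_insert)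
  have J: "Y u (y js) $$ (k - int j) = 0" if "j > M" "js \<in> S" for j js
    using that M[of js] by (auto simp: J_def)
  define S' where "S' = (\<lambda>(js, j). int j # js) ` (S \<times> {..M})"
  define g where "g js = fls_pure (shift_coeffs (map fst (x # xs)) js) (Y_product Y vac (map snd (x # xs)) (map2 (-) (k # ks) js))" for js
  have "finite S'" using S(1) by (simp add: S'_def)
  moreover have "shift_coeffs (map fst (x # xs)) js = 0 \<or> Y_product Y vac (map snd (x # xs)) (map2 (-) (k # ks) js) = 0"
    if "js \<notin> S'" for js
  proof (cases js)
    case (Cons j js')
    show ?thesis
    proof (cases "0 \<le> j \<and> c js' \<noteq> 0 \<and> js' \<in> S")
      case True
      have "\<not> nat j \<le> M"
      proof
        assume "nat j \<le> M"
        then have "(\<lambda>(js, j). int j # js) (js', nat j) \<in> S'"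
          unfolding S'_def using True by (intro imageI) auto
        then show False using that Cons True by simp
      qed
      then show ?thesis using J[of "nat j" js'] True Cons x by (simp add: y_def)
    next
      case False
      then show ?thesis using S(2)[of js'] Cons x by (auto simp: c_def y_def)
    qed
  qed simp
  moreover have "Yq_product (x # xs) (k # ks) = (\<Sum>js\<in>S'. g js)"
  proof -
    have "Yq_product (x # xs) (k # ks) = Yq Y (fls_pure f u) (\<Sum>js\<in>S. fls_pure (c js) (y js)) k"
      using S(3) by (simp add: x)
    also have "\<dots> = (\<Sum>js\<in>S. Yq Y (fls_pure f u) (fls_pure (c js) (y js)) k)"
      by (rule clinear_on_sum[OF subspace_laurent_tensor Yq_linear_on(2)]) auto
    also have "\<dots> = (\<Sum>js\<in>S. \<Sum>j\<le>M. fls_pure (shift_coeff j f * c js) (Y u (y js) $$ (k - int j)))"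
    proof (rule sum.cong)
      fix js assume "js \<in> S"
      then show "Yq Y (fls_pure f u) (fls_pure (c js) (y js)) k
          = (\<Sum>j\<le>M. fls_pure (shift_coeff j f * c js) (Y u (y js) $$ (k - int j)))"
        by (intro ev_sum_unique[OF Yq_pure] ev_sumI[of M]) (auto simp: J)
    qed simp
    also have "\<dots> = (\<Sum>(js, j)\<in>S \<times> {..M}. g (int j # js))"
      by (simp add: sum.cartesian_product g_def c_def y_def x)
    also have "\<dots> = (\<Sum>js\<in>S'. g js)"
      unfolding S'_def by (subst sum.reindex) (auto simp: inj_on_def case_prod_unfold)
    finally show ?thesis .
  qed
  ultimately show ?case unfolding g_def by blast
qed

text \<open>At a fixed power of x the scalars form an element of C((y_1))...((y_n)) multiplying an
  ordinary product of vertex operators. This is the shape of a value of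
  \<open>Z_map\<close>.\<close>

lemma Yq_product_nth:
  assumes "length ks = length xs"
  shows "Yq_product xs ks $$ p
    = iter_laurent_mult (\<lambda>js. shift_coeffs (map fst xs) js $$ p) (Y_product Y vac (map snd xs)) ks"
proof -
  obtain S where S: "finite S" "\<And>js. js \<notin> S \<Longrightarrow> shift_coeffs (map fst xs) js = 0 \<or> Y_product Y vac (map snd xs) (map2 (-) ks js) = 0"
     "Yq_product xs ks = (\<Sum>js\<in>S. fls_pure (shift_coeffs (map fst xs) js) (Y_product Y vac (map snd xs) (map2 (-) ks js)))"
    using Yq_product_expand[OF assms] by blast
  let ?g = "\<lambda>js. if length js = length ks then (shift_coeffs (map fst xs) js $$ p)
      *\<^sub>C Y_product Y vac (map snd xs) (map2 (-) ks js) else 0"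
  have "iter_laurent_mult (\<lambda>js. shift_coeffs (map fst xs) js $$ p) (Y_product Y vac (map snd xs)) ks
      = (\<Sum>js\<in>S. ?g js)"
    unfolding iter_laurent_mult_def
  proof (rule Sum_any.expand_superset[OF S(1)])
    have "?g js = 0" if "js \<notin> S" for js using S(2)[OF that] by auto
    then show "{js. ?g js \<noteq> 0} \<subseteq> S" by blast
  qed
  also have "\<dots> = (\<Sum>js\<in>S. (shift_coeffs (map fst xs) js $$ p) *\<^sub>C Y_product Y vac (map snd xs) (map2 (-) ks js))"
    using shift_coeffs_support[of "map fst xs"] assms by (intro sum.cong) force+
  finally show ?thesis by (simp add: S(3) fls_nth_sum)
qed

text \<open>Nondegeneracy is used for each power p of x separately. The resulting scalar identities
  are the coefficients of one identity in C((x)).\<close>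

lemma Yq_product_sum_eq_0:
  assumes nd: "nondegenerate Y vac" and n: "n > 0"
    and P: "\<And>xs. xs \<in> set P \<Longrightarrow> length xs = n"
    and 0: "\<And>ks. length ks = n \<Longrightarrow> (\<Sum>xs\<leftarrow>P. Yq_product xs ks) = 0"
    and \<phi>s: "\<And>\<phi>. \<phi> \<in> set \<phi>s \<Longrightarrow> clinear \<phi>"
  shows "(\<Sum>xs\<leftarrow>P. fls_const (functional_prod \<phi>s (map snd xs)) * shift_coeffs (map fst xs) js) = 0"
proof (rule fls_eqI)
  fix p
  define qs where "qs = map (\<lambda>xs. (map snd xs, \<lambda>js. shift_coeffs (map fst xs) js $$ p)) P"
  have nth: "(\<Sum>i\<leftarrow>A. g i) $$ p = (\<Sum>i\<leftarrow>A. g i $$ p)" for A and g :: "(complex fls \<times> 'v) list \<Rightarrow> 'b::comm_monoid_add fls"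
    by (induct A) auto
  have "(\<Sum>(us, F)\<leftarrow>qs. functional_prod \<phi>s us * F js) = 0"
  proof (rule nondegenerate_multilinear[OF nd n _ _ cmultilinear_functional_prod[OF \<phi>s]])
    show "length us = n \<and> F \<in> iter_laurent n" if q: "(us, F) \<in> set qs" for us F
    proof -
      obtain xs where xs: "xs \<in> set P" "us = map snd xs" "F = (\<lambda>js. shift_coeffs (map fst xs) js $$ p)"
        using q by (auto simp: qs_def)
      have "F \<in> iter_laurent n"
      proof (rule iter_laurentI_nonneg)
        fix ks assume "F ks \<noteq> 0"
        then have "shift_coeffs (map fst xs) ks \<noteq> 0" using xs(3) by auto
        then show "length ks = n \<and> (\<forall>k\<in>set ks. 0 \<le> k)"
          using shift_coeffs_support P[OF xs(1)] by fastforce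
      qed
      then show ?thesis using xs P by simp
    qed
    show "(\<Sum>(us, F)\<leftarrow>qs. iter_laurent_mult F (Y_product Y vac us) ks) = 0" for ks
    proof (cases "length ks = n")
      case True
      have "(\<Sum>(us, F)\<leftarrow>qs. iter_laurent_mult F (Y_product Y vac us) ks) = (\<Sum>xs\<leftarrow>P. Yq_product xs ks $$ p)"
        unfolding qs_def map_map o_def
        by (rule arg_cong[where f = sum_list], rule map_cong) (use P True in \<open>auto simp: Yq_product_nth\<close>)
      then show ?thesis using 0[OF True] nth[of "\<lambda>xs. Yq_product xs ks" P] by simp
    next
      case False
      \<comment> \<open>Lists of the wrong length are treated because
        \<open>nondegenerate_multilinear\<close> asks for vanishing at every list.\<close>
      have "iter_laurent_mult F (Y_product Y vac us) ks = 0" if "(us, F) \<in> set qs" for us F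
      proof -
        have "length is = n" if Fis: "F is \<noteq> 0" for "is"
        proof -
          obtain xs where xs: "xs \<in> set P" "F = (\<lambda>js. shift_coeffs (map fst xs) js $$ p)"
            using \<open>(us, F) \<in> set qs\<close> by (auto simp: qs_def)
          then have "shift_coeffs (map fst xs) is \<noteq> 0" using Fis by auto
          then show ?thesis using shift_coeffs_support P[OF xs(1)] by fastforce
        qed
        then have "(\<lambda>is. if length is = length ks then F is *\<^sub>C Y_product Y vac us (map2 (-) ks is) else 0) = (\<lambda>is. 0)"
          using False by fastforce
        then have "iter_laurent_mult F (Y_product Y vac us) ks = Sum_any (\<lambda>is::int list. 0)"
          unfolding iter_laurent_mult_def by (rule arg_cong)
        then show ?thesis by simp
      qed
      then show ?thesis by (intro sum_list_map_eq_0) auto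
    qed
  qed
  then have "(\<Sum>xs\<leftarrow>P. functional_prod \<phi>s (map snd xs) * shift_coeffs (map fst xs) js $$ p) = 0"
    by (simp add: qs_def o_def)
  then show "(\<Sum>xs\<leftarrow>P. fls_const (functional_prod \<phi>s (map snd xs)) * shift_coeffs (map fst xs) js) $$ p = 0 $$ p"
    by (simp add: nth)
qed

end

section \<open>Detecting tensors by linear functionals\<close>

lemma separating_functional:
  fixes v :: "'v::complex_vector"
  assumes "\<And>\<phi> :: 'v \<Rightarrow> complex. clinear \<phi> \<Longrightarrow> \<phi> v = 0"
  shows "v = 0"
proof (rule ccontr)
  assume "v \<noteq> 0"
  interpret p: vector_space_pair "scaleC :: complex \<Rightarrow> 'v \<Rightarrow> 'v" "scaleC :: complex \<Rightarrow> complex \<Rightarrow> complex"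
    by unfold_locales
  have "cvec.independent {v}" using \<open>v \<noteq> 0\<close> by simp
  from p.linear_independent_extend[OF this, of "\<lambda>_. 1"]
  obtain g where "clinear g" "g v = (1::complex)" by auto
  with assms[of g] show False by simp
qed

text \<open>If $f(a) \neq 0$ for the first component $a$ of the list, the hypothesis for $f$ expresses the
  partner $b$ of $a$ through the other second components, so that the list can be shortened.\<close>

lemma tensor_list_eq_0:
  fixes \<Phi> :: "('a::complex_vector \<Rightarrow> complex) set" and ps :: "('a \<times> 'b::complex_vector) list"
  assumes sep: "\<And>x. (\<And>f. f \<in> \<Phi> \<Longrightarrow> f x = 0) \<Longrightarrow> x = 0"
    and lin: "\<And>f. f \<in> \<Phi> \<Longrightarrow> clinear f"
    and "\<And>f. f \<in> \<Phi> \<Longrightarrow> (\<Sum>(a, b)\<leftarrow>ps. f a *\<^sub>C b) = 0"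
  shows "(\<Sum>(a, b)\<leftarrow>ps. a \<otimes> b) = 0"
  using assms(3)
proof (induct "length ps" arbitrary: ps)
  case (Suc n)
  obtain a b qs where ps: "ps = (a, b) # qs" "length qs = n"
    using Suc.hyps(2) by (cases ps) auto
  show ?case
  proof (cases "a = 0")
    case True
    have z0: "f a = 0" if "f \<in> \<Phi>" for f
      using lin[OF that] True by (metis clinear_iff cvec.scale_zero_left)
    then have "(\<Sum>(a, b)\<leftarrow>qs. f a *\<^sub>C b) = 0" if "f \<in> \<Phi>" for f
      using Suc.prems[OF that] ps z0[OF that] by simp
    then have "(\<Sum>(a, b)\<leftarrow>qs. a \<otimes> b) = 0"
      using ps by (intro Suc.hyps(1)) auto
    moreover have "(0::'a) \<otimes> b = 0" using pure_add_scale(3)[of 0 0 b] by simp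
    ultimately show ?thesis using ps True by simp
  next
    case False
    then obtain f0 where f0: "f0 \<in> \<Phi>" "f0 a \<noteq> 0" using sep by blast
    define k where "k x = f0 x / f0 a" for x
    have "f0 a *\<^sub>C b + (\<Sum>(x, y)\<leftarrow>qs. f0 x *\<^sub>C y) = 0"
      using Suc.prems[OF f0(1)] ps by simp
    then have "(1 / f0 a) *\<^sub>C (f0 a *\<^sub>C b + (\<Sum>(x, y)\<leftarrow>qs. f0 x *\<^sub>C y)) = 0" by simp
    moreover have "(1 / f0 a) *\<^sub>C (\<Sum>(x, y)\<leftarrow>qs. f0 x *\<^sub>C y) = (\<Sum>(x, y)\<leftarrow>qs. k x *\<^sub>C y)"
      by (induct qs) (auto simp: cvec.scale_right_distrib k_def)
    ultimately have b: "b = - (\<Sum>(x, y)\<leftarrow>qs. k x *\<^sub>C y)"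
      using f0(2) by (simp add: cvec.scale_right_distrib eq_neg_iff_add_eq_0)
    \<comment> \<open>Inserting the expression for b moves a multiple of a into each remaining first
      component.\<close>
    define rs where "rs = map (\<lambda>(x, y). (x - k x *\<^sub>C a, y)) qs"
    have lin1: "T (x - c *\<^sub>C y) = T x - c *\<^sub>C T y"
      if "clinear T" for T :: "'a \<Rightarrow> 'c::complex_vector" and x y c
      using module_hom.diff[of scaleC scaleC T] module_hom.scale[of scaleC scaleC T] that
      by (simp add: Vector_Spaces.module_hom_eq_linear)
    \<comment> \<open>A general bilinear \<open>T\<close> is taken because the old and new lists are
      compared both for the tensor product and for each functional in \<open>\<Phi>\<close>.\<close>
    have expand: "(\<Sum>(x, y)\<leftarrow>rs. T x y) = (\<Sum>(x, y)\<leftarrow>qs. T x y) + T a b"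
      if T: "cbilinear T" for T :: "'a \<Rightarrow> 'b \<Rightarrow> 'c::complex_vector"
    proof -
      have T1: "clinear (\<lambda>x. T x y)" "clinear (T x)" for x y using T by (auto simp: cbilinear_def)
      have sum: "(\<Sum>(x, y)\<leftarrow>rs. T x y) = (\<Sum>(x, y)\<leftarrow>qs. T x y) - (\<Sum>(x, y)\<leftarrow>qs. k x *\<^sub>C T a y)"
        unfolding rs_def by (induct qs) (auto simp: lin1[OF T1(1)] algebra_simps)
      have Tk: "T a (\<Sum>(x, y)\<leftarrow>qs. k x *\<^sub>C y) = (\<Sum>(x, y)\<leftarrow>qs. k x *\<^sub>C T a y)"
      proof (induct qs)
        case Nil
        show ?case using T1(2)[of a] by simp (metis clinear_iff cvec.scale_zero_left)
      next
        case (Cons q qs)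
        then show ?case using T1(2)[of a] by (auto simp: clinear_iff split: prod.split)
      qed
      have "T a (- z) = - T a z" for z
        using T1(2)[of a] by (metis clinear_iff cvec.scale_minus_left cvec.scale_one)
      then have "T a b = - (\<Sum>(x, y)\<leftarrow>qs. k x *\<^sub>C T a y)" unfolding b Tk[symmetric] by simp
      then show ?thesis using sum by simp
    qed
    have "(\<Sum>(x, y)\<leftarrow>rs. x \<otimes> y) = 0"
    proof (rule Suc.hyps(1))
      show "n = length rs" by (simp add: rs_def ps)
      fix f assume f: "f \<in> \<Phi>"
      have "cbilinear (\<lambda>x y. f x *\<^sub>C (y::'b))"
        using lin[OF f] unfolding cbilinear_def clinear_iff
        by (simp add: cvec.scale_left_distrib cvec.scale_right_distrib mult.commute)
      from expand[OF this] show "(\<Sum>(x, y)\<leftarrow>rs. f x *\<^sub>C y) = 0"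
        using Suc.prems[OF f] ps by (simp add: add.commute)
    qed
    then show ?thesis using expand[OF cbilinear_pure] ps by (simp add: add.commute)
  qed
qed simp

text \<open>The criterion for pairs is used twice, first with b \<otimes> c as second component and
  then on b \<otimes> c itself.\<close>

lemma tensor_triple_list_eq_0:
  fixes \<Phi> :: "('a::complex_vector \<Rightarrow> complex) set" and \<Psi> :: "('b::complex_vector \<Rightarrow> complex) set"
    and ts :: "('a \<times> 'b \<times> 'c::complex_vector) list"
  assumes sep: "\<And>x. (\<And>f. f \<in> \<Phi> \<Longrightarrow> f x = 0) \<Longrightarrow> x = 0" "\<And>f. f \<in> \<Phi> \<Longrightarrow> clinear f"
    "\<And>x. (\<And>g. g \<in> \<Psi> \<Longrightarrow> g x = 0) \<Longrightarrow> x = 0" "\<And>g. g \<in> \<Psi> \<Longrightarrow> clinear g"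
    and 0: "\<And>f g. f \<in> \<Phi> \<Longrightarrow> g \<in> \<Psi> \<Longrightarrow> (\<Sum>(a, b, c)\<leftarrow>ts. (f a * g b) *\<^sub>C c) = 0"
  shows "(\<Sum>(a, b, c)\<leftarrow>ts. a \<otimes> (b \<otimes> c)) = 0"
proof -
  have "(\<Sum>(a, d)\<leftarrow>map (\<lambda>(a, b, c). (a, b \<otimes> c)) ts. a \<otimes> d) = 0"
  proof (rule tensor_list_eq_0[OF sep(1,2)])
    fix f assume f: "f \<in> \<Phi>"
    have "(\<Sum>(b, c)\<leftarrow>map (\<lambda>(a, b, c). (f a *\<^sub>C b, c)) ts. b \<otimes> c) = 0"
    proof (rule tensor_list_eq_0[OF sep(3,4)])
      fix g assume g: "g \<in> \<Psi>"
      have "g (z *\<^sub>C x) = z * g x" for z x using sep(4)[OF g] unfolding clinear_iff by simp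
      then show "(\<Sum>(b, c)\<leftarrow>map (\<lambda>(a, b, c). (f a *\<^sub>C b, c)) ts. g b *\<^sub>C c) = 0"
        using 0[OF f g] by (simp add: o_def case_prod_unfold)
    qed
    then show "(\<Sum>(a, d)\<leftarrow>map (\<lambda>(a, b, c). (a, b \<otimes> c)) ts. f a *\<^sub>C d) = 0"
      by (simp add: o_def case_prod_unfold pure_add_scale)
  qed
  then show ?thesis by (simp add: o_def case_prod_unfold)
qed

text \<open>The matrix coefficients of operators, each at one power of x.\<close>

definition laurent_functionals :: "('v::complex_vector laurent_hom \<Rightarrow> complex) set" where
  "laurent_functionals = {\<lambda>a. \<phi> (laurent_apply a u $$ m) |\<phi> u m. clinear \<phi>}"

lemma laurent_functionals_separate:
  assumes "\<And>f. f \<in> laurent_functionals \<Longrightarrow> f a = 0" shows "a = 0"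
proof (rule laurent_hom_eqI)
  fix u
  have "laurent_apply a u $$ m = 0" for m
    by (rule separating_functional) (use assms in \<open>auto simp: laurent_functionals_def\<close>)
  then show "laurent_apply a u = laurent_apply 0 u" by (simp add: fls_eq_iff)
qed

lemma laurent_functionals_linear: "f \<in> laurent_functionals \<Longrightarrow> clinear f"
  unfolding laurent_functionals_def clinear_iff by auto

section \<open>Functionals on series and decomposition into pure tensors\<close>

definition fls_functional :: "('v::complex_vector \<Rightarrow> complex) \<Rightarrow> 'v fls \<Rightarrow> complex fls" where
  "fls_functional \<phi> \<alpha> = Abs_fls (\<lambda>n. \<phi> (\<alpha> $$ n))"

lemma fls_functional_nth:
  assumes "clinear \<phi>" shows "fls_functional \<phi> \<alpha> $$ n = \<phi> (\<alpha> $$ n)"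
proof -
  have "\<phi> 0 = 0" using assms by (metis clinear_iff cvec.scale_zero_left)
  then show ?thesis
    unfolding fls_functional_def
    by (subst nth_Abs_fls_lower_bound[where N = "fls_subdegree \<alpha>"]) auto
qed

lemma fls_functional_simps:
  assumes "clinear \<phi>"
  shows "fls_functional \<phi> (\<alpha> + \<beta>) = fls_functional \<phi> \<alpha> + fls_functional \<phi> \<beta>"
    "fls_functional \<phi> (c *\<^sub>C \<alpha>) = fls_const c * fls_functional \<phi> \<alpha>"
    "fls_functional \<phi> (fls_pure f u) = fls_const (\<phi> u) * f"
  using assms unfolding clinear_iff by (simp_all add: fls_eq_iff fls_functional_nth[OF assms])

lemma fls_scaleC_eq: "c *\<^sub>C f = fls_const c * (f :: complex fls)"
  by (simp add: fls_eq_iff)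

lemma shift_coeff_const_mult:
  "shift_coeff j (fls_const c * f) = fls_const c * shift_coeff j f"
  "shift_coeff j (f * fls_const c) = fls_const c * shift_coeff j f"
  by (simp_all add: fls_eq_iff)

text \<open>A fixed choice of decomposition, so that one list of pure triples serves both for
  products of vertex operators and for products of scalar series.\<close>

definition pure_decomp :: "'v::complex_vector fls \<Rightarrow> (complex fls \<times> 'v) list" where
  "pure_decomp \<alpha> = (SOME xs. \<alpha> = (\<Sum>x\<leftarrow>xs. fls_pure (fst x) (snd x)))"

lemma pure_decomp:
  assumes "\<alpha> \<in> W" shows "\<alpha> = (\<Sum>x\<leftarrow>pure_decomp \<alpha>. fls_pure (fst x) (snd x))"
proof -
  have "\<exists>xs. \<alpha> = (\<Sum>x\<leftarrow>xs. fls_pure (fst x) (snd x))"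
    using assms
  proof (induct rule: laurent_tensor_induct)
    case zero
    show ?case by (rule exI[of _ "[]"]) simp
  next
    case (add f v g)
    then obtain xs where "g = (\<Sum>x\<leftarrow>xs. fls_pure (fst x) (snd x))" by blast
    then show ?case by (intro exI[of _ "(f, v) # xs"]) simp
  qed
  then show ?thesis unfolding pure_decomp_def by (rule someI_ex)
qed

lemma trilinear_decomp:
  fixes T :: "'v::complex_vector fls \<Rightarrow> 'v fls \<Rightarrow> 'v fls \<Rightarrow> 'b::complex_vector"
  assumes W: "\<alpha> \<in> W" "\<beta> \<in> W" "\<gamma> \<in> W"
    and T: "\<And>\<beta> \<gamma>. \<beta> \<in> W \<Longrightarrow> \<gamma> \<in> W \<Longrightarrow> clinear_on W (\<lambda>\<alpha>. T \<alpha> \<beta> \<gamma>)"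
      "\<And>\<alpha> \<gamma>. \<alpha> \<in> W \<Longrightarrow> \<gamma> \<in> W \<Longrightarrow> clinear_on W (\<lambda>\<beta>. T \<alpha> \<beta> \<gamma>)"
      "\<And>\<alpha> \<beta>. \<alpha> \<in> W \<Longrightarrow> \<beta> \<in> W \<Longrightarrow> clinear_on W (\<lambda>\<gamma>. T \<alpha> \<beta> \<gamma>)"
  shows "T \<alpha> \<beta> \<gamma> = (\<Sum>x\<leftarrow>pure_decomp \<alpha>. \<Sum>y\<leftarrow>pure_decomp \<beta>. \<Sum>z\<leftarrow>pure_decomp \<gamma>.
     T (fls_pure (fst x) (snd x)) (fls_pure (fst y) (snd y)) (fls_pure (fst z) (snd z)))"
proof -
  let ?p = "\<lambda>x. fls_pure (fst x) (snd x)"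
  have 1: "T \<alpha> \<beta> \<gamma> = (\<Sum>x\<leftarrow>pure_decomp \<alpha>. T (?p x) \<beta> \<gamma>)"
    by (subst (1) pure_decomp[OF W(1)])
       (rule clinear_on_sum_list[OF subspace_laurent_tensor T(1)[OF W(2,3)]], simp)
  have 2: "T (?p x) \<beta> \<gamma> = (\<Sum>y\<leftarrow>pure_decomp \<beta>. T (?p x) (?p y) \<gamma>)" for x
    by (subst (1) pure_decomp[OF W(2)])
       (rule clinear_on_sum_list[OF subspace_laurent_tensor T(2)[OF laurent_tensor_pure W(3)]], simp)
  have 3: "T (?p x) (?p y) \<gamma> = (\<Sum>z\<leftarrow>pure_decomp \<gamma>. T (?p x) (?p y) (?p z))" for x y
    by (subst (1) pure_decomp[OF W(3)])
       (rule clinear_on_sum_list[OF subspace_laurent_tensor T(3)[OF laurent_tensor_pure laurent_tensor_pure]], simp)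
  show ?thesis unfolding 1 2 3 ..
qed

lemma sum_list_concat_map:
  "sum_list (map g (concat (map h xs))) = (\<Sum>x\<leftarrow>xs. sum_list (map g (h x)))"
  by (induct xs) auto

definition pure_triples ::
  "'v::complex_vector fls \<Rightarrow> 'v fls \<Rightarrow> 'v fls \<Rightarrow> (complex fls \<times> 'v) list list" where
  "pure_triples \<alpha> \<beta> \<gamma> = concat (map (\<lambda>x. concat (map (\<lambda>y. map (\<lambda>z. [x, y, z])
      (pure_decomp \<gamma>)) (pure_decomp \<beta>))) (pure_decomp \<alpha>))"

lemma sum_pure_triples:
  fixes T :: "'v::complex_vector fls \<Rightarrow> 'v fls \<Rightarrow> 'v fls \<Rightarrow> 'b::complex_vector"
  assumes W: "\<And>i. i \<in> set ts \<Longrightarrow> \<alpha> i \<in> W \<and> \<beta> i \<in> W \<and> \<gamma> i \<in> W"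
    and T: "\<And>\<beta> \<gamma>. \<beta> \<in> W \<Longrightarrow> \<gamma> \<in> W \<Longrightarrow> clinear_on W (\<lambda>\<alpha>. T \<alpha> \<beta> \<gamma>)"
      "\<And>\<alpha> \<gamma>. \<alpha> \<in> W \<Longrightarrow> \<gamma> \<in> W \<Longrightarrow> clinear_on W (\<lambda>\<beta>. T \<alpha> \<beta> \<gamma>)"
      "\<And>\<alpha> \<beta>. \<alpha> \<in> W \<Longrightarrow> \<beta> \<in> W \<Longrightarrow> clinear_on W (\<lambda>\<gamma>. T \<alpha> \<beta> \<gamma>)"
    and g: "\<And>x y z. T (fls_pure (fst x) (snd x)) (fls_pure (fst y) (snd y)) (fls_pure (fst z) (snd z)) = g [x, y, z]"
  shows "(\<Sum>i\<leftarrow>ts. T (\<alpha> i) (\<beta> i) (\<gamma> i))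
    = (\<Sum>xs\<leftarrow>concat (map (\<lambda>i. pure_triples (\<alpha> i) (\<beta> i) (\<gamma> i)) ts). g xs)"
proof -
  have "T \<alpha> \<beta> \<gamma> = (\<Sum>xs\<leftarrow>pure_triples \<alpha> \<beta> \<gamma>. g xs)" if "\<alpha> \<in> W" "\<beta> \<in> W" "\<gamma> \<in> W" for \<alpha> \<beta> \<gamma>
  proof -
    note trilinear_decomp[where T = T, OF that T]
    then show ?thesis by (simp add: pure_triples_def sum_list_concat_map o_def g)
  qed
  then show ?thesis
    unfolding sum_list_concat_map using W by (intro arg_cong[where f = sum_list] map_cong) auto
qed

lemma shift_coeff_products_list_eq_0:
  assumes "\<And>j. (\<Sum>i\<leftarrow>ts. shift_coeff j (f i) * g i) = 0"
  shows "(\<Sum>i\<leftarrow>ts. fls_const (f i $$ m) * g i) = 0"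
  using shift_coeff_products_eq_0[of "{0..<length ts}" "\<lambda>k. f (ts ! k)" "\<lambda>k. g (ts ! k)" m] assms
  by (simp add: sum_list_sum_nth)

context nonlocal_vertex_algebra
begin

text \<open>With pure entries the hypothesis concerns three vertex operators on the vacuum, so
  nondegeneracy in degree 3 applies. It makes sums of f(x - y_1) g(x - y_2) h(x - y_3) vanish, from
  which the coefficients are separated one factor at a time.\<close>

lemma nested_vac_sum_eq_0:
  fixes \<phi>1 \<phi>2 \<phi>3 :: "'v \<Rightarrow> complex"
  assumes nd: "nondegenerate Y vac"
    and W: "\<And>i. i \<in> set ts \<Longrightarrow> \<alpha> i \<in> W \<and> \<beta> i \<in> W \<and> \<gamma> i \<in> W"
    and 0: "\<And>s t r. (\<Sum>i\<leftarrow>ts. nested (\<alpha> i) (\<beta> i) (Yq Y (\<gamma> i) (fls_const vac) r) s t) = 0"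
    and \<phi>: "clinear \<phi>1" "clinear \<phi>2" "clinear \<phi>3"
  shows "(\<Sum>i\<leftarrow>ts. \<phi>1 (\<alpha> i $$ m1) * (\<phi>2 (\<beta> i $$ m2) * \<phi>3 (\<gamma> i $$ m3))) = 0"
proof -
  define P where "P = concat (map (\<lambda>i. pure_triples (\<alpha> i) (\<beta> i) (\<gamma> i)) ts)"
  have "(\<Sum>xs\<leftarrow>P. Yq_product xs ks) = 0" if len: "length ks = 3" for ks
  proof -
    obtain s t r where ks: "ks = [s, t, r]"
      using len by (auto simp: length_Suc_conv numeral_3_eq_3)
    have "(\<Sum>i\<leftarrow>ts. nested (\<alpha> i) (\<beta> i) (Yq Y (\<gamma> i) (fls_const vac) r) s t) = (\<Sum>xs\<leftarrow>P. Yq_product xs ks)"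
      unfolding P_def
      by (rule sum_pure_triples[OF W, where T = "\<lambda>\<alpha> \<beta> \<gamma>. nested \<alpha> \<beta> (Yq Y \<gamma> (fls_const vac) r) s t"])
         (simp_all add: ks nested_def clinear_on_def Yq_add_left Yq_add_right Yq_scale)
    then show ?thesis using 0 by simp
  qed
  then have Z: "(\<Sum>xs\<leftarrow>P. fls_const (functional_prod [\<phi>1, \<phi>2, \<phi>3] (map snd xs)) * shift_coeffs (map fst xs) js) = 0" for js
    by (intro Yq_product_sum_eq_0[OF nd, of 3]) (use \<phi> in \<open>auto simp: P_def pure_triples_def\<close>)
  let ?f = "\<lambda>i. fls_functional \<phi>1 (\<alpha> i)" and ?g = "\<lambda>i. fls_functional \<phi>2 (\<beta> i)"
    and ?h = "\<lambda>i. fls_functional \<phi>3 (\<gamma> i)"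
  have 1: "(\<Sum>i\<leftarrow>ts. shift_coeff j1 (?f i) * (shift_coeff j2 (?g i) * shift_coeff j3 (?h i))) = 0" for j1 j2 j3
  proof -
    have "(\<Sum>i\<leftarrow>ts. shift_coeff j1 (?f i) * (shift_coeff j2 (?g i) * shift_coeff j3 (?h i)))
       = (\<Sum>xs\<leftarrow>P. fls_const (functional_prod [\<phi>1, \<phi>2, \<phi>3] (map snd xs)) * shift_coeffs (map fst xs) [int j1, int j2, int j3])"
      unfolding P_def
      by (rule sum_pure_triples[OF W, where T = "\<lambda>\<alpha> \<beta> \<gamma>. shift_coeff j1 (fls_functional \<phi>1 \<alpha>)
             * (shift_coeff j2 (fls_functional \<phi>2 \<beta>) * shift_coeff j3 (fls_functional \<phi>3 \<gamma>))"])
         (simp_all add: clinear_on_def fls_functional_simps[OF \<phi>(1)] fls_functional_simps[OF \<phi>(2)]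
           fls_functional_simps[OF \<phi>(3)] shift_coeff_const_mult shift_coeff_add fls_scaleC_eq
           algebra_simps flip: fls_const_mult_const)
    then show ?thesis using Z by simp
  qed
  \<comment> \<open>For fixed j2 and j3 the product of the last two factors takes the place of g in
    \<open>shift_coeff_products_list_eq_0\<close>.\<close>
  have 2: "(\<Sum>i\<leftarrow>ts. fls_const (?f i $$ m1) * (shift_coeff j2 (?g i) * shift_coeff j3 (?h i))) = 0" for j2 j3
    using 1 by (rule shift_coeff_products_list_eq_0)
  have 3: "(\<Sum>i\<leftarrow>ts. fls_const (?g i $$ m2) * (fls_const (?f i $$ m1) * shift_coeff j3 (?h i))) = 0" for j3
    by (rule shift_coeff_products_list_eq_0) (use 2 in \<open>simp add: mult_ac\<close>)
  \<comment> \<open>The third factor is read off at y_3^0, where \<open>shift_coeff\<close> is the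
    identity.\<close>
  from 3[of 0] have "(\<Sum>i\<leftarrow>ts. fls_const (?g i $$ m2) * (fls_const (?f i $$ m1) * ?h i)) $$ m3 = 0"
    by simp
  moreover have "(\<Sum>i\<leftarrow>ts. fls_const (?g i $$ m2) * (fls_const (?f i $$ m1) * ?h i)) $$ m3
     = (\<Sum>i\<leftarrow>ts. \<phi>1 (\<alpha> i $$ m1) * (\<phi>2 (\<beta> i $$ m2) * \<phi>3 (\<gamma> i $$ m3)))"
    by (induct ts) (auto simp: fls_functional_nth \<phi> mult_ac)
  ultimately show ?thesis by simp
qed

end

section \<open>The bialgebra B(V)\<close>

lemma clinear_tensor_assoc:
  "clinear (tensor_assoc :: (('a::complex_vector, 'b::complex_vector) tensor, 'c::complex_vector) tensor \<Rightarrow> _)"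
proof -
  have 1: "cbilinear (\<lambda>(a::'a) (b::'b). a \<otimes> (b \<otimes> c))" for c :: 'c
    by (simp add: cbilinear_def clinear_iff pure_add_scale)
  note lin = clinear_tensor_lift[OF 1]
  have 2: "clinear (\<lambda>c::'c. tensor_lift (\<lambda>(a::'a) (b::'b). a \<otimes> (b \<otimes> c)) s)" for s
  proof (induct s rule: tensor_induct)
    case (pure a b)
    then show ?case unfolding tensor_lift_pure[OF 1] by (simp add: clinear_iff pure_add_scale)
  next
    case (add s t)
    then show ?case
      using lin by (simp add: clinear_iff cvec.scale_right_distrib add_ac)
  qed
  have "cbilinear (\<lambda>s (c::'c). tensor_lift (\<lambda>(a::'a) (b::'b). a \<otimes> (b \<otimes> c)) s)"
    using 2 lin by (simp add: cbilinear_def)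
  then show ?thesis unfolding tensor_assoc_def by (rule clinear_tensor_lift)
qed

lemma clinear_sum_list: "clinear T \<Longrightarrow> T (\<Sum>i\<leftarrow>A. g i) = (\<Sum>i\<leftarrow>A. T (g i))"
  by (rule clinear_on_sum_list[where S = UNIV]) (auto simp: clinear_on_def clinear_iff)

lemma pure_sum_list:
  "(\<Sum>i\<leftarrow>A. g i) \<otimes> b = (\<Sum>i\<leftarrow>A. g i \<otimes> b)" "a \<otimes> (\<Sum>i\<leftarrow>A. h i) = (\<Sum>i\<leftarrow>A. a \<otimes> h i)"
  by (rule clinear_sum_list[of "\<lambda>a. a \<otimes> b"], simp add: clinear_iff pure_add_scale,
      rule clinear_sum_list[of "\<lambda>b. a \<otimes> b"], simp add: clinear_iff pure_add_scale)

lemma tensor_mult_sum_list: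
  fixes ps qs :: "('a::complex_algebra_1 \<times> 'b::complex_algebra_1) list"
  shows "(\<Sum>(a, b)\<leftarrow>ps. a \<otimes> b) * (\<Sum>(c, d)\<leftarrow>qs. c \<otimes> d)
    = (\<Sum>(a, b)\<leftarrow>[(a * c, b * d). (a, b) \<leftarrow> ps, (c, d) \<leftarrow> qs]. a \<otimes> b)"
proof -
  have "(a \<otimes> b) * (\<Sum>(c, d)\<leftarrow>qs. c \<otimes> d) = (\<Sum>(c, d)\<leftarrow>qs. (a * c) \<otimes> (b * d))" for a :: 'a and b :: 'b
    by (induct qs) (auto simp: tensor_distrib tensor_mult_pure)
  then show ?thesis
    by (induct ps) (auto simp: tensor_distrib o_def case_prod_unfold)
qed

lemma lext_ddx:
  "\<alpha> \<in> W \<Longrightarrow> fls_ddx (lext a \<alpha>) = lext (laurent_ddx a) \<alpha> + lext a (fls_ddx \<alpha>)"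
proof (induct rule: laurent_tensor_induct)
  case (add f v g)
  have "fls_ddx (lext a (fls_pure f v)) = lext (laurent_ddx a) (fls_pure f v) + lext a (fls_ddx (fls_pure f v))"
    by (simp add: laurent_extend_pure[OF laurent_apply_clinear] fls_ddx_module fls_ddx_pure
        laurent_apply_ddx add.commute)
  with add show ?case
    by (simp add: lext_add fls_ddx_add laurent_tensor_ddx)
qed simp

lemma laurent_ddx_mult: "laurent_ddx (a * b) = laurent_ddx a * b + a * laurent_ddx b"
  by (rule laurent_hom_eqI) (simp add: laurent_apply_ddx laurent_apply_mult lext_ddx)

lemma laurent_ddx_linear: "laurent_ddx (a + b) = laurent_ddx a + laurent_ddx b"
  "laurent_ddx (c *\<^sub>C a) = c *\<^sub>C laurent_ddx a"
  by (rule laurent_hom_eqI, simp add: laurent_apply_ddx fls_ddx_add fls_ddx_scale)+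

definition vac_eigen :: "'v::complex_vector \<Rightarrow> 'v laurent_hom \<Rightarrow> bool" where
  "vac_eigen vac a \<longleftrightarrow> (\<exists>c. laurent_apply a vac = fls_const (c *\<^sub>C vac))"

lemma fls_const_scaleC: "fls_const (c *\<^sub>C v) = c *\<^sub>C fls_const v"
  by (auto simp: fls_eq_iff)

lemma fls_const_add: "fls_const (u + v) = fls_const u + fls_const v"
  by (auto simp: fls_eq_iff)

lemma vac_eigen_span:
  assumes "\<And>a. a \<in> S \<Longrightarrow> vac_eigen vac a" "a \<in> cvec.span S" shows "vac_eigen vac a"
  using assms(2)
proof (induct rule: cvec.span_induct_alt)
  case base
  show ?case unfolding vac_eigen_def by (rule exI[of _ 0]) simp
next
  case (step c x y)
  then obtain d e where "laurent_apply x vac = d *\<^sub>C fls_const vac" "laurent_apply y vac = e *\<^sub>C fls_const vac"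
    using assms(1) unfolding vac_eigen_def fls_const_scaleC by blast
  then have "laurent_apply (c *\<^sub>C x + y) vac = fls_const ((c * d + e) *\<^sub>C vac)"
    by (simp add: fls_const_scaleC fls_const_add cvec.scale_left_distrib)
  then show ?case unfolding vac_eigen_def ..
qed

section \<open>Membership in B(V) and its closure properties\<close>

context nonlocal_vertex_algebra
begin

abbreviation B :: "'v laurent_hom set" where "B \<equiv> B_space Y vac"

lemma coproduct_span:
  assumes S: "\<And>a. a \<in> S \<Longrightarrow> \<exists>ps. set ps \<subseteq> T \<times> T \<and> coproduct_identity Y a ps"
    and T: "cvec.subspace T" and "a \<in> cvec.span S"
  shows "\<exists>ps. set ps \<subseteq> T \<times> T \<and> coproduct_identity Y a ps"
  using assms(3)
proof (induct rule: cvec.span_induct_alt)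
  case base
  show ?case using coproduct_identity_zero by (intro exI[of _ "[]"]) simp
next
  case (step c x y)
  obtain ps where ps: "set ps \<subseteq> T \<times> T" "coproduct_identity Y x ps" using S[OF step(1)] by blast
  obtain qs where qs: "set qs \<subseteq> T \<times> T" "coproduct_identity Y y qs" using step by blast
  have "set (map (\<lambda>(a, b). (c *\<^sub>C a, b)) ps @ qs) \<subseteq> T \<times> T"
    using ps(1) qs(1) cvec.subspace_scale[OF T] by auto
  then show ?case
    using coproduct_identity_add[OF coproduct_identity_scale[OF ps(2)] qs(2)] by blast
qed

text \<open>Both conditions in the definition of \<open>B_space\<close> pass from generators to
  their span, so it suffices to check them on \<open>S\<close>.\<close>

lemma B_spaceI:
  assumes "\<And>a. a \<in> S \<Longrightarrow> \<exists>ps. set ps \<subseteq> cvec.span S \<times> cvec.span S \<and> coproduct_identity Y a ps"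
    and "\<And>a. a \<in> S \<Longrightarrow> vac_eigen vac a"
  shows "S \<subseteq> B"
proof -
  have "Delta_closed Y (cvec.span S)"
    unfolding Delta_closed_def using coproduct_span[OF assms(1) cvec.subspace_span] by blast
  moreover have "\<forall>a\<in>cvec.span S. \<exists>c. laurent_apply a vac = fls_const (c *\<^sub>C vac)"
    using vac_eigen_span[of S vac] assms(2) by (auto simp: vac_eigen_def)
  ultimately have "cvec.span S \<subseteq> \<Union>{U. cvec.subspace U \<and> Delta_closed Y U \<and>
     (\<forall>a\<in>U. \<exists>c. laurent_apply a vac = fls_const (c *\<^sub>C vac))}"
    by (intro Union_upper) simp
  then have "cvec.span S \<subseteq> B"
    unfolding B_space_def using cvec.span_superset by (rule order_trans)
  with cvec.span_superset show ?thesis by (rule order_trans)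
qed

lemma subspace_B: "cvec.subspace B"
  by (simp add: B_space_def)

text \<open>Each subspace in the definition has its coproducts in itself and lies in
  \<open>B\<close>; the property passes to their sum by \<open>coproduct_span\<close>.\<close>

lemma B_coproduct:
  assumes "a \<in> B" shows "\<exists>ps. set ps \<subseteq> B \<times> B \<and> coproduct_identity Y a ps"
proof (rule coproduct_span[OF _ subspace_B assms[unfolded B_space_def]])
  fix a assume "a \<in> \<Union>{U. cvec.subspace U \<and> Delta_closed Y U \<and>
     (\<forall>a\<in>U. \<exists>c. laurent_apply a vac = fls_const (c *\<^sub>C vac))}"
  then obtain U where U: "a \<in> U" "U \<in> {U. cvec.subspace U \<and> Delta_closed Y U \<and>
     (\<forall>a\<in>U. \<exists>c. laurent_apply a vac = fls_const (c *\<^sub>C vac))}" by blast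
  then have "U \<subseteq> B" unfolding B_space_def by (blast intro: cvec.span_base)
  moreover obtain ps where "set ps \<subseteq> U \<times> U" "coproduct_identity Y a ps"
    using U by (auto simp: Delta_closed_def)
  ultimately show "\<exists>ps. set ps \<subseteq> B \<times> B \<and> coproduct_identity Y a ps" by blast
qed

lemma B_vac_eigen:
  assumes "a \<in> B" shows "vac_eigen vac a"
  by (rule vac_eigen_span[OF _ assms[unfolded B_space_def]]) (auto simp: vac_eigen_def)

lemma B_one: "1 \<in> B"
proof -
  have "{1} \<subseteq> B"
  proof (rule B_spaceI)
    show "\<exists>ps. set ps \<subseteq> cvec.span {1} \<times> cvec.span {1} \<and> coproduct_identity Y a ps" if "a \<in> {1}" for a
      using that coproduct_identity_one by (intro exI[of _ "[(1, 1)]"]) (auto intro: cvec.span_base)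
    show "vac_eigen vac a" if "a \<in> {1}" for a
      using that by (auto simp: vac_eigen_def intro: exI[of _ 1])
  qed
  then show ?thesis by simp
qed

text \<open>The coproduct components of a product are again products, so the set of all products
  satisfies \<open>B_spaceI\<close>.\<close>

lemma B_mult:
  assumes "a \<in> B" "b \<in> B" shows "a * b \<in> B"
proof -
  have "{a * b |a b. a \<in> B \<and> b \<in> B} \<subseteq> B" (is "?S \<subseteq> B")
  proof (rule B_spaceI)
    fix x assume "x \<in> ?S"
    then obtain a b where x: "x = a * b" "a \<in> B" "b \<in> B" by blast
    obtain ps where ps: "set ps \<subseteq> B \<times> B" "coproduct_identity Y a ps" using B_coproduct[OF x(2)] by blast
    obtain qs where qs: "set qs \<subseteq> B \<times> B" "coproduct_identity Y b qs" using B_coproduct[OF x(3)] by blast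
    have "set [(b1 * c1, b2 * c2). (b1, b2) \<leftarrow> ps, (c1, c2) \<leftarrow> qs] \<subseteq> ?S \<times> ?S"
      using ps(1) qs(1) by fastforce
    also have "\<dots> \<subseteq> cvec.span ?S \<times> cvec.span ?S"
      using cvec.span_superset by (rule Sigma_mono) (rule cvec.span_superset)
    finally show "\<exists>ps. set ps \<subseteq> cvec.span ?S \<times> cvec.span ?S \<and> coproduct_identity Y x ps"
      using coproduct_identity_mult[OF ps(2) qs(2)] unfolding x(1) by blast
    obtain c d where "laurent_apply a vac = fls_const (c *\<^sub>C vac)" "laurent_apply b vac = fls_const (d *\<^sub>C vac)"
      using B_vac_eigen[OF x(2)] B_vac_eigen[OF x(3)] by (auto simp: vac_eigen_def)
    then have "laurent_apply x vac = d *\<^sub>C fls_const (c *\<^sub>C vac)"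
      by (simp add: x laurent_apply_mult)
    then have "laurent_apply x vac = fls_const ((d * c) *\<^sub>C vac)"
      by (simp add: fls_const_scaleC)
    then show "vac_eigen vac x" unfolding vac_eigen_def ..
  qed
  then show ?thesis using assms by blast
qed

lemma vac_eigen_ddx: "vac_eigen vac a \<Longrightarrow> laurent_apply (laurent_ddx a) vac = 0"
  by (auto simp: vac_eigen_def laurent_apply_ddx fls_ddx_const)

lemma coproduct_ddx_subset:
  assumes "set ps \<subseteq> B \<times> B" "B \<subseteq> S" "laurent_ddx ` B \<subseteq> S"
  shows "set (map (\<lambda>(b, c). (laurent_ddx b, c)) ps @ map (\<lambda>(b, c). (b, laurent_ddx c)) ps) \<subseteq> S \<times> S"
  using assms(1) by (induct ps) (use assms(2,3) in auto)

text \<open>The coproduct of a derivative has components in \<open>B\<close> and in its image under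
  the derivation, so the test is made on their union.\<close>

lemma B_ddx:
  assumes "a \<in> B" shows "laurent_ddx a \<in> B"
proof -
  have "B \<union> laurent_ddx ` B \<subseteq> B" (is "?S \<subseteq> B")
  proof (rule B_spaceI)
    fix x assume "x \<in> ?S"
    then consider "x \<in> B" | a where "x = laurent_ddx a" "a \<in> B" by blast
    then show "\<exists>ps. set ps \<subseteq> cvec.span ?S \<times> cvec.span ?S \<and> coproduct_identity Y x ps"
    proof cases
      case 1
      then show ?thesis using B_coproduct[OF 1] cvec.span_superset[of ?S] by blast
    next
      case 2
      obtain ps where ps: "set ps \<subseteq> B \<times> B" "coproduct_identity Y a ps" using B_coproduct[OF 2(2)] by blast
      show ?thesis
        unfolding 2(1)
        by (intro exI conjI, rule coproduct_ddx_subset[OF ps(1)])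
           (use cvec.span_superset[of ?S] coproduct_identity_ddx[OF ps(2)] in auto)
    qed
    show "vac_eigen vac x" using \<open>x \<in> ?S\<close> B_vac_eigen
      by (auto simp: vac_eigen_ddx vac_eigen_def[of vac "laurent_ddx _"] intro: exI[of _ 0])
  qed
  then show ?thesis using assms by blast
qed

text \<open>The entry 1 in the first slot leaves Y(v,x_2) in front of the operator, so the pair (1,
  \<psi>) is the second half of the commutator, moved to the other side.\<close>

lemma PDer_iff: "\<psi> \<in> PDer Y \<longleftrightarrow> coproduct_identity Y \<psi> [(\<psi>, 1), (1, \<psi>)]"
proof -
  have "Y_shifted_series Y (laurent_apply \<psi> v) (fls_const w) p q = Y_shifted Y (laurent_apply \<psi> v) w p q"
    "Y_shifted_series Y (fls_const v) (laurent_apply \<psi> w) p q = Y_apply Y \<psi> v w p q" for v w p q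
    using Yq_const_right[of "laurent_apply \<psi> v" w q p] Yq_const_left[of "laurent_apply \<psi> w" v q p]
    by (simp_all add: Yq_nth Y_apply_def)
  then show ?thesis by (simp add: PDer_def coproduct_identity_def diff_eq_eq)
qed

text \<open>At v = w = 1 and x_2^0 the identity says that the value on the vacuum equals twice
  itself.\<close>

lemma PDer_vac:
  assumes "\<psi> \<in> PDer Y" shows "laurent_apply \<psi> vac = 0"
proof -
  have "lext \<psi> (Yq Y (fls_const vac) (fls_const vac) 0)
      = Yq Y (laurent_apply \<psi> vac) (fls_const vac) 0 + Yq Y (fls_const vac) (laurent_apply \<psi> vac) 0"
    using assms unfolding PDer_iff coproduct_identity_iff by simp
  then show ?thesis by (simp add: Yq_vac_right Yq_vac_left)
qed

lemma PDer_subset: "PDer Y \<subseteq> B"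
proof
  fix \<psi> assume \<psi>: "\<psi> \<in> PDer Y"
  have "{1, \<psi>} \<subseteq> B"
  proof (rule B_spaceI)
    show "\<exists>ps. set ps \<subseteq> cvec.span {1, \<psi>} \<times> cvec.span {1, \<psi>} \<and> coproduct_identity Y a ps" if "a \<in> {1, \<psi>}" for a
    proof (cases "a = \<psi>")
      case True
      then show ?thesis using \<psi>[unfolded PDer_iff]
        by (intro exI[of _ "[(\<psi>, 1), (1, \<psi>)]"]) (auto intro: cvec.span_base)
    next
      case False
      then show ?thesis using that coproduct_identity_one
        by (intro exI[of _ "[(1, 1)]"]) (auto intro: cvec.span_base)
    qed
    show "vac_eigen vac a" if "a \<in> {1, \<psi>}" for a
      using that PDer_vac[OF \<psi>] by (auto simp: vac_eigen_def intro: exI[of _ 1] exI[of _ 0])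
  qed
  then show "\<psi> \<in> B" by simp
qed

lemma PEnd_iff:
  "\<phi> \<in> PEnd Y vac \<longleftrightarrow> laurent_apply \<phi> vac = fls_const vac \<and> coproduct_identity Y \<phi> [(\<phi>, \<phi>)]"
  by (simp add: PEnd_def coproduct_identity_def)

lemma PEnd_subset: "PEnd Y vac \<subseteq> B"
proof
  fix \<phi> assume \<phi>: "\<phi> \<in> PEnd Y vac"
  have "{\<phi>} \<subseteq> B"
  proof (rule B_spaceI)
    show "\<exists>ps. set ps \<subseteq> cvec.span {\<phi>} \<times> cvec.span {\<phi>} \<and> coproduct_identity Y a ps" if "a \<in> {\<phi>}" for a
      using that \<phi>[unfolded PEnd_iff]
      by (intro exI[of _ "[(\<phi>, \<phi>)]"]) (auto intro: cvec.span_base)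
    show "vac_eigen vac a" if "a \<in> {\<phi>}" for a
      using that \<phi> by (auto simp: PEnd_iff vac_eigen_def intro: exI[of _ 1])
  qed
  then show "\<phi> \<in> B" by simp
qed

text \<open>The right-hand side of the identity is bilinear in (b, c) and so depends on the tensor
  only. This recovers an identity from an equation for the comultiplication.\<close>

lemma coproduct_identity_tensor:
  assumes "coproduct_identity Y a ps" "(\<Sum>(b, c)\<leftarrow>ps. b \<otimes> c) = (\<Sum>(b, c)\<leftarrow>qs. b \<otimes> c)"
  shows "coproduct_identity Y a qs"
proof -
  have "cbilinear (\<lambda>b c. Yq Y (laurent_apply b v) (laurent_apply c w) q)" for v w q
    by (simp add: cbilinear_def clinear_iff Yq_add_left Yq_add_right Yq_scale)
  note tensor_lift_sum[OF this]
  then show ?thesis using assms unfolding coproduct_identity_iff by metis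
qed

text \<open>The scalar is unique once the vacuum is nonzero; see \<open>counit_eqI\<close>.\<close>

definition counit :: "'v laurent_hom \<Rightarrow> complex" where
  "counit a = (SOME c. laurent_apply a vac = fls_const (c *\<^sub>C vac))"

lemma counit: "a \<in> B \<Longrightarrow> laurent_apply a vac = fls_const (counit a *\<^sub>C vac)"
  unfolding counit_def by (rule someI_ex) (use B_vac_eigen in \<open>simp add: vac_eigen_def\<close>)

text \<open>This makes nondegeneracy applicable: an operator acting on $w$ is evaluated on the coefficients
  of $Y(v, y)1$, where it becomes one more vertex operator applied to the vacuum.\<close>

lemma lext_Y_vac:
  assumes "c \<in> B"
  shows "laurent_apply c (Y v vac $$ r) = Yq Y (laurent_apply c v) (fls_const vac) r"
proof -
  obtain ps where ps: "set ps \<subseteq> B \<times> B" "coproduct_identity Y c ps" using B_coproduct[OF assms] by blast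
  have "laurent_apply c (Y v vac $$ r) = (\<Sum>(b, d)\<leftarrow>ps. Yq Y (laurent_apply b v) (laurent_apply d vac) r)"
    using ps(2) by (simp add: coproduct_identity_iff Yq_const)
  also have "\<dots> = (\<Sum>(b, d)\<leftarrow>ps. Yq Y (laurent_apply (counit d *\<^sub>C b) v) (fls_const vac) r)"
    by (rule arg_cong[where f = sum_list], rule map_cong)
       (use ps(1) counit in \<open>auto simp: fls_const_scaleC Yq_scale\<close>)
  also have "\<dots> = Yq Y (\<Sum>i\<leftarrow>ps. laurent_apply (counit (snd i) *\<^sub>C fst i) v) (fls_const vac) r"
    unfolding case_prod_unfold
    by (rule clinear_on_sum_list[OF subspace_laurent_tensor Yq_linear_on(1), symmetric]) (simp_all add: W_scale)
  also have "(\<Sum>i\<leftarrow>ps. laurent_apply (counit (snd i) *\<^sub>C fst i) v) = laurent_apply (\<Sum>(b, d)\<leftarrow>ps. counit d *\<^sub>C b) v"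
    by (simp add: laurent_apply_sum_list case_prod_unfold)
  also have "(\<Sum>(b, d)\<leftarrow>ps. counit d *\<^sub>C b) = c"
    by (rule counit_law_right[OF ps(2)]) (use ps(1) counit in blast)
  finally show ?thesis .
qed

end

section \<open>Uniqueness of the coproduct and the bialgebra structure\<close>

locale nondegenerate_vertex_algebra = nonlocal_vertex_algebra +
  assumes nondeg: "nondegenerate Y vac" and nontrivial: "\<exists>v::'a. v \<noteq> 0"
begin

text \<open>If the vacuum were 0, then Y(1,x) = 1 would force V = 0. Over the zero space the element
  1 of \<open>B\<close> is 0, and no linear counit could send it to 1.\<close>

lemma vac_nonzero: "vac \<noteq> 0"
proof
  assume "vac = 0"
  then have "fls_const w = (0 :: 'a fls)" for w using vacuum[of w] by simp
  then show False using nontrivial by (metis fls_const_nonzero)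
qed

lemma counit_eqI: "laurent_apply a vac = fls_const (c *\<^sub>C vac) \<Longrightarrow> counit a = c"
proof -
  assume a: "laurent_apply a vac = fls_const (c *\<^sub>C vac)"
  then have "laurent_apply a vac = fls_const (counit a *\<^sub>C vac)"
    unfolding counit_def by (rule someI)
  then have "fls_const (counit a *\<^sub>C vac) $$ 0 = fls_const (c *\<^sub>C vac) $$ 0"
    using a by simp
  then have "(counit a - c) *\<^sub>C vac = 0"
    by (simp add: cvec.scale_left_diff_distrib)
  then show ?thesis using vac_nonzero by simp
qed

text \<open>The vectors w are specialised to the coefficients of Y(w,y)1. By
  \<open>lext_Y_vac\<close> the third component becomes one more vertex operator on the vacuum,
  which makes matrix coefficients available in all three positions.\<close>

lemma triple_list_eq_0:
  assumes ts: "set ts \<subseteq> B \<times> B \<times> B"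
    and 0: "\<And>u v w s t. (\<Sum>(a, b, c)\<leftarrow>ts. nested (laurent_apply a u) (laurent_apply b v) (laurent_apply c w) s t) = 0"
  shows "(\<Sum>(a, b, c)\<leftarrow>ts. a \<otimes> (b \<otimes> c)) = 0"
proof (rule tensor_triple_list_eq_0[OF laurent_functionals_separate laurent_functionals_linear
        laurent_functionals_separate laurent_functionals_linear])
  fix f g :: "'a laurent_hom \<Rightarrow> complex" assume fg: "f \<in> laurent_functionals" "g \<in> laurent_functionals"
  show "(\<Sum>(a, b, c)\<leftarrow>ts. (f a * g b) *\<^sub>C c) = 0"
  proof (rule laurent_functionals_separate)
    fix h :: "'a laurent_hom \<Rightarrow> complex" assume h: "h \<in> laurent_functionals"
    obtain \<phi>1 u m1 where f: "f = (\<lambda>a. \<phi>1 (laurent_apply a u $$ m1))" "clinear \<phi>1"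
      using fg(1) by (auto simp: laurent_functionals_def)
    obtain \<phi>2 v m2 where g: "g = (\<lambda>a. \<phi>2 (laurent_apply a v $$ m2))" "clinear \<phi>2"
      using fg(2) by (auto simp: laurent_functionals_def)
    obtain \<phi>3 w m3 where h': "h = (\<lambda>a. \<phi>3 (laurent_apply a w $$ m3))" "clinear \<phi>3"
      using h by (auto simp: laurent_functionals_def)
    have "(\<Sum>i\<leftarrow>ts. nested (laurent_apply (fst i) u) (laurent_apply (fst (snd i)) v)
        (Yq Y (laurent_apply (snd (snd i)) w) (fls_const vac) r) s t) = 0" for s t r
    proof -
      have "(\<Sum>i\<leftarrow>ts. nested (laurent_apply (fst i) u) (laurent_apply (fst (snd i)) v)
        (Yq Y (laurent_apply (snd (snd i)) w) (fls_const vac) r) s t)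
        = (\<Sum>(a, b, c)\<leftarrow>ts. nested (laurent_apply a u) (laurent_apply b v) (laurent_apply c (Y w vac $$ r)) s t)"
        by (rule arg_cong[where f = sum_list], rule map_cong)
           (use ts in \<open>auto simp: lext_Y_vac\<close>)
      then show ?thesis using 0 by simp
    qed
    then have "(\<Sum>i\<leftarrow>ts. \<phi>1 (laurent_apply (fst i) u $$ m1) * (\<phi>2 (laurent_apply (fst (snd i)) v $$ m2)
        * \<phi>3 (laurent_apply (snd (snd i)) w $$ m3))) = 0"
      by (intro nested_vac_sum_eq_0[OF nondeg]) (use f g h' in auto)
    moreover have "h (\<Sum>(a, b, c)\<leftarrow>ts. (f a * g b) *\<^sub>C c) = (\<Sum>i\<leftarrow>ts. h ((f (fst i) * g (fst (snd i))) *\<^sub>C snd (snd i)))"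
      unfolding case_prod_unfold by (rule clinear_sum_list[OF laurent_functionals_linear[OF h]])
    moreover have "h (z *\<^sub>C a) = z * h a" for z a
      using laurent_functionals_linear[OF h] unfolding clinear_iff by simp
    ultimately show "h (\<Sum>(a, b, c)\<leftarrow>ts. (f a * g b) *\<^sub>C c) = 0"
      by (simp add: f(1) g(1) h'(1) mult.assoc)
  qed
qed

text \<open>The vacuum is inserted as a third factor, which reduces pairs to the three-factor
  statement \<open>nested_vac_sum_eq_0\<close>.\<close>

lemma pair_list_eq_0:
  assumes ps: "set ps \<subseteq> B \<times> B"
    and 0: "\<And>v w q. (\<Sum>(b, c)\<leftarrow>ps. Yq Y (laurent_apply b v) (laurent_apply c w) q) = 0"
  shows "(\<Sum>(b, c)\<leftarrow>ps. b \<otimes> c) = 0"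
proof (rule tensor_list_eq_0[OF laurent_functionals_separate laurent_functionals_linear])
  fix f :: "'a laurent_hom \<Rightarrow> complex" assume f0: "f \<in> laurent_functionals"
  show "(\<Sum>(b, c)\<leftarrow>ps. f b *\<^sub>C c) = 0"
  proof (rule laurent_functionals_separate)
    fix g :: "'a laurent_hom \<Rightarrow> complex" assume g0: "g \<in> laurent_functionals"
    obtain \<phi>1 u m1 where f: "f = (\<lambda>a. \<phi>1 (laurent_apply a u $$ m1))" "clinear \<phi>1"
      using f0 by (auto simp: laurent_functionals_def)
    obtain \<phi>2 v m2 where g: "g = (\<lambda>a. \<phi>2 (laurent_apply a v $$ m2))" "clinear \<phi>2"
      using g0 by (auto simp: laurent_functionals_def)
    \<comment> \<open>This functional evaluates the extra factor, and its nonzero value is cancelled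
      at the end.\<close>
    obtain \<phi>3 :: "'a \<Rightarrow> complex" where \<phi>3: "clinear \<phi>3" "\<phi>3 vac \<noteq> 0"
      using separating_functional[of vac] vac_nonzero by blast
    have "(\<Sum>i\<leftarrow>ps. nested (laurent_apply (fst i) u) (laurent_apply (snd i) v)
        (Yq Y (fls_const vac) (fls_const vac) r) s t) = 0" for s t r
    \<comment> \<open>Y(1,y)1 = 1 has no coefficient other than the one at y^0.\<close>
    proof (cases "r = 0")
      case True
      have "(\<Sum>i\<leftarrow>ps. nested (laurent_apply (fst i) u) (laurent_apply (snd i) v)
        (Yq Y (fls_const vac) (fls_const vac) r) s t)
        = (\<Sum>(b, c)\<leftarrow>ps. Yq Y (laurent_apply b u) (laurent_apply c (Y v vac $$ t)) s)"
        by (rule arg_cong[where f = sum_list], rule map_cong)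
           (use ps True in \<open>auto simp: lext_Y_vac nested_def Yq_vac_left\<close>)
      then show ?thesis using 0 by simp
    qed (simp add: Yq_vac_left nested_def)
    then have "(\<Sum>i\<leftarrow>ps. \<phi>1 (laurent_apply (fst i) u $$ m1) * (\<phi>2 (laurent_apply (snd i) v $$ m2)
        * \<phi>3 (fls_const vac $$ 0))) = 0"
      by (intro nested_vac_sum_eq_0[OF nondeg]) (use f g \<phi>3 in auto)
    moreover have "(\<Sum>i\<leftarrow>ps. \<phi>1 (laurent_apply (fst i) u $$ m1) * (\<phi>2 (laurent_apply (snd i) v $$ m2)
        * \<phi>3 (fls_const vac $$ 0))) = (\<Sum>i\<leftarrow>ps. f (fst i) * g (snd i)) * \<phi>3 vac"
      by (simp add: f(1) g(1) mult.assoc flip: sum_list_mult_const)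
    moreover have "g (\<Sum>(b, c)\<leftarrow>ps. f b *\<^sub>C c) = (\<Sum>i\<leftarrow>ps. g (f (fst i) *\<^sub>C snd i))"
      unfolding case_prod_unfold by (rule clinear_sum_list[OF laurent_functionals_linear[OF g0]])
    moreover have "g (z *\<^sub>C a) = z * g a" for z a
      using laurent_functionals_linear[OF g0] unfolding clinear_iff by simp
    ultimately show "g (\<Sum>(b, c)\<leftarrow>ps. f b *\<^sub>C c) = 0"
      using \<phi>3(2) by simp
  qed
qed

lemma set_concat_map_subset:
  "(\<And>x. x \<in> set xs \<Longrightarrow> set (h x) \<subseteq> C) \<Longrightarrow> set (concat (map h xs)) \<subseteq> C"
  by (induct xs) auto

lemma B_scale_pairs:
  "set ps \<subseteq> B \<times> C \<Longrightarrow> set (map (\<lambda>(b, c). (z *\<^sub>C b, c)) ps) \<subseteq> B \<times> C"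
  using cvec.subspace_scale[OF subspace_B] by (induct ps) (auto simp del: cvec.scale_minus_left)

lemma sum_scale_pairs:
  assumes "\<And>b c. T (z *\<^sub>C b) c = z *\<^sub>C T b c"
  shows "(\<Sum>(b, c)\<leftarrow>map (\<lambda>(b, c). (z *\<^sub>C b, c)) ps. T b c) = z *\<^sub>C (\<Sum>(b, c)\<leftarrow>ps. T b c)"
  by (induct ps) (auto simp: assms cvec.scale_right_distrib)

text \<open>With the sign of one list changed, the two lists together give a coproduct identity for
  0, and \<open>pair_list_eq_0\<close> makes the difference of the tensors vanish.\<close>

lemma coproduct_unique:
  assumes ps: "set ps \<subseteq> B \<times> B" "coproduct_identity Y a ps"
    and qs: "set qs \<subseteq> B \<times> B" "coproduct_identity Y a qs"
  shows "(\<Sum>(b, c)\<leftarrow>ps. b \<otimes> c) = (\<Sum>(b, c)\<leftarrow>qs. b \<otimes> c)"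
proof -
  define rs where "rs = ps @ map (\<lambda>(b, c). ((-1) *\<^sub>C b, c)) qs"
  have rs: "set rs \<subseteq> B \<times> B"
    unfolding rs_def set_append by (rule Un_least[OF ps(1) B_scale_pairs[OF qs(1)]])
  have id: "coproduct_identity Y (a + (-1) *\<^sub>C a) rs"
    unfolding rs_def by (rule coproduct_identity_add[OF ps(2) coproduct_identity_scale[OF qs(2)]])
  have "a + (-1) *\<^sub>C a = 0" by simp
  then have "(\<Sum>(b, c)\<leftarrow>rs. Yq Y (laurent_apply b v) (laurent_apply c w) q) = 0" for v w q
    using id unfolding coproduct_identity_iff by (metis Yq_const lext_const laurent_apply_simps(4))
  from pair_list_eq_0[OF rs this] have "(\<Sum>(b, c)\<leftarrow>rs. b \<otimes> c) = 0" .
  moreover have "(\<Sum>(b, c)\<leftarrow>rs. b \<otimes> c) = (\<Sum>(b, c)\<leftarrow>ps. b \<otimes> c) + (-1) *\<^sub>C (\<Sum>(b, c)\<leftarrow>qs. b \<otimes> c)"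
    unfolding rs_def map_append sum_list_append sum_scale_pairs[where T = "(\<otimes>)", OF pure_add_scale(3)] ..
  ultimately show ?thesis by simp
qed

text \<open>The choice is harmless: by \<open>coproduct_unique\<close> the associated tensor does
  not depend on it.\<close>

definition coproduct_list :: "'a laurent_hom \<Rightarrow> ('a laurent_hom \<times> 'a laurent_hom) list" where
  "coproduct_list a = (SOME ps. set ps \<subseteq> B \<times> B \<and> coproduct_identity Y a ps)"

definition comult :: "'a laurent_hom \<Rightarrow> ('a laurent_hom, 'a laurent_hom) tensor" where
  "comult a = (\<Sum>(b, c)\<leftarrow>coproduct_list a. b \<otimes> c)"

lemma coproduct_list:
  assumes "a \<in> B"
  shows "set (coproduct_list a) \<subseteq> B \<times> B" "coproduct_identity Y a (coproduct_list a)"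
  using someI_ex[OF B_coproduct[OF assms]] unfolding coproduct_list_def by auto

lemma comult_eqI:
  assumes "a \<in> B" "set ps \<subseteq> B \<times> B" "coproduct_identity Y a ps"
  shows "comult a = (\<Sum>(b, c)\<leftarrow>ps. b \<otimes> c)"
  unfolding comult_def by (rule coproduct_unique[OF coproduct_list[OF assms(1)] assms(2,3)])

lemma comult_linear: "clinear_on B comult"
  unfolding clinear_on_def
proof (intro conjI ballI allI)
  fix x y c assume x: "x \<in> B" and y: "y \<in> B"
  have "comult (x + y) = (\<Sum>(b, c)\<leftarrow>coproduct_list x @ coproduct_list y. b \<otimes> c)"
    by (rule comult_eqI[OF cvec.subspace_add[OF subspace_B x y] _
          coproduct_identity_add[OF coproduct_list(2)[OF x] coproduct_list(2)[OF y]]])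
       (use coproduct_list(1)[OF x] coproduct_list(1)[OF y] in auto)
  then show "comult (x + y) = comult x + comult y" by (simp add: comult_def)
next
  fix c x assume x: "x \<in> B"
  have scale: "(\<Sum>(b, d)\<leftarrow>map (\<lambda>(b, d). (c *\<^sub>C b, d)) qs. b \<otimes> d) = c *\<^sub>C (\<Sum>(b, d)\<leftarrow>qs. b \<otimes> d)"
    for qs :: "('a laurent_hom \<times> 'a laurent_hom) list"
    by (induct qs) (auto simp: pure_add_scale cvec.scale_right_distrib)
  have "comult (c *\<^sub>C x) = (\<Sum>(b, d)\<leftarrow>map (\<lambda>(b, d). (c *\<^sub>C b, d)) (coproduct_list x). b \<otimes> d)"
    by (rule comult_eqI[OF cvec.subspace_scale[OF subspace_B x] _ coproduct_identity_scale[OF coproduct_list(2)[OF x]]])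
       (rule B_scale_pairs[OF coproduct_list(1)[OF x]])
  also have "\<dots> = c *\<^sub>C (\<Sum>(b, d)\<leftarrow>coproduct_list x. b \<otimes> d)"
    using scale .
  finally show "comult (c *\<^sub>C x) = c *\<^sub>C comult x" by (simp add: comult_def)
qed

lemma counit_linear: "clinear_on B counit"
  unfolding clinear_on_def
  by (auto intro!: counit_eqI simp: counit fls_const_scaleC fls_const_add cvec.scale_left_distrib)

lemma comult_lift:
  assumes "a \<in> B" "cbilinear_on B B f"
  shows "tensor_lift_on B B f (comult a) = (\<Sum>(b, c)\<leftarrow>coproduct_list a. f b c)"
  unfolding comult_def
  by (rule tensor_lift_on_eq[OF subspace_B subspace_B assms(2) coproduct_list(1)[OF assms(1)]])

text \<open>\<open>coassociativity_series\<close> compares the two iterated coproducts as operators,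
  and \<open>triple_list_eq_0\<close> turns this into an equality of tensors. For this both are
  written as sums over triples.\<close>

lemma comult_coassoc:
  assumes a: "a \<in> B"
  shows "tensor_assoc (tensor_lift_on B B (\<lambda>b c. comult b \<otimes> c) (comult a))
       = tensor_lift_on B B (\<lambda>b c. b \<otimes> comult c) (comult a)"
proof -
  define ps where "ps = coproduct_list a"
  have ps: "set ps \<subseteq> B \<times> B" "coproduct_identity Y a ps"
    using coproduct_list[OF a] by (simp_all add: ps_def)
  have bil: "cbilinear_on B B (\<lambda>b c. comult b \<otimes> c)" "cbilinear_on B B (\<lambda>b c. b \<otimes> comult c)"
    using comult_linear by (simp_all add: cbilinear_on_def clinear_on_def pure_add_scale)
  define L where "L = concat (map (\<lambda>(b, c). map (\<lambda>(b1, b2). (b1, b2, c)) (coproduct_list b)) ps)"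
  define R where "R = concat (map (\<lambda>(b, c). map (\<lambda>(c1, c2). (b, c1, c2)) (coproduct_list c)) ps)"
  have L: "(\<Sum>(x, y, z)\<leftarrow>L. f x y z) = (\<Sum>(b, c)\<leftarrow>ps. \<Sum>(b1, b2)\<leftarrow>coproduct_list b. f b1 b2 c)" for f :: "_ \<Rightarrow> _ \<Rightarrow> _ \<Rightarrow> 'c::comm_monoid_add"
    unfolding L_def sum_list_concat_map by (simp add: o_def case_prod_unfold)
  have R: "(\<Sum>(x, y, z)\<leftarrow>R. f x y z) = (\<Sum>(b, c)\<leftarrow>ps. \<Sum>(c1, c2)\<leftarrow>coproduct_list c. f b c1 c2)" for f :: "_ \<Rightarrow> _ \<Rightarrow> _ \<Rightarrow> 'c::comm_monoid_add"
    unfolding R_def sum_list_concat_map by (simp add: o_def case_prod_unfold)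
  \<comment> \<open>This list represents the difference of the two sides, with the sign on the first
    entry.\<close>
  define ts where "ts = L @ map (\<lambda>(x, yz). ((-1) *\<^sub>C x, yz)) R"
  have LR: "set L \<subseteq> B \<times> B \<times> B" "set R \<subseteq> B \<times> B \<times> B"
  proof -
    have *: "set (map (\<lambda>(b1, b2). (b1, b2, c)) (coproduct_list b)) \<subseteq> B \<times> B \<times> B"
      "set (map (\<lambda>(c1, c2). (b, c1, c2)) (coproduct_list c)) \<subseteq> B \<times> B \<times> B" if "(b, c) \<in> set ps" for b c
    proof -
      have bc: "b \<in> B" "c \<in> B" using that ps(1) by auto
      show "set (map (\<lambda>(b1, b2). (b1, b2, c)) (coproduct_list b)) \<subseteq> B \<times> B \<times> B"
        using coproduct_list(1)[OF bc(1)] bc(2) by auto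
      show "set (map (\<lambda>(c1, c2). (b, c1, c2)) (coproduct_list c)) \<subseteq> B \<times> B \<times> B"
        using coproduct_list(1)[OF bc(2)] bc(1) by auto
    qed
    show "set L \<subseteq> B \<times> B \<times> B" unfolding L_def
      by (rule set_concat_map_subset, unfold split_paired_all, drule *(1), simp only: prod.case)
    show "set R \<subseteq> B \<times> B \<times> B" unfolding R_def
      by (rule set_concat_map_subset, unfold split_paired_all, drule *(2), simp only: prod.case)
  qed
  have ts0: "(\<Sum>(x, y, z)\<leftarrow>ts. x \<otimes> (y \<otimes> z)) = 0"
  proof (rule triple_list_eq_0)
    show "set ts \<subseteq> B \<times> B \<times> B"
      unfolding ts_def set_append by (rule Un_least[OF LR(1) B_scale_pairs[OF LR(2)]])
    fix u v w s t
    let ?N = "\<lambda>x y z. nested (laurent_apply x u) (laurent_apply y v) (laurent_apply z w) s t"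
    \<comment> \<open>A triple is read as x paired with (y, w'), so that the rule for scaling first
      components applies.\<close>
    have N: "(case yz of (y, w') \<Rightarrow> ?N (k *\<^sub>C x) y w') = k *\<^sub>C (case yz of (y, w') \<Rightarrow> ?N x y w')" for k x yz
      by (simp add: nested_def Yq_scale split: prod.split)
    have "(\<Sum>(x, y, z)\<leftarrow>ts. ?N x y z) = (\<Sum>(x, y, z)\<leftarrow>L. ?N x y z) + (-1) *\<^sub>C (\<Sum>(x, y, z)\<leftarrow>R. ?N x y z)"
      unfolding ts_def map_append sum_list_append sum_scale_pairs[where T = "\<lambda>x yz. case yz of (y, w') \<Rightarrow> ?N x y w'", OF N] ..
    moreover have "(\<Sum>(x, y, z)\<leftarrow>L. ?N x y z) = (\<Sum>(x, y, z)\<leftarrow>R. ?N x y z)"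
    proof -
      have "coproduct_identity Y b (coproduct_list b) \<and> coproduct_identity Y c (coproduct_list c)"
        if "(b, c) \<in> set ps" for b c
        using that ps(1) coproduct_list(2) by blast
      from coassociativity_series[where Q = coproduct_list and ps = ps and u = u and v = v and w = w
          and s = s and t = t, OF ps(2) this]
      have "(\<Sum>(b, c)\<leftarrow>ps. \<Sum>(b1, b2)\<leftarrow>coproduct_list b. ?N b1 b2 c)
          = (\<Sum>(b, c)\<leftarrow>ps. \<Sum>(c1, c2)\<leftarrow>coproduct_list c. ?N b c1 c2)" .
      then show ?thesis by (simp only: L[of ?N] R[of ?N])
    qed
    ultimately show "(\<Sum>(x, y, z)\<leftarrow>ts. ?N x y z) = 0" by simp
  qed
  have T: "(case yz of (y, z) \<Rightarrow> (k *\<^sub>C x) \<otimes> (y \<otimes> z)) = k *\<^sub>C (case yz of (y, z) \<Rightarrow> x \<otimes> (y \<otimes> z))"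
    for k and x :: "'a laurent_hom" and yz :: "'a laurent_hom \<times> 'a laurent_hom"
    by (simp add: pure_add_scale split: prod.split)
  have "(\<Sum>(x, y, z)\<leftarrow>ts. x \<otimes> (y \<otimes> z)) = (\<Sum>(x, y, z)\<leftarrow>L. x \<otimes> (y \<otimes> z)) + (-1) *\<^sub>C (\<Sum>(x, y, z)\<leftarrow>R. x \<otimes> (y \<otimes> z))"
    unfolding ts_def map_append sum_list_append sum_scale_pairs[where T = "\<lambda>x yz. case yz of (y, z) \<Rightarrow> x \<otimes> (y \<otimes> z)", OF T] ..
  with ts0 have eq: "(\<Sum>(x, y, z)\<leftarrow>L. x \<otimes> (y \<otimes> z)) = (\<Sum>(x, y, z)\<leftarrow>R. x \<otimes> (y \<otimes> z))"
    by simp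
  have "tensor_assoc (tensor_lift_on B B (\<lambda>b c. comult b \<otimes> c) (comult a))
      = (\<Sum>(b, c)\<leftarrow>ps. \<Sum>(b1, b2)\<leftarrow>coproduct_list b. b1 \<otimes> (b2 \<otimes> c))"
    unfolding comult_lift[OF a bil(1)] ps_def[symmetric]
    by (simp add: comult_def pure_sum_list clinear_sum_list[OF clinear_tensor_assoc] tensor_assoc_pure
        case_prod_unfold)
  moreover have "tensor_lift_on B B (\<lambda>b c. b \<otimes> comult c) (comult a)
      = (\<Sum>(b, c)\<leftarrow>ps. \<Sum>(c1, c2)\<leftarrow>coproduct_list c. b \<otimes> (c1 \<otimes> c2))"
    unfolding comult_lift[OF a bil(2)] ps_def[symmetric]
    by (simp add: comult_def pure_sum_list case_prod_unfold)
  ultimately show ?thesis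
    using eq L[of "\<lambda>x y z. x \<otimes> (y \<otimes> z)"] R[of "\<lambda>x y z. x \<otimes> (y \<otimes> z)"] by simp
qed

text \<open>For 1, products and derivatives, a list with the required tensor is already known to
  satisfy the coproduct identity, so \<open>comult_eqI\<close> gives the axiom.\<close>

lemma differential_bialgebra_B: "differential_bialgebra B comult counit laurent_ddx"
proof unfold_locales
  show "cvec.subspace B" by (rule subspace_B)
  show "1 \<in> B" by (rule B_one)
  show "clinear_on B comult" by (rule comult_linear)
  show "clinear_on B counit" by (rule counit_linear)
  show "comult 1 = 1"
    using comult_eqI[OF B_one _ coproduct_identity_one] B_one by (simp add: one_tensor_def)
  show "counit 1 = 1" by (rule counit_eqI) simp
  show "clinear_on B laurent_ddx" by (simp add: clinear_on_def laurent_ddx_linear)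
  fix a b assume a: "a \<in> B"
  show "laurent_ddx a \<in> B" using a by (rule B_ddx)
  show "counit (laurent_ddx a) = 0"
    by (rule counit_eqI) (simp add: vac_eigen_ddx[OF B_vac_eigen[OF a]])
  show "comult a \<in> B \<otimes>\<^sub>S B"
    unfolding comult_def tensor_sub_def
    by (rule subspace_sum_list) (use coproduct_list(1)[OF a] in \<open>auto intro!: cvec.span_base\<close>)
  show "tensor_assoc (tensor_lift_on B B (\<lambda>b c. comult b \<otimes> c) (comult a))
       = tensor_lift_on B B (\<lambda>b c. b \<otimes> comult c) (comult a)"
    by (rule comult_coassoc[OF a])
  have cu: "laurent_apply b vac = fls_const (counit b *\<^sub>C vac)" "laurent_apply c vac = fls_const (counit c *\<^sub>C vac)"
    if "(b, c) \<in> set (coproduct_list a)" for b c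
    using that coproduct_list(1)[OF a] counit by blast+
  show "tensor_lift_on B B (\<lambda>b c. counit b *\<^sub>C c) (comult a) = a"
    by (subst comult_lift[OF a])
       (use counit_linear counit_law_left[OF coproduct_list(2)[OF a] cu(1)] in
        \<open>auto simp: cbilinear_on_def clinear_on_def cvec.scale_left_distrib cvec.scale_right_distrib mult.commute\<close>)
  show "tensor_lift_on B B (\<lambda>b c. counit c *\<^sub>C b) (comult a) = a"
    by (subst comult_lift[OF a])
       (use counit_linear counit_law_right[OF coproduct_list(2)[OF a] cu(2)] in
        \<open>auto simp: cbilinear_on_def clinear_on_def cvec.scale_left_distrib cvec.scale_right_distrib mult.commute\<close>)
  show "comult (laurent_ddx a) = tensor_lift_on B B (\<lambda>b c. laurent_ddx b \<otimes> c + b \<otimes> laurent_ddx c) (comult a)"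
  proof -
    have "cbilinear_on B B (\<lambda>b c. laurent_ddx b \<otimes> c + b \<otimes> laurent_ddx c)"
      by (simp add: cbilinear_on_def clinear_on_def laurent_ddx_linear pure_add_scale cvec.scale_right_distrib add_ac)
    moreover have "comult (laurent_ddx a) = (\<Sum>(b, c)\<leftarrow>map (\<lambda>(b, c). (laurent_ddx b, c)) (coproduct_list a)
        @ map (\<lambda>(b, c). (b, laurent_ddx c)) (coproduct_list a). b \<otimes> c)"
      by (rule comult_eqI[OF B_ddx[OF a] _ coproduct_identity_ddx[OF coproduct_list(2)[OF a]]],
          rule coproduct_ddx_subset[OF coproduct_list(1)[OF a]]) (auto intro: B_ddx)
    ultimately show ?thesis
      by (simp add: comult_lift[OF a] o_def case_prod_unfold sum_list_addf)
  qed
  assume b: "b \<in> B"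
  show "a * b \<in> B" using a b by (rule B_mult)
  show "counit (a * b) = counit a * counit b"
  proof (rule counit_eqI)
    have "laurent_apply (a * b) vac = counit b *\<^sub>C fls_const (counit a *\<^sub>C vac)"
      by (simp add: laurent_apply_mult counit[OF a] counit[OF b])
    then show "laurent_apply (a * b) vac = fls_const ((counit a * counit b) *\<^sub>C vac)"
      by (simp add: fls_const_scaleC mult.commute)
  qed
  show "laurent_ddx (a * b) = laurent_ddx a * b + a * laurent_ddx b" by (rule laurent_ddx_mult)
  show "comult (a * b) = comult a * comult b"
  proof -
    have "set [(b1 * c1, b2 * c2). (b1, b2) \<leftarrow> coproduct_list a, (c1, c2) \<leftarrow> coproduct_list b] \<subseteq> B \<times> B"
      using coproduct_list(1)[OF a] coproduct_list(1)[OF b] by (auto intro!: B_mult)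
    from comult_eqI[OF B_mult[OF a b] this coproduct_identity_mult[OF coproduct_list(2)[OF a] coproduct_list(2)[OF b]]]
    show ?thesis unfolding comult_def tensor_mult_sum_list .
  qed
qed

text \<open>Uniqueness of the coproduct gives one inclusion; the other reads a coproduct identity
  off the equality of tensors.\<close>

lemma PDer_eq: "PDer Y = {a \<in> B. comult a = a \<otimes> 1 + 1 \<otimes> a}"
proof (intro set_eqI iffI)
  fix a assume a: "a \<in> PDer Y"
  then have aB: "a \<in> B" using PDer_subset by blast
  from a have "comult a = (\<Sum>(b, c)\<leftarrow>[(a, 1), (1, a)]. b \<otimes> c)"
    unfolding PDer_iff by (intro comult_eqI[OF aB]) (use aB B_one in auto)
  then show "a \<in> {a \<in> B. comult a = a \<otimes> 1 + 1 \<otimes> a}" using aB by simp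
next
  fix a assume "a \<in> {a \<in> B. comult a = a \<otimes> 1 + 1 \<otimes> a}"
  then have "a \<in> B" "(\<Sum>(b, c)\<leftarrow>coproduct_list a. b \<otimes> c) = (\<Sum>(b, c)\<leftarrow>[(a, 1), (1, a)]. b \<otimes> c)"
    by (simp_all add: comult_def)
  then show "a \<in> PDer Y"
    unfolding PDer_iff using coproduct_identity_tensor coproduct_list(2) by blast
qed

lemma PEnd_eq: "PEnd Y vac = {a \<in> B. a \<noteq> 0 \<and> comult a = a \<otimes> a}"
proof (intro set_eqI iffI)
  fix a assume a: "a \<in> PEnd Y vac"
  then have aB: "a \<in> B" using PEnd_subset by blast
  from a have "comult a = (\<Sum>(b, c)\<leftarrow>[(a, a)]. b \<otimes> c)"
    unfolding PEnd_iff by (intro comult_eqI[OF aB]) (use aB in auto)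
  moreover have "a \<noteq> 0" using a vac_nonzero by (auto simp: PEnd_iff)
  ultimately show "a \<in> {a \<in> B. a \<noteq> 0 \<and> comult a = a \<otimes> a}" using aB by simp
next
  fix a assume "a \<in> {a \<in> B. a \<noteq> 0 \<and> comult a = a \<otimes> a}"
  then have a: "a \<in> B" "a \<noteq> 0" "(\<Sum>(b, c)\<leftarrow>coproduct_list a. b \<otimes> c) = (\<Sum>(b, c)\<leftarrow>[(a, a)]. b \<otimes> c)"
    by (simp_all add: comult_def)
  then have id: "coproduct_identity Y a [(a, a)]"
    using coproduct_identity_tensor coproduct_list(2) by blast
  \<comment> \<open>The counit law gives \<epsilon>(a)a = a, and a \<noteq> 0 forces \<epsilon>(a) =
    1. This is the vacuum condition in \<open>PEnd\<close>, which the equation for the coproduct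
    does not contain.\<close>
  from counit_law_right[OF this, of counit] counit[OF a(1)] have "counit a *\<^sub>C a = a" by simp
  then have "(counit a - 1) *\<^sub>C a = 0" by (simp add: cvec.scale_left_diff_distrib)
  then have "counit a = 1" using a(2) by simp
  then show "a \<in> PEnd Y vac" unfolding PEnd_iff using id counit[OF a(1)] by simp
qed

lemma is_counit_counit: "is_counit Y vac counit"
  by (simp add: is_counit_def counit)

lemma is_comultiplication_comult: "is_comultiplication Y vac comult"
  unfolding is_comultiplication_def
proof
  fix a assume "a \<in> B"
  from coproduct_list[OF this] show "\<exists>ps. set ps \<subseteq> B \<times> B \<and> coproduct_identity Y a ps
      \<and> comult a = (\<Sum>(b, c)\<leftarrow>ps. b \<otimes> c)"
    by (intro exI[of _ "coproduct_list a"] conjI) (simp_all only: comult_def)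
qed

lemma is_counit_unique:
  assumes "is_counit Y vac \<epsilon>" "a \<in> B" shows "\<epsilon> a = counit a"
  by (rule counit_eqI[symmetric]) (use assms in \<open>simp add: is_counit_def\<close>)

lemma is_comultiplication_unique:
  assumes "is_comultiplication Y vac \<Delta>" "a \<in> B" shows "\<Delta> a = comult a"
proof -
  obtain ps where "set ps \<subseteq> B \<times> B" "coproduct_identity Y a ps" "\<Delta> a = (\<Sum>(b, c)\<leftarrow>ps. b \<otimes> c)"
    using assms unfolding is_comultiplication_def by blast
  with comult_eqI[OF assms(2)] show ?thesis by simp
qed

end

theorem theorem3p8:
  fixes Y :: "'v::complex_vector \<Rightarrow> 'v \<Rightarrow> 'v fls" and vac :: 'v
  assumes "nonlocal_vertex_algebra Y vac"
    and "nondegenerate Y vac"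
    and "\<exists>v::'v. v \<noteq> 0"
  shows "\<exists>\<Delta> \<epsilon>.
     is_counit Y vac \<epsilon> \<and> is_comultiplication Y vac \<Delta> \<and>
     (\<forall>\<epsilon>'. is_counit Y vac \<epsilon>' \<longrightarrow> (\<forall>a\<in>B_space Y vac. \<epsilon>' a = \<epsilon> a)) \<and>
     (\<forall>\<Delta>'. is_comultiplication Y vac \<Delta>' \<longrightarrow> (\<forall>a\<in>B_space Y vac. \<Delta>' a = \<Delta> a)) \<and>
     differential_bialgebra (B_space Y vac) \<Delta> \<epsilon> laurent_ddx \<and>
     PDer Y = {a \<in> B_space Y vac. \<Delta> a = a \<otimes> 1 + 1 \<otimes> a} \<and>
     PEnd Y vac = {a \<in> B_space Y vac. a \<noteq> 0 \<and> \<Delta> a = a \<otimes> a}"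
proof -
  interpret nondegenerate_vertex_algebra Y vac
    using assms by (simp add: nondegenerate_vertex_algebra_def nondegenerate_vertex_algebra_axioms_def)
  show ?thesis
    by (rule exI[of _ comult], rule exI[of _ counit])
       (intro conjI allI impI ballI is_counit_counit is_comultiplication_comult is_counit_unique
         is_comultiplication_unique differential_bialgebra_B PDer_eq PEnd_eq)
qed

end
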